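(* Let $k$ be a field of characteristic $0$, let $L$ be a Lie superalgebra over $k$ with bracket $[\cdot,\cdot]$, and let $\sigma:L\times L\to k$ be a 2-cocycle. Let $\mathfrak g=L^0\rtimes_{\mathrm{ad}}L$ with the extended cocycle $\sigma_{\mathfrak g}$, let $U_{\sigma_{\mathfrak g}}(\mathfrak g)$ be the Sridharan superalgebra of $(\mathfrak g,\sigma_{\mathfrak g})$ with canonical map $\iota:\mathfrak g\to U_{\sigma_{\mathfrak g}}(\mathfrak g)$, let $\alpha:PS_\sigma(L)\to U_{\sigma_{\mathfrak g}}(\mathfrak g)$ be the even superalgebra homomorphism with $\alpha(x)=\iota(x^0)$ for $x\in L$, and let $\beta:PS_\sigma(L)\to U_{\sigma_{\mathfrak g}}(\mathfrak g)$ be the even $\alpha$-superderivation with $\beta(x)=\iota(x^1)$ for $x\in L$. Then the triple $(U_{\sigma_{\mathfrak g}}(\mathfrak g),\alpha,\beta)$ is the universal enveloping algebra of the Poisson symplectic superalgebra $PS_\sigma(L)$.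
   Context: Super objects are $\mathbb Z_2$-graded over $k$, $|\cdot|$ denotes parity, and formulas are for homogeneous elements. Superalgebras are associative, unital, $\mathbb Z_2$-graded; supercommutative means $ab=(-1)^{|a||b|}ba$. For a superalgebra $B$, $[a,b]_{gr}=ab-(-1)^{|a||b|}ba$ and $B_L=(B,[\cdot,\cdot]_{gr})$. A Lie superalgebra has an even bilinear bracket with $\{x,y\}=-(-1)^{|x||y|}\{y,x\}$ and $\{x,\{y,z\}\}+(-1)^{|x|(|y|+|z|)}\{y,\{z,x\}\}+(-1)^{|z|(|x|+|y|)}\{z,\{x,y\}\}=0$. A Poisson superalgebra is a supercommutative superalgebra with a Lie superalgebra bracket satisfying $\{x,yz\}=(-1)^{|x||y|}y\{x,z\}+\{x,y\}z$. 2-cocycle on $L$: a bilinear form $\sigma:L\times L\to k$ with $\sigma(x,y)=-(-1)^{|x||y|}\sigma(y,x)$; $\sigma([x,y],z)+(-1)^{|z|(|x|+|y|)}\sigma([z,x],y)+(-1)^{|x|(|y|+|z|)}\sigma([y,z],x)=0$; and $\sigma(x,y)=0$ if $|x|+|y|=1$. $PS_\sigma(L)$ is the supersymmetric superalgebra $S(L)=T(L)/(x\otimes y-(-1)^{|x||y|}y\otimes x)$ with the Poisson bracket extending $\{x,y\}_\sigma=[x,y]+\sigma(x,y)$ ($x,y\in L$) as a bisuperderivation. $L^0$ is the abelian Lie superalgebra on the super vector space $L$, $\mathrm{ad}(x)(u)=[x,u]$ for $x\in L,u\in L^0$, and $\mathfrak g=L^0\oplus L$ has bracket $[u+x,v+y]=(\mathrm{ad}(x)(v)-(-1)^{|u||y|}\mathrm{ad}(y)(u))+[x,y]$.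 For $x\in L$, $x^0$ and $x^1$ denote the images of $x$ in the summands $L^0$ and $L$ of $\mathfrak g$. The cocycle $\sigma_{\mathfrak g}$ is given by $\sigma_{\mathfrak g}(x^0,y^0)=\sigma_{\mathfrak g}(x^1,y^1)=0$ and $\sigma_{\mathfrak g}(x^0,y^1)=\sigma_{\mathfrak g}(x^1,y^0)=\sigma(x,y)$. $U_{\sigma_{\mathfrak g}}(\mathfrak g)=T(\mathfrak g)/J_\sigma$, with $J_\sigma$ the two-sided ideal generated by $x\otimes y-(-1)^{|x||y|}y\otimes x-[x,y]_{\mathfrak g}-\sigma_{\mathfrak g}(x,y)$, $x,y\in\mathfrak g$. An even $\alpha$-superderivation is an even linear map $\beta$ with $\beta(ab)=\alpha(a)\beta(b)+(-1)^{|a||b|}\alpha(b)\beta(a)$. A triple $(B,\alpha,\beta)$ satisfies property P with respect to a Poisson superalgebra $R$ if $B$ is a superalgebra, $\alpha:R\to B$ is an even superalgebra homomorphism, $\beta:R\to B_L$ is an even Lie superalgebra homomorphism, $\alpha(\{x,y\})=[\beta(x),\alpha(y)]_{gr}$, and $\beta$ is an even $\alpha$-superderivation. The universal enveloping algebra of $R$ is the triple $(U(R),m,h)$ universal with respect to property P: it satisfies property P and for any $(B,\gamma,\delta)$ with property P there is a unique superalgebra homomorphism $\phi:U(R)\to B$ with $\phi m=\gamma$, $\phi h=\delta$. *)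

theory Defs
  imports "HOL-Algebra.Module" "HOL-Algebra.QuotRing" "HOL-Library.Z2"
begin

section \<open>Super vector spaces, superalgebras, Lie and Poisson superalgebras\<close>

text \<open>
  All structures are records over a field record \<^term>\<open>K\<close>, in the style of the HOL-Algebra theory of modules.
  The homogeneous component of parity \<^term>\<open>p\<close> (of type \<^typ>\<open>bit\<close>, the integers mod 2) is the set
  \<open>part V p\<close>; the zero element lies in both components.
  As usual for modules in HOL-Algebra, the ring fields \<open>mult\<close> and \<open>one\<close> carry no meaning when the
  record is only used as a (super) vector space or as a Lie superalgebra.
\<close>

record ('k, 'a) super = "('k, 'a) module" +
  part :: "bit \<Rightarrow> 'a set"

record ('k, 'a) bsuper = "('k, 'a) super" +
  bracket :: "'a \<Rightarrow> 'a \<Rightarrow> 'a" (\<open>\<lbrace>_, _\<rbrace>\<index>\<close>)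

text \<open>\<open>sgnmul M p x\<close> is \<open>(-1)\<^sup>p x\<close>.\<close>

definition sgnmul :: "('a, 'm) ring_scheme \<Rightarrow> bit \<Rightarrow> 'a \<Rightarrow> 'a" where
  "sgnmul M p x = (if p = 1 then \<ominus>\<^bsub>M\<^esub> x else x)"

definition char_zero :: "('k, 'm) ring_scheme \<Rightarrow> bool" where
  "char_zero K \<longleftrightarrow> (\<forall>n::nat. n \<noteq> 0 \<longrightarrow> [n] \<cdot>\<^bsub>K\<^esub> \<one>\<^bsub>K\<^esub> \<noteq> \<zero>\<^bsub>K\<^esub>)"

definition linear_map ::
  "('k, 'm) ring_scheme \<Rightarrow> ('k, 'a, 'r) module_scheme \<Rightarrow> ('k, 'b, 's) module_scheme \<Rightarrow> ('a \<Rightarrow> 'b) \<Rightarrow> bool" where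
  "linear_map K V W f \<longleftrightarrow>
     f \<in> carrier V \<rightarrow> carrier W \<and>
     (\<forall>x\<in>carrier V. \<forall>y\<in>carrier V. f (x \<oplus>\<^bsub>V\<^esub> y) = f x \<oplus>\<^bsub>W\<^esub> f y) \<and>
     (\<forall>c\<in>carrier K. \<forall>x\<in>carrier V. f (c \<odot>\<^bsub>V\<^esub> x) = c \<odot>\<^bsub>W\<^esub> f x)"

definition bilinear_map ::
  "('k, 'm) ring_scheme \<Rightarrow> ('k, 'a, 'r) module_scheme \<Rightarrow> ('k, 'b, 's) module_scheme \<Rightarrow> ('a \<Rightarrow> 'a \<Rightarrow> 'b) \<Rightarrow> bool" where
  "bilinear_map K V W f \<longleftrightarrow>
     (\<forall>x\<in>carrier V. linear_map K V W (\<lambda>y. f x y)) \<and>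
     (\<forall>y\<in>carrier V. linear_map K V W (\<lambda>x. f x y))"

definition self_module :: "('k, 'm) ring_scheme \<Rightarrow> ('k, 'k) module" where
  "self_module K = \<lparr>carrier = carrier K, mult = mult K, one = one K, zero = zero K, add = add K,
     smult = mult K\<rparr>"

definition even_linear ::
  "('k, 'm) ring_scheme \<Rightarrow> ('k, 'a, 'r) super_scheme \<Rightarrow> ('k, 'b, 's) super_scheme \<Rightarrow> ('a \<Rightarrow> 'b) \<Rightarrow> bool" where
  "even_linear K V W f \<longleftrightarrow> linear_map K V W f \<and> (\<forall>p. f ` part V p \<subseteq> part W p)"

locale super_space = field K + module K V
  for K :: "('k, 'm) ring_scheme" and V :: "('k, 'a, 'n) super_scheme" +
  assumes part_submodule: "submodule (part V p) K V"
    and part_sum: "part V 0 <+>\<^bsub>V\<^esub> part V 1 = carrier V"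
    and part_inter: "part V 0 \<inter> part V 1 = {\<zero>\<^bsub>V\<^esub>}"

locale superalgebra = super_space K A + ring A
  for K :: "('k, 'm) ring_scheme" and A :: "('k, 'a, 'n) super_scheme" +
  assumes smult_mult_left: "\<lbrakk>c \<in> carrier K; a \<in> carrier A; b \<in> carrier A\<rbrakk>
      \<Longrightarrow> (c \<odot>\<^bsub>A\<^esub> a) \<otimes>\<^bsub>A\<^esub> b = c \<odot>\<^bsub>A\<^esub> (a \<otimes>\<^bsub>A\<^esub> b)"
    and smult_mult_right: "\<lbrakk>c \<in> carrier K; a \<in> carrier A; b \<in> carrier A\<rbrakk>
      \<Longrightarrow> a \<otimes>\<^bsub>A\<^esub> (c \<odot>\<^bsub>A\<^esub> b) = c \<odot>\<^bsub>A\<^esub> (a \<otimes>\<^bsub>A\<^esub> b)"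
    and one_even: "\<one>\<^bsub>A\<^esub> \<in> part A 0"
    and part_mult: "\<lbrakk>a \<in> part A p; b \<in> part A q\<rbrakk> \<Longrightarrow> a \<otimes>\<^bsub>A\<^esub> b \<in> part A (p + q)"

locale supercommutative_superalgebra = superalgebra K A
  for K :: "('k, 'm) ring_scheme" and A :: "('k, 'a, 'n) super_scheme" +
  assumes super_comm: "\<lbrakk>a \<in> part A p; b \<in> part A q\<rbrakk>
      \<Longrightarrow> a \<otimes>\<^bsub>A\<^esub> b = sgnmul A (p * q) (b \<otimes>\<^bsub>A\<^esub> a)"

locale lie_superalgebra = super_space K L
  for K :: "('k, 'm) ring_scheme" and L :: "('k, 'a, 'n) bsuper_scheme" +
  assumes bracket_bilinear: "bilinear_map K L L (bracket L)"
    and bracket_even: "\<lbrakk>x \<in> part L p; y \<in> part L q\<rbrakk> \<Longrightarrow> \<lbrace>x, y\<rbrace>\<^bsub>L\<^esub> \<in> part L (p + q)"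
    and bracket_skew: "\<lbrakk>x \<in> part L p; y \<in> part L q\<rbrakk>
      \<Longrightarrow> \<lbrace>x, y\<rbrace>\<^bsub>L\<^esub> = \<ominus>\<^bsub>L\<^esub> sgnmul L (p * q) \<lbrace>y, x\<rbrace>\<^bsub>L\<^esub>"
    and bracket_jacobi: "\<lbrakk>x \<in> part L p; y \<in> part L q; z \<in> part L r\<rbrakk>
      \<Longrightarrow> \<lbrace>x, \<lbrace>y, z\<rbrace>\<^bsub>L\<^esub>\<rbrace>\<^bsub>L\<^esub>
          \<oplus>\<^bsub>L\<^esub> sgnmul L (p * (q + r)) \<lbrace>y, \<lbrace>z, x\<rbrace>\<^bsub>L\<^esub>\<rbrace>\<^bsub>L\<^esub>
          \<oplus>\<^bsub>L\<^esub> sgnmul L (r * (p + q)) \<lbrace>z, \<lbrace>x, y\<rbrace>\<^bsub>L\<^esub>\<rbrace>\<^bsub>L\<^esub> = \<zero>\<^bsub>L\<^esub>"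

locale poisson_superalgebra = supercommutative_superalgebra K R + lie_superalgebra K R
  for K :: "('k, 'm) ring_scheme" and R :: "('k, 'a, 'n) bsuper_scheme" +
  assumes leibniz: "\<lbrakk>x \<in> part R p; y \<in> part R q; z \<in> part R r\<rbrakk>
      \<Longrightarrow> \<lbrace>x, y \<otimes>\<^bsub>R\<^esub> z\<rbrace>\<^bsub>R\<^esub> =
          sgnmul R (p * q) (y \<otimes>\<^bsub>R\<^esub> \<lbrace>x, z\<rbrace>\<^bsub>R\<^esub>) \<oplus>\<^bsub>R\<^esub> \<lbrace>x, y\<rbrace>\<^bsub>R\<^esub> \<otimes>\<^bsub>R\<^esub> z"

definition super_hom ::
  "('k, 'm) ring_scheme \<Rightarrow> ('k, 'a, 'r) super_scheme \<Rightarrow> ('k, 'b, 's) super_scheme \<Rightarrow> ('a \<Rightarrow> 'b) \<Rightarrow> bool" where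
  "super_hom K A B f \<longleftrightarrow>
     even_linear K A B f \<and>
     (\<forall>x\<in>carrier A. \<forall>y\<in>carrier A. f (x \<otimes>\<^bsub>A\<^esub> y) = f x \<otimes>\<^bsub>B\<^esub> f y) \<and>
     f \<one>\<^bsub>A\<^esub> = \<one>\<^bsub>B\<^esub>"

definition lie_super_hom ::
  "('k, 'm) ring_scheme \<Rightarrow> ('k, 'a, 'r) bsuper_scheme \<Rightarrow> ('k, 'b, 's) bsuper_scheme \<Rightarrow> ('a \<Rightarrow> 'b) \<Rightarrow> bool" where
  "lie_super_hom K L M f \<longleftrightarrow>
     even_linear K L M f \<and>
     (\<forall>x\<in>carrier L. \<forall>y\<in>carrier L. f \<lbrace>x, y\<rbrace>\<^bsub>L\<^esub> = \<lbrace>f x, f y\<rbrace>\<^bsub>M\<^esub>)"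

definition even_superderivation ::
  "('k, 'm) ring_scheme \<Rightarrow> ('k, 'a, 'r) super_scheme \<Rightarrow> ('k, 'b, 's) super_scheme \<Rightarrow> ('a \<Rightarrow> 'b) \<Rightarrow> ('a \<Rightarrow> 'b) \<Rightarrow> bool" where
  "even_superderivation K A B \<alpha> \<beta> \<longleftrightarrow>
     even_linear K A B \<beta> \<and>
     (\<forall>p q. \<forall>a\<in>part A p. \<forall>b\<in>part A q.
        \<beta> (a \<otimes>\<^bsub>A\<^esub> b) = \<alpha> a \<otimes>\<^bsub>B\<^esub> \<beta> b \<oplus>\<^bsub>B\<^esub> sgnmul B (p * q) (\<alpha> b \<otimes>\<^bsub>B\<^esub> \<beta> a))"

text \<open>
  Formulas with signs are given on homogeneous elements. \<open>homog_ext V W X f\<close> is the resulting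
  operation on all of \<open>V\<close> and \<open>W\<close>: if \<open>f p q\<close> is bilinear on \<open>part V p\<close> and \<open>part W q\<close>, it is
  the bilinear map given there by \<open>f p q\<close>.
\<close>

definition proj :: "('k, 'a, 'n) super_scheme \<Rightarrow> bit \<Rightarrow> 'a \<Rightarrow> 'a" where
  "proj V p x = (THE y. y \<in> part V p \<and> x \<ominus>\<^bsub>V\<^esub> y \<in> part V (p + 1))"

definition homog_ext ::
  "('k, 'a, 'm) super_scheme \<Rightarrow> ('k, 'b, 'n) super_scheme \<Rightarrow> ('k, 'c, 'o) super_scheme \<Rightarrow>
   (bit \<Rightarrow> bit \<Rightarrow> 'a \<Rightarrow> 'b \<Rightarrow> 'c) \<Rightarrow> 'a \<Rightarrow> 'b \<Rightarrow> 'c" where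
  "homog_ext V W X f x y =
     (\<Oplus>\<^bsub>X\<^esub>pq\<in>UNIV. f (fst pq) (snd pq) (proj V (fst pq) x) (proj W (snd pq) y))"

definition with_bracket :: "('k, 'a, 'n) super_scheme \<Rightarrow> ('a \<Rightarrow> 'a \<Rightarrow> 'a) \<Rightarrow> ('k, 'a) bsuper" where
  "with_bracket A b = \<lparr>carrier = carrier A, mult = mult A, one = one A, zero = zero A, add = add A,
     smult = smult A, part = part A, bracket = b\<rparr>"

definition super_commutator :: "('k, 'a, 'n) super_scheme \<Rightarrow> 'a \<Rightarrow> 'a \<Rightarrow> 'a" where
  "super_commutator B =
     homog_ext B B B (\<lambda>p q a b. a \<otimes>\<^bsub>B\<^esub> b \<ominus>\<^bsub>B\<^esub> sgnmul B (p * q) (b \<otimes>\<^bsub>B\<^esub> a))"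

text \<open>The Lie superalgebra \<open>B\<^sub>L\<close>.\<close>

definition lie_of :: "('k, 'a, 'n) super_scheme \<Rightarrow> ('k, 'a) bsuper" where
  "lie_of B = with_bracket B (super_commutator B)"

locale cocycle = lie_superalgebra K L
  for K :: "('k, 'm) ring_scheme" and L :: "('k, 'a, 'n) bsuper_scheme" and \<sigma> :: "'a \<Rightarrow> 'a \<Rightarrow> 'k" +
  assumes cocycle_bilinear: "bilinear_map K L (self_module K) \<sigma>"
    and cocycle_skew: "\<lbrakk>x \<in> part L p; y \<in> part L q\<rbrakk> \<Longrightarrow> \<sigma> x y = \<ominus>\<^bsub>K\<^esub> sgnmul K (p * q) (\<sigma> y x)"
    and cocycle_jacobi: "\<lbrakk>x \<in> part L p; y \<in> part L q; z \<in> part L r\<rbrakk>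
      \<Longrightarrow> \<sigma> \<lbrace>x, y\<rbrace>\<^bsub>L\<^esub> z
          \<oplus>\<^bsub>K\<^esub> sgnmul K (r * (p + q)) (\<sigma> \<lbrace>z, x\<rbrace>\<^bsub>L\<^esub> y)
          \<oplus>\<^bsub>K\<^esub> sgnmul K (p * (q + r)) (\<sigma> \<lbrace>y, z\<rbrace>\<^bsub>L\<^esub> x) = \<zero>\<^bsub>K\<^esub>"
    and cocycle_even: "\<lbrakk>x \<in> part L p; y \<in> part L q; p + q = 1\<rbrakk> \<Longrightarrow> \<sigma> x y = \<zero>\<^bsub>K\<^esub>"


section \<open>Free, tensor and quotient superalgebras\<close>

text \<open>
  The free associative unital algebra on a set \<open>X\<close>: finitely supported functions on words over \<open>X\<close>,
  with the concatenation (convolution) product.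
\<close>

definition supp :: "('k, 'm) ring_scheme \<Rightarrow> ('w \<Rightarrow> 'k) \<Rightarrow> 'w set" where
  "supp K f = {w. f w \<noteq> \<zero>\<^bsub>K\<^esub>}"

definition word :: "('k, 'm) ring_scheme \<Rightarrow> 'v list \<Rightarrow> 'v list \<Rightarrow> 'k" where
  "word K w = (\<lambda>v. if v = w then \<one>\<^bsub>K\<^esub> else \<zero>\<^bsub>K\<^esub>)"

definition free_algebra :: "('k, 'm) ring_scheme \<Rightarrow> 'v set \<Rightarrow> ('k, 'v list \<Rightarrow> 'k) module" where
  "free_algebra K X =
     \<lparr>carrier = {f. range f \<subseteq> carrier K \<and> finite (supp K f) \<and> supp K f \<subseteq> lists X},
      mult = (\<lambda>f g w. \<Oplus>\<^bsub>K\<^esub>i\<in>{..length w}. f (take i w) \<otimes>\<^bsub>K\<^esub> g (drop i w)),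
      one = word K [],
      zero = (\<lambda>_. \<zero>\<^bsub>K\<^esub>),
      add = (\<lambda>f g w. f w \<oplus>\<^bsub>K\<^esub> g w),
      smult = (\<lambda>c f w. c \<otimes>\<^bsub>K\<^esub> f w)\<rparr>"

text \<open>
  The quotient of an algebra by a two-sided ideal \<open>I\<close>; \<open>P p\<close> is the set of those elements of \<open>A\<close>
  whose classes form the component of parity \<open>p\<close>.
\<close>

definition quot_algebra ::
  "('k, 'a, 'n) module_scheme \<Rightarrow> (bit \<Rightarrow> 'a set) \<Rightarrow> 'a set \<Rightarrow> ('k, 'a set) super" where
  "quot_algebra A P I =
     \<lparr>carrier = carrier (A Quot I), mult = mult (A Quot I), one = one (A Quot I),
      zero = zero (A Quot I), add = add (A Quot I),
      smult = (\<lambda>c X. \<Union>x\<in>X. I +>\<^bsub>A\<^esub> (c \<odot>\<^bsub>A\<^esub> x)),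
      part = (\<lambda>p. (\<lambda>x. I +>\<^bsub>A\<^esub> x) ` P p)\<rparr>"

text \<open>Words in homogeneous elements of \<open>V\<close>, of total parity \<open>p\<close>.\<close>

primrec homog_word :: "('k, 'v, 'n) super_scheme \<Rightarrow> bit \<Rightarrow> 'v list \<Rightarrow> bool" where
  "homog_word V p [] \<longleftrightarrow> p = 0"
| "homog_word V p (x # w) \<longleftrightarrow> (\<exists>q r. p = q + r \<and> x \<in> part V q \<and> homog_word V r w)"

text \<open>
  The tensor algebra is presented as the free algebra on the elements of \<open>V\<close> modulo linearity of the
  map sending an element to the corresponding one-letter word. Its component of parity \<open>p\<close> is spanned
  by the tensors \<open>x\<^sub>1 \<otimes> \<dots> \<otimes> x\<^sub>n\<close> of homogeneous elements of total parity \<open>p\<close>.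
\<close>

definition lin_ideal :: "('k, 'm) ring_scheme \<Rightarrow> ('k, 'v, 'n) super_scheme \<Rightarrow> ('v list \<Rightarrow> 'k) set" where
  "lin_ideal K V = (let F = free_algebra K (carrier V) in
     genideal F
      ({word K [x \<oplus>\<^bsub>V\<^esub> y] \<ominus>\<^bsub>F\<^esub> (word K [x] \<oplus>\<^bsub>F\<^esub> word K [y]) | x y. x \<in> carrier V \<and> y \<in> carrier V} \<union>
       {word K [c \<odot>\<^bsub>V\<^esub> x] \<ominus>\<^bsub>F\<^esub> c \<odot>\<^bsub>F\<^esub> word K [x] | c x. c \<in> carrier K \<and> x \<in> carrier V}))"

definition tensor_algebra ::
  "('k, 'm) ring_scheme \<Rightarrow> ('k, 'v, 'n) super_scheme \<Rightarrow> ('k, ('v list \<Rightarrow> 'k) set) super" where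
  "tensor_algebra K V = (let F = free_algebra K (carrier V) in
     quot_algebra F (\<lambda>p. {f \<in> carrier F. \<forall>w\<in>supp K f. homog_word V p w}) (lin_ideal K V))"

definition tensor_incl ::
  "('k, 'm) ring_scheme \<Rightarrow> ('k, 'v, 'n) super_scheme \<Rightarrow> 'v \<Rightarrow> ('v list \<Rightarrow> 'k) set" where
  "tensor_incl K V x = lin_ideal K V +>\<^bsub>free_algebra K (carrier V)\<^esub> word K [x]"

definition sym_ideal ::
  "('k, 'm) ring_scheme \<Rightarrow> ('k, 'v, 'n) super_scheme \<Rightarrow> ('v list \<Rightarrow> 'k) set set" where
  "sym_ideal K V = (let T = tensor_algebra K V; t = tensor_incl K V in
     genideal T {t x \<otimes>\<^bsub>T\<^esub> t y \<ominus>\<^bsub>T\<^esub> sgnmul T (p * q) (t y \<otimes>\<^bsub>T\<^esub> t x) | p q x y.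
       x \<in> part V p \<and> y \<in> part V q})"

definition sym_algebra ::
  "('k, 'm) ring_scheme \<Rightarrow> ('k, 'v, 'n) super_scheme \<Rightarrow> ('k, ('v list \<Rightarrow> 'k) set set) super" where
  "sym_algebra K V =
     quot_algebra (tensor_algebra K V) (part (tensor_algebra K V)) (sym_ideal K V)"

definition sym_incl ::
  "('k, 'm) ring_scheme \<Rightarrow> ('k, 'v, 'n) super_scheme \<Rightarrow> 'v \<Rightarrow> ('v list \<Rightarrow> 'k) set set" where
  "sym_incl K V x = sym_ideal K V +>\<^bsub>tensor_algebra K V\<^esub> tensor_incl K V x"

definition sridharan_ideal ::
  "('k, 'm) ring_scheme \<Rightarrow> ('k, 'v, 'n) bsuper_scheme \<Rightarrow> ('v \<Rightarrow> 'v \<Rightarrow> 'k) \<Rightarrow> ('v list \<Rightarrow> 'k) set set" where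
  "sridharan_ideal K V \<sigma> = (let T = tensor_algebra K V; t = tensor_incl K V in
     genideal T
      {t x \<otimes>\<^bsub>T\<^esub> t y \<ominus>\<^bsub>T\<^esub> sgnmul T (p * q) (t y \<otimes>\<^bsub>T\<^esub> t x) \<ominus>\<^bsub>T\<^esub> t \<lbrace>x, y\<rbrace>\<^bsub>V\<^esub> \<ominus>\<^bsub>T\<^esub> \<sigma> x y \<odot>\<^bsub>T\<^esub> \<one>\<^bsub>T\<^esub> | p q x y.
        x \<in> part V p \<and> y \<in> part V q})"

definition sridharan ::
  "('k, 'm) ring_scheme \<Rightarrow> ('k, 'v, 'n) bsuper_scheme \<Rightarrow> ('v \<Rightarrow> 'v \<Rightarrow> 'k) \<Rightarrow> ('k, ('v list \<Rightarrow> 'k) set set) super" where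
  "sridharan K V \<sigma> =
     quot_algebra (tensor_algebra K V) (part (tensor_algebra K V)) (sridharan_ideal K V \<sigma>)"

definition sridharan_incl ::
  "('k, 'm) ring_scheme \<Rightarrow> ('k, 'v, 'n) bsuper_scheme \<Rightarrow> ('v \<Rightarrow> 'v \<Rightarrow> 'k) \<Rightarrow> 'v \<Rightarrow> ('v list \<Rightarrow> 'k) set set" where
  "sridharan_incl K V \<sigma> x = sridharan_ideal K V \<sigma> +>\<^bsub>tensor_algebra K V\<^esub> tensor_incl K V x"


section \<open>The Poisson symplectic superalgebra\<close>

text \<open>
  For a cocycle \<open>\<sigma>\<close> on a Lie superalgebra \<open>L\<close> in characteristic 0, the extension of the bracket from
  \<open>L\<close> to \<open>S(L)\<close> as a bisuperderivation (Leibniz rule and super skew-symmetry) exists and is unique on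
  the carrier; the choice below is therefore only a choice of values outside the carrier.
  The same applies to \<open>can_alpha\<close> and \<open>can_beta\<close>.
\<close>

definition PS_bracket ::
  "('k, 'm) ring_scheme \<Rightarrow> ('k, 'v, 'n) bsuper_scheme \<Rightarrow> ('v \<Rightarrow> 'v \<Rightarrow> 'k) \<Rightarrow>
   ('v list \<Rightarrow> 'k) set set \<Rightarrow> ('v list \<Rightarrow> 'k) set set \<Rightarrow> ('v list \<Rightarrow> 'k) set set" where
  "PS_bracket K L \<sigma> = (let S = sym_algebra K L; s = sym_incl K L in
     SOME b. poisson_superalgebra K (with_bracket S b) \<and>
       (\<forall>x\<in>carrier L. \<forall>y\<in>carrier L. b (s x) (s y) = s \<lbrace>x, y\<rbrace>\<^bsub>L\<^esub> \<oplus>\<^bsub>S\<^esub> \<sigma> x y \<odot>\<^bsub>S\<^esub> \<one>\<^bsub>S\<^esub>))"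

definition PS ::
  "('k, 'm) ring_scheme \<Rightarrow> ('k, 'v, 'n) bsuper_scheme \<Rightarrow> ('v \<Rightarrow> 'v \<Rightarrow> 'k) \<Rightarrow> ('k, ('v list \<Rightarrow> 'k) set set) bsuper" where
  "PS K L \<sigma> = with_bracket (sym_algebra K L) (PS_bracket K L \<sigma>)"


section \<open>The Lie superalgebra \<open>L\<^sup>0 \<oplus> L\<close> and the canonical maps\<close>

definition ad :: "('k, 'v, 'n) bsuper_scheme \<Rightarrow> 'v \<Rightarrow> 'v \<Rightarrow> 'v" where
  "ad L x u = \<lbrace>x, u\<rbrace>\<^bsub>L\<^esub>"

text \<open>A pair \<open>(u, x)\<close> stands for \<open>u + x\<close> with \<open>u\<close> in \<open>L\<^sup>0\<close> and \<open>x\<close> in \<open>L\<close>.\<close>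

definition semidirect_ad :: "('k, 'v, 'n) bsuper_scheme \<Rightarrow> ('k, 'v \<times> 'v) bsuper" where
  "semidirect_ad L =
     \<lparr>carrier = carrier L \<times> carrier L,
      mult = undefined,
      one = undefined,
      zero = (\<zero>\<^bsub>L\<^esub>, \<zero>\<^bsub>L\<^esub>),
      add = (\<lambda>(u, x) (v, y). (u \<oplus>\<^bsub>L\<^esub> v, x \<oplus>\<^bsub>L\<^esub> y)),
      smult = (\<lambda>c (u, x). (c \<odot>\<^bsub>L\<^esub> u, c \<odot>\<^bsub>L\<^esub> x)),
      part = (\<lambda>p. part L p \<times> part L p),
      bracket = (\<lambda>(u, x) (v, y).
        (ad L x v \<ominus>\<^bsub>L\<^esub> homog_ext L L L (\<lambda>p q u y. sgnmul L (p * q) (ad L y u)) u y, \<lbrace>x, y\<rbrace>\<^bsub>L\<^esub>))\<rparr>"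

definition incl0 :: "('k, 'v, 'n) bsuper_scheme \<Rightarrow> 'v \<Rightarrow> 'v \<times> 'v" where
  "incl0 L x = (x, \<zero>\<^bsub>L\<^esub>)"

definition incl1 :: "('k, 'v, 'n) bsuper_scheme \<Rightarrow> 'v \<Rightarrow> 'v \<times> 'v" where
  "incl1 L x = (\<zero>\<^bsub>L\<^esub>, x)"

text \<open>
  The bilinear form on \<open>L\<^sup>0 \<oplus> L\<close> with
  \<open>\<sigma>\<^sub>g(x\<^sup>0, y\<^sup>0) = \<sigma>\<^sub>g(x\<^sup>1, y\<^sup>1) = 0\<close> and \<open>\<sigma>\<^sub>g(x\<^sup>0, y\<^sup>1) = \<sigma>\<^sub>g(x\<^sup>1, y\<^sup>0) = \<sigma>(x, y)\<close>.
\<close>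

definition semidirect_cocycle ::
  "('k, 'm) ring_scheme \<Rightarrow> ('v \<Rightarrow> 'v \<Rightarrow> 'k) \<Rightarrow> 'v \<times> 'v \<Rightarrow> 'v \<times> 'v \<Rightarrow> 'k" where
  "semidirect_cocycle K \<sigma> = (\<lambda>(u, x) (v, y). \<sigma> u y \<oplus>\<^bsub>K\<^esub> \<sigma> x v)"

definition can_alpha ::
  "('k, 'm) ring_scheme \<Rightarrow> ('k, 'v, 'n) bsuper_scheme \<Rightarrow> ('v \<Rightarrow> 'v \<Rightarrow> 'k) \<Rightarrow>
   ('v list \<Rightarrow> 'k) set set \<Rightarrow> (('v \<times> 'v) list \<Rightarrow> 'k) set set" where
  "can_alpha K L \<sigma> = (let g = semidirect_ad L; \<sigma>g = semidirect_cocycle K \<sigma> in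
     SOME \<alpha>. super_hom K (PS K L \<sigma>) (sridharan K g \<sigma>g) \<alpha> \<and>
       (\<forall>x\<in>carrier L. \<alpha> (sym_incl K L x) = sridharan_incl K g \<sigma>g (incl0 L x)))"

definition can_beta ::
  "('k, 'm) ring_scheme \<Rightarrow> ('k, 'v, 'n) bsuper_scheme \<Rightarrow> ('v \<Rightarrow> 'v \<Rightarrow> 'k) \<Rightarrow>
   ('v list \<Rightarrow> 'k) set set \<Rightarrow> (('v \<times> 'v) list \<Rightarrow> 'k) set set" where
  "can_beta K L \<sigma> = (let g = semidirect_ad L; \<sigma>g = semidirect_cocycle K \<sigma> in
     SOME \<beta>. even_superderivation K (PS K L \<sigma>) (sridharan K g \<sigma>g) (can_alpha K L \<sigma>) \<beta> \<and>
       (\<forall>x\<in>carrier L. \<beta> (sym_incl K L x) = sridharan_incl K g \<sigma>g (incl1 L x)))"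


section \<open>Universal enveloping algebras of Poisson superalgebras\<close>

definition property_P ::
  "('k, 'm) ring_scheme \<Rightarrow> ('k, 'r, 'n) bsuper_scheme \<Rightarrow> ('k, 'b) super \<Rightarrow> ('r \<Rightarrow> 'b) \<Rightarrow> ('r \<Rightarrow> 'b) \<Rightarrow> bool" where
  "property_P K R B \<alpha> \<beta> \<longleftrightarrow>
     superalgebra K B \<and>
     super_hom K R B \<alpha> \<and>
     lie_super_hom K R (lie_of B) \<beta> \<and>
     (\<forall>x\<in>carrier R. \<forall>y\<in>carrier R. \<alpha> \<lbrace>x, y\<rbrace>\<^bsub>R\<^esub> = super_commutator B (\<beta> x) (\<alpha> y)) \<and>
     even_superderivation K R B \<alpha> \<beta>"

text \<open>
  The type argument is the type carrying the test algebras \<open>B\<close>; leaving it as a free type variable of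
  a theorem quantifies over all of them. Maps out of \<open>U\<close> are taken extensional for uniqueness.
\<close>

definition universal_enveloping ::
  "'b itself \<Rightarrow> ('k, 'm) ring_scheme \<Rightarrow> ('k, 'r, 'n) bsuper_scheme \<Rightarrow> ('k, 'u) super \<Rightarrow>
   ('r \<Rightarrow> 'u) \<Rightarrow> ('r \<Rightarrow> 'u) \<Rightarrow> bool" where
  "universal_enveloping TYPE('b) K R U m h \<longleftrightarrow>
     poisson_superalgebra K R \<and>
     property_P K R U m h \<and>
     (\<forall>(B :: ('k, 'b) super) \<gamma> \<delta>. property_P K R B \<gamma> \<delta> \<longrightarrow>
        (\<exists>!\<phi>. \<phi> \<in> carrier U \<rightarrow>\<^sub>E carrier B \<and> super_hom K U B \<phi> \<and>
          (\<forall>x\<in>carrier R. \<phi> (m x) = \<gamma> x \<and> \<phi> (h x) = \<delta> x)))"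

end

theory Submission
  imports Defs
begin

text \<open>
  Write \<open>S = S(L)\<close> and \<open>U\<close> for the Sridharan superalgebra. By construction \<open>U\<close> is the
  superalgebra with generators \<open>x\<^sup>0\<close>, \<open>x\<^sup>1\<close>, linear and even in \<open>x \<in> L\<close>, and relations
  \<open>[x\<^sup>0, y\<^sup>0] = 0\<close>, \<open>[x\<^sup>1, y\<^sup>0] = [x, y]\<^sup>0 + \<sigma>(x, y)\<close>, \<open>[x\<^sup>1, y\<^sup>1] = [x, y]\<^sup>1\<close>.
  If \<open>(B, \<gamma>, \<delta>)\<close> satisfies property P, then the elements \<open>\<gamma>(x)\<close> and \<open>\<delta>(x)\<close> satisfy
  these relations: the first because \<open>S\<close> is supercommutative, the second because
  \<open>\<gamma>{x, y} = [\<delta>(x), \<gamma>(y)]\<close>, the third because \<open>\<delta>\<close> is a Lie homomorphism which, being a derivation,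
  kills the scalar \<open>\<sigma>(x, y)\<close>. Hence they define a homomorphism \<open>U \<rightarrow> B\<close>. It carries \<open>\<alpha>\<close> to \<open>\<gamma>\<close> and \<open>\<beta>\<close> to
  \<open>\<delta>\<close> because homomorphisms and derivations on \<open>S\<close> are determined by their values on \<open>L\<close>, and it is
  unique because \<open>U\<close> is generated by the values of \<open>\<alpha>\<close> and \<open>\<beta>\<close> (\<open>universal_U\<close>).

  That \<open>(U, \<alpha>, \<beta>)\<close> itself satisfies property P is a statement about all of \<open>S\<close>, whereas the relations
  only speak of generators. But both sides of \<open>\<alpha>{a, b} = [\<beta>(a), \<alpha>(b)]\<close> obey the same Leibniz
  rules in \<open>a\<close> and in \<open>b\<close>, and so do the two sides of \<open>\<beta>{a, b} = [\<beta>(a), \<beta>(b)]\<close> once the former identity is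
  known; so the identities spread from generators to \<open>S\<close> (\<open>\<alpha>_br\<close>, \<open>\<beta>_br\<close>).

  The remaining work is the existence of the maps involved. A derivation of \<open>S\<close> into a supermodule \<open>M\<close>
  is the second component of a homomorphism from \<open>S\<close> into the square-zero extension \<open>S \<oplus> M\<close>, in which
  the elements \<open>(x, f(x))\<close> supercommute for every even linear \<open>f : L \<rightarrow> M\<close>. Hence every such \<open>f\<close>
  extends to a derivation (\<open>derivation_exists\<close>). This is used three times: with \<open>M = Hom(L, S)\<close> it
  produces the operators \<open>{\<cdot>, x}\<close> for \<open>x \<in> L\<close>, and with a sign the operators \<open>{x, \<cdot>}\<close>; with \<open>M = End(S)\<close>
  it extends \<open>x \<mapsto> {x, \<cdot>}\<close> to \<open>a \<mapsto> {a, \<cdot>}\<close>, that is, to the Poisson bracket; with \<open>M = U\<close> it gives \<open>\<beta>\<close>. The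
  Jacobi identity of the bracket reads \<open>{{a, b}, \<cdot>} = [{a, \<cdot>}, {b, \<cdot>}]\<close> in \<open>End(S)\<close>. It is the second of
  the two identities above, for \<open>B = End(S)\<close> with \<open>\<alpha>(a)\<close> the multiplication by \<open>a\<close> and
  \<open>\<beta>(a) = {a, \<cdot>}\<close>, so it too needs checking on generators only (\<open>bracket_exists\<close>).

  All algebras are obtained from the free algebra by imposing relations, and only universal properties
  and the fact that they are spanned by products of homogeneous generators are used. The grading of the tensor algebra needs an argument, since a word may contain letters that are
  not homogeneous: the parity involution of \<open>V\<close> extends to \<open>T(V)\<close> and separates the two components
  because 2 is invertible (\<open>T_part_inter\<close>).
\<close>

section \<open>Preliminaries on parities and structure records\<close>

text \<open>
  Parities are added and multiplied as elements of a field; these rules would rewrite sums and products of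
  parities into bit operations.
\<close>

declare add_bit_eq_xor [simp del] mult_bit_eq_and [simp del]

lemma bit_exhaust: "p = (0::bit) \<or> p = 1"
  by (cases p) auto

lemma bit_add_self [simp]: "p + p = (0::bit)"
  by (cases p) auto

lemma bit_add_add [simp]: "p + (p + q) = (q::bit)"
  by (cases p; cases q) auto

text \<open>
  The same space occurs in several records: \<open>S(L)\<close> with and without its Poisson bracket, \<open>B\<close> and \<open>B\<^sub>L\<close>, linear
  endomorphisms as a space and as an algebra. The next lemmas move structure between records with equal fields.
\<close>

lemma abelian_group_transfer:
  assumes "abelian_group V" "carrier W = carrier V" "zero W = zero V" "add W = add V"
  shows "abelian_group W"
  by (rule abelian_groupI) (use abelian_groupE[OF assms(1)] assms(2-) in auto)

lemma module_transfer:
  assumes "module K V" "carrier W = carrier V" "zero W = zero V" "add W = add V" "smult W = smult V"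
  shows "module K W"
proof -
  interpret module K V by fact
  show ?thesis
    by (rule moduleI)
      (use R.is_cring abelian_group_transfer[OF M.abelian_group_axioms] assms(2-)
        in \<open>auto simp: smult_l_distr smult_r_distr smult_assoc1\<close>)
qed

lemma a_inv_transfer:
  assumes "carrier W = carrier V" "zero W = zero V" "add W = add V"
  shows "a_inv W = a_inv V" "a_minus W = a_minus V" "sgnmul W = sgnmul V"
  using assms by (auto simp: a_inv_def m_inv_def a_minus_def sgnmul_def fun_eq_iff)

lemma submodule_transfer:
  assumes "module K V" "submodule H K V"
    "carrier W = carrier V" "zero W = zero V" "add W = add V" "smult W = smult V"
  shows "submodule H K W"
proof -
  interpret V: module K V by fact
  interpret W: module K W by (rule module_transfer[OF assms(1)]) (use assms in auto)
  show ?thesis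
    by (rule W.submoduleI)
      (use V.submoduleE[OF assms(2)] subgroup.one_closed[OF submodule.axioms(1)[OF assms(2)]]
        assms a_inv_transfer[of W V] in auto)
qed

lemma super_space_transfer:
  assumes "super_space K V" "carrier W = carrier V" "zero W = zero V" "add W = add V"
    "smult W = smult V" "part W = part V"
  shows "super_space K W"
proof -
  interpret super_space K V by fact
  have [simp]: "x <+>\<^bsub>W\<^esub> y = x <+>\<^bsub>V\<^esub> y" for x y
    using assms by (simp add: set_add_def set_mult_def)
  show ?thesis
    unfolding super_space_def super_space_axioms_def
    using field_axioms module_transfer[OF module_axioms] submodule_transfer[OF module_axioms]
      part_submodule part_sum part_inter assms
    by auto
qed

lemma superalgebra_transfer:
  assumes "superalgebra K A" "carrier B = carrier A" "zero B = zero A" "add B = add A"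
    "smult B = smult A" "part B = part A" "mult B = mult A" "one B = one A"
  shows "superalgebra K B"
proof -
  interpret superalgebra K A by fact
  have "ring B"
    by (intro ringI abelian_group_transfer[OF M.abelian_group_axioms] monoidI)
      (use assms in \<open>auto simp: l_distr r_distr m_assoc\<close>)
  then show ?thesis
    unfolding superalgebra_def superalgebra_axioms_def
    using super_space_transfer[OF super_space_axioms] assms
    by (auto simp: smult_mult_left smult_mult_right one_even part_mult)
qed

section \<open>Linear maps\<close>

lemma linear_mapI:
  assumes "\<And>x. x \<in> carrier V \<Longrightarrow> f x \<in> carrier W"
    "\<And>x y. x \<in> carrier V \<Longrightarrow> y \<in> carrier V \<Longrightarrow> f (x \<oplus>\<^bsub>V\<^esub> y) = f x \<oplus>\<^bsub>W\<^esub> f y"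
    "\<And>c x. c \<in> carrier K \<Longrightarrow> x \<in> carrier V \<Longrightarrow> f (c \<odot>\<^bsub>V\<^esub> x) = c \<odot>\<^bsub>W\<^esub> f x"
  shows "linear_map K V W f"
  using assms by (auto simp: linear_map_def)

lemma
  assumes "linear_map K V W f"
  shows linear_map_closed: "x \<in> carrier V \<Longrightarrow> f x \<in> carrier W"
    and linear_map_add: "x \<in> carrier V \<Longrightarrow> y \<in> carrier V \<Longrightarrow> f (x \<oplus>\<^bsub>V\<^esub> y) = f x \<oplus>\<^bsub>W\<^esub> f y"
    and linear_map_smult: "c \<in> carrier K \<Longrightarrow> x \<in> carrier V \<Longrightarrow> f (c \<odot>\<^bsub>V\<^esub> x) = c \<odot>\<^bsub>W\<^esub> f x"
  using assms by (auto simp: linear_map_def)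

lemma
  assumes f: "linear_map K V W f" and "module K V" "module K W"
  shows linear_map_zero: "f \<zero>\<^bsub>V\<^esub> = \<zero>\<^bsub>W\<^esub>"
    and linear_map_neg: "x \<in> carrier V \<Longrightarrow> f (\<ominus>\<^bsub>V\<^esub> x) = \<ominus>\<^bsub>W\<^esub> f x"
    and linear_map_minus: "x \<in> carrier V \<Longrightarrow> y \<in> carrier V \<Longrightarrow> f (x \<ominus>\<^bsub>V\<^esub> y) = f x \<ominus>\<^bsub>W\<^esub> f y"
    and linear_map_sgn: "x \<in> carrier V \<Longrightarrow> f (sgnmul V p x) = sgnmul W p (f x)"
proof -
  interpret V: module K V by fact
  interpret W: module K W by fact
  note [simp] = linear_map_closed[OF f] linear_map_add[OF f] linear_map_smult[OF f]
  show z: "f \<zero>\<^bsub>V\<^esub> = \<zero>\<^bsub>W\<^esub>"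
    using linear_map_smult[OF f, of "\<zero>\<^bsub>K\<^esub>" "\<zero>\<^bsub>V\<^esub>"] by simp
  have n: "f (\<ominus>\<^bsub>V\<^esub> x) = \<ominus>\<^bsub>W\<^esub> f x" if "x \<in> carrier V" for x
  proof -
    have "f (\<ominus>\<^bsub>V\<^esub> x) \<oplus>\<^bsub>W\<^esub> f x = \<zero>\<^bsub>W\<^esub>"
      using that linear_map_add[OF f, of "\<ominus>\<^bsub>V\<^esub> x" x] z by (simp add: V.M.l_neg)
    then show ?thesis using that by (metis W.M.minus_equality V.M.a_inv_closed linear_map_closed[OF f])
  qed
  then show "x \<in> carrier V \<Longrightarrow> f (\<ominus>\<^bsub>V\<^esub> x) = \<ominus>\<^bsub>W\<^esub> f x" .
  show "x \<in> carrier V \<Longrightarrow> y \<in> carrier V \<Longrightarrow> f (x \<ominus>\<^bsub>V\<^esub> y) = f x \<ominus>\<^bsub>W\<^esub> f y"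
    by (simp add: a_minus_def n)
  show "x \<in> carrier V \<Longrightarrow> f (sgnmul V p x) = sgnmul W p (f x)"
    by (simp add: sgnmul_def n)
qed

lemma linear_map_comp:
  assumes "linear_map K V W f" "linear_map K W X g"
  shows "linear_map K V X (\<lambda>x. g (f x))"
  using assms by (auto simp: linear_map_def Pi_iff)

lemma linear_map_const_zero:
  assumes "module K W" shows "linear_map K V W (\<lambda>x. \<zero>\<^bsub>W\<^esub>)"
proof -
  interpret module K W by fact
  show ?thesis by (rule linear_mapI) auto
qed

lemma linear_map_plus:
  assumes "module K V" "module K W" "linear_map K V W f" "linear_map K V W g"
  shows "linear_map K V W (\<lambda>x. f x \<oplus>\<^bsub>W\<^esub> g x)"
proof -
  interpret V: module K V by fact
  interpret module K W by fact
  note [simp] = linear_map_closed[OF assms(3)] linear_map_closed[OF assms(4)]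
    linear_map_add[OF assms(3)] linear_map_add[OF assms(4)]
    linear_map_smult[OF assms(3)] linear_map_smult[OF assms(4)]
  show ?thesis by (rule linear_mapI) (auto simp: M.a_ac smult_r_distr)
qed

lemma linear_map_uminus:
  assumes "module K V" "module K W" "linear_map K V W f"
  shows "linear_map K V W (\<lambda>x. \<ominus>\<^bsub>W\<^esub> f x)"
proof -
  interpret V: module K V by fact
  interpret module K W by fact
  note [simp] = linear_map_closed[OF assms(3)] linear_map_add[OF assms(3)] linear_map_smult[OF assms(3)]
  show ?thesis by (rule linear_mapI) (auto simp: M.minus_add smult_r_minus M.a_comm)
qed

lemma linear_map_sgnmul:
  assumes "module K V" "module K W" "linear_map K V W f"
  shows "linear_map K V W (\<lambda>x. sgnmul W p (f x))"
  using linear_map_uminus[OF assms] assms(3) by (cases p) (simp_all add: sgnmul_def)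

lemma linear_map_scale:
  assumes "module K V" "module K W" "linear_map K V W f" "c \<in> carrier K"
  shows "linear_map K V W (\<lambda>x. c \<odot>\<^bsub>W\<^esub> f x)"
proof -
  interpret V: module K V by fact
  interpret module K W by fact
  note [simp] = linear_map_closed[OF assms(3)] linear_map_add[OF assms(3)] linear_map_smult[OF assms(3)]
  show ?thesis using assms(4)
    by (intro linear_mapI) (auto simp: smult_r_distr simp flip: smult_assoc1 simp: V.R.m_comm)
qed

text \<open>Multiplications, actions, brackets and cocycles are all handled through this one notion.\<close>

definition bilinear2 where
  "bilinear2 K V W X f \<longleftrightarrow>
     (\<forall>x\<in>carrier V. linear_map K W X (\<lambda>y. f x y)) \<and> (\<forall>y\<in>carrier W. linear_map K V X (\<lambda>x. f x y))"

lemma bilinear_map_iff: "bilinear_map K V W f \<longleftrightarrow> bilinear2 K V V W f"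
  by (simp add: bilinear_map_def bilinear2_def)

lemma bilinear2I:
  assumes "\<And>x. x \<in> carrier V \<Longrightarrow> linear_map K W X (\<lambda>y. f x y)"
    "\<And>y. y \<in> carrier W \<Longrightarrow> linear_map K V X (\<lambda>x. f x y)"
  shows "bilinear2 K V W X f"
  using assms by (auto simp: bilinear2_def)

lemma
  assumes "bilinear2 K V W X f"
  shows bilinear2_right: "x \<in> carrier V \<Longrightarrow> linear_map K W X (\<lambda>y. f x y)"
    and bilinear2_left: "y \<in> carrier W \<Longrightarrow> linear_map K V X (\<lambda>x. f x y)"
  using assms by (auto simp: bilinear2_def)

lemma
  assumes f: "bilinear2 K V W X f"
  shows bilinear2_closed: "x \<in> carrier V \<Longrightarrow> y \<in> carrier W \<Longrightarrow> f x y \<in> carrier X"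
    and bilinear2_add_left: "x \<in> carrier V \<Longrightarrow> x' \<in> carrier V \<Longrightarrow> y \<in> carrier W \<Longrightarrow>
      f (x \<oplus>\<^bsub>V\<^esub> x') y = f x y \<oplus>\<^bsub>X\<^esub> f x' y"
    and bilinear2_add_right: "x \<in> carrier V \<Longrightarrow> y \<in> carrier W \<Longrightarrow> y' \<in> carrier W \<Longrightarrow>
      f x (y \<oplus>\<^bsub>W\<^esub> y') = f x y \<oplus>\<^bsub>X\<^esub> f x y'"
    and bilinear2_smult_left: "c \<in> carrier K \<Longrightarrow> x \<in> carrier V \<Longrightarrow> y \<in> carrier W \<Longrightarrow>
      f (c \<odot>\<^bsub>V\<^esub> x) y = c \<odot>\<^bsub>X\<^esub> f x y"
    and bilinear2_smult_right: "c \<in> carrier K \<Longrightarrow> x \<in> carrier V \<Longrightarrow> y \<in> carrier W \<Longrightarrow>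
      f x (c \<odot>\<^bsub>W\<^esub> y) = c \<odot>\<^bsub>X\<^esub> f x y"
  using bilinear2_left[OF f] bilinear2_right[OF f]
  by (simp_all add: linear_map_def Pi_iff)

lemma
  assumes f: "bilinear2 K V W X f" and "module K V" "module K W" "module K X"
  shows bilinear2_zero_left: "y \<in> carrier W \<Longrightarrow> f \<zero>\<^bsub>V\<^esub> y = \<zero>\<^bsub>X\<^esub>"
    and bilinear2_zero_right: "x \<in> carrier V \<Longrightarrow> f x \<zero>\<^bsub>W\<^esub> = \<zero>\<^bsub>X\<^esub>"
    and bilinear2_sgn_left: "x \<in> carrier V \<Longrightarrow> y \<in> carrier W \<Longrightarrow>
      f (sgnmul V p x) y = sgnmul X p (f x y)"
    and bilinear2_sgn_right: "x \<in> carrier V \<Longrightarrow> y \<in> carrier W \<Longrightarrow>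
      f x (sgnmul W p y) = sgnmul X p (f x y)"
    and bilinear2_neg_left: "x \<in> carrier V \<Longrightarrow> y \<in> carrier W \<Longrightarrow> f (\<ominus>\<^bsub>V\<^esub> x) y = \<ominus>\<^bsub>X\<^esub> f x y"
    and bilinear2_neg_right: "x \<in> carrier V \<Longrightarrow> y \<in> carrier W \<Longrightarrow> f x (\<ominus>\<^bsub>W\<^esub> y) = \<ominus>\<^bsub>X\<^esub> f x y"
  using linear_map_zero[OF bilinear2_left[OF f]] linear_map_zero[OF bilinear2_right[OF f]]
    linear_map_sgn[OF bilinear2_left[OF f]] linear_map_sgn[OF bilinear2_right[OF f]]
    linear_map_neg[OF bilinear2_left[OF f]] linear_map_neg[OF bilinear2_right[OF f]] assms(2-)
  by blast+

lemma bilinear2_flip: "bilinear2 K V W X f \<Longrightarrow> bilinear2 K W V X (\<lambda>y x. f x y)"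
  by (simp add: bilinear2_def)

lemma bilinear2_sgnmul:
  assumes "module K V" "module K W" "module K X" "bilinear2 K V W X f"
  shows "bilinear2 K V W X (\<lambda>x y. sgnmul X p (f x y))"
  using assms by (auto simp: bilinear2_def intro!: linear_map_sgnmul)

lemma bilinear2_plus:
  assumes "module K V" "module K W" "module K X" "bilinear2 K V W X f" "bilinear2 K V W X g"
  shows "bilinear2 K V W X (\<lambda>x y. f x y \<oplus>\<^bsub>X\<^esub> g x y)"
  using assms by (auto simp: bilinear2_def intro!: linear_map_plus)

lemma bilinear2_uminus:
  assumes "module K V" "module K W" "module K X" "bilinear2 K V W X f"
  shows "bilinear2 K V W X (\<lambda>x y. \<ominus>\<^bsub>X\<^esub> f x y)"
  using assms by (auto simp: bilinear2_def intro!: linear_map_uminus)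

lemma bilinear2_comp:
  assumes "bilinear2 K V W X f" "linear_map K V' V g" "linear_map K W' W h" "linear_map K X X' k"
  shows "bilinear2 K V' W' X' (\<lambda>x y. k (f (g x) (h y)))"
  using assms by (auto simp: bilinear2_def linear_map_def Pi_iff)

section \<open>Super vector spaces\<close>

lemma (in abelian_group) minus_zero_iff:
  assumes "x \<in> carrier G" "y \<in> carrier G"
  shows "x \<ominus> y = \<zero> \<longleftrightarrow> x = y"
proof
  assume "x \<ominus> y = \<zero>"
  then have "\<ominus> (\<ominus> y) = x"
    using assms by (intro minus_equality) (simp_all add: minus_eq)
  then show "x = y" using assms by simp
qed (use assms in \<open>simp add: minus_eq r_neg\<close>)

lemma (in abelian_group) a_inv_zero [simp]: "\<ominus> \<zero> = \<zero>"
  by (rule minus_equality) auto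

text \<open>
  Under the ordered rewriting by \<open>a_ac\<close>, a term and its negative are separated by the smaller
  terms of a sum; cancellation therefore has to reach across up to three of them.
\<close>

lemma (in abelian_group)
  assumes "x \<in> carrier G" "y \<in> carrier G"
  shows cancel2: "x \<oplus> (y \<oplus> \<ominus> x) = y"
    and cancel2': "z \<in> carrier G \<Longrightarrow> x \<oplus> (y \<oplus> (\<ominus> x \<oplus> z)) = y \<oplus> z"
    and cancel3: "z \<in> carrier G \<Longrightarrow> x \<oplus> (y \<oplus> (z \<oplus> \<ominus> x)) = y \<oplus> z"
    and cancel3': "z \<in> carrier G \<Longrightarrow> u \<in> carrier G \<Longrightarrow> x \<oplus> (y \<oplus> (z \<oplus> (\<ominus> x \<oplus> u))) = y \<oplus> (z \<oplus> u)"
    and cancel4: "z \<in> carrier G \<Longrightarrow> u \<in> carrier G \<Longrightarrow> x \<oplus> (y \<oplus> (z \<oplus> (u \<oplus> \<ominus> x))) = y \<oplus> (z \<oplus> u)"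
    and cancel4': "z \<in> carrier G \<Longrightarrow> u \<in> carrier G \<Longrightarrow> v \<in> carrier G \<Longrightarrow>
      x \<oplus> (y \<oplus> (z \<oplus> (u \<oplus> (\<ominus> x \<oplus> v)))) = y \<oplus> (z \<oplus> (u \<oplus> v))"
proof -
  have c: "x \<oplus> (w \<oplus> \<ominus> x) = w" if "w \<in> carrier G" for w
    using assms that by (metis a_assoc a_comm a_inv_closed r_neg2)
  show "x \<oplus> (y \<oplus> \<ominus> x) = y" using assms c by simp
  assume z: "z \<in> carrier G"
  show "x \<oplus> (y \<oplus> (\<ominus> x \<oplus> z)) = y \<oplus> z" "x \<oplus> (y \<oplus> (z \<oplus> \<ominus> x)) = y \<oplus> z"
    using assms z c[of "y \<oplus> z"] by (simp_all add: a_assoc) (simp_all add: a_ac)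
  assume u: "u \<in> carrier G"
  show "x \<oplus> (y \<oplus> (z \<oplus> (\<ominus> x \<oplus> u))) = y \<oplus> (z \<oplus> u)"
    "x \<oplus> (y \<oplus> (z \<oplus> (u \<oplus> \<ominus> x))) = y \<oplus> (z \<oplus> u)"
    using assms z u c[of "y \<oplus> (z \<oplus> u)"] by (simp_all add: a_assoc) (simp_all add: a_ac)
  assume v: "v \<in> carrier G"
  show "x \<oplus> (y \<oplus> (z \<oplus> (u \<oplus> (\<ominus> x \<oplus> v)))) = y \<oplus> (z \<oplus> (u \<oplus> v))"
    using assms z u v c[of "y \<oplus> (z \<oplus> (u \<oplus> v))"] by (simp_all add: a_assoc) (simp_all add: a_ac)
qed

lemmas (in abelian_group) cancel =
  minus_eq minus_add l_neg r_neg r_neg1 r_neg2 cancel2 cancel2' cancel3 cancel3' cancel4 cancel4' a_ac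

context module
begin

lemma sgnmul_closed [simp, intro]: "x \<in> carrier M \<Longrightarrow> sgnmul M p x \<in> carrier M"
  by (simp add: sgnmul_def)

lemma sgnmul_0 [simp]: "sgnmul M 0 x = x"
  by (simp add: sgnmul_def)

lemma sgnmul_zero [simp]: "sgnmul M p \<zero>\<^bsub>M\<^esub> = \<zero>\<^bsub>M\<^esub>"
  using M.add.inv_one by (simp add: sgnmul_def)

lemma sgnmul_sgnmul [simp]: "x \<in> carrier M \<Longrightarrow> sgnmul M p (sgnmul M q x) = sgnmul M (p + q) x"
  by (cases p; cases q) (auto simp: sgnmul_def)

lemma sgnmul_add:
  "x \<in> carrier M \<Longrightarrow> y \<in> carrier M \<Longrightarrow> sgnmul M p (x \<oplus>\<^bsub>M\<^esub> y) = sgnmul M p x \<oplus>\<^bsub>M\<^esub> sgnmul M p y"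
  by (simp add: sgnmul_def M.minus_add M.a_comm)

lemma sgnmul_smult:
  "c \<in> carrier R \<Longrightarrow> x \<in> carrier M \<Longrightarrow> sgnmul M p (c \<odot>\<^bsub>M\<^esub> x) = c \<odot>\<^bsub>M\<^esub> sgnmul M p x"
  by (simp add: sgnmul_def smult_r_minus)

lemma sgnmul_neg:
  "x \<in> carrier M \<Longrightarrow> sgnmul M p (\<ominus>\<^bsub>M\<^esub> x) = \<ominus>\<^bsub>M\<^esub> sgnmul M p x"
  by (simp add: sgnmul_def)

end

context super_space
begin

lemma module: "module K V" ..

lemma part_closed [intro]: "x \<in> part V p \<Longrightarrow> x \<in> carrier V"
  using submoduleE(1)[OF part_submodule] by blast

lemma part_zero [simp, intro]: "\<zero>\<^bsub>V\<^esub> \<in> part V p"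
  using subgroup.one_closed[OF submodule.axioms(1)[OF part_submodule[of p]]] by simp

lemma part_add [intro]: "x \<in> part V p \<Longrightarrow> y \<in> part V p \<Longrightarrow> x \<oplus>\<^bsub>V\<^esub> y \<in> part V p"
  using submoduleE(5)[OF part_submodule] by blast

lemma part_neg [intro]: "x \<in> part V p \<Longrightarrow> \<ominus>\<^bsub>V\<^esub> x \<in> part V p"
  using submoduleE(3)[OF part_submodule] by blast

lemma part_minus [intro]: "x \<in> part V p \<Longrightarrow> y \<in> part V p \<Longrightarrow> x \<ominus>\<^bsub>V\<^esub> y \<in> part V p"
  unfolding a_minus_def by blast

lemma part_smult [intro]: "c \<in> carrier K \<Longrightarrow> x \<in> part V p \<Longrightarrow> c \<odot>\<^bsub>V\<^esub> x \<in> part V p"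
  using submoduleE(4)[OF part_submodule] by blast

lemma part_sgnmul [intro]: "x \<in> part V p \<Longrightarrow> sgnmul V q x \<in> part V p"
  unfolding sgnmul_def by auto

lemma part_disjoint: "x \<in> part V p \<Longrightarrow> x \<in> part V (p + 1) \<Longrightarrow> x = \<zero>\<^bsub>V\<^esub>"
  using part_inter by (cases p) auto

lemma ex_decomp:
  assumes "x \<in> carrier V"
  shows "\<exists>a\<in>part V p. \<exists>b\<in>part V (p + 1). x = a \<oplus>\<^bsub>V\<^esub> b"
proof -
  have "x \<in> part V 0 <+>\<^bsub>V\<^esub> part V 1"
    using assms by (simp add: part_sum)
  then obtain a b where "a \<in> part V 0" "b \<in> part V 1" "x = a \<oplus>\<^bsub>V\<^esub> b"
    by (auto simp: set_add_defs)
  moreover have "a \<oplus>\<^bsub>V\<^esub> b = b \<oplus>\<^bsub>V\<^esub> a"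
    using calculation by (simp add: M.a_comm part_closed)
  ultimately show ?thesis by (cases p) (auto, metis)
qed

lemma decomp_unique:
  assumes "a \<in> part V p" "b \<in> part V (p + 1)" "a' \<in> part V p" "b' \<in> part V (p + 1)"
    "a \<oplus>\<^bsub>V\<^esub> b = a' \<oplus>\<^bsub>V\<^esub> b'"
  shows "a = a'"
proof -
  note c = assms(1-4)[THEN part_closed]
  have "a \<ominus>\<^bsub>V\<^esub> a' = ((a \<oplus>\<^bsub>V\<^esub> b) \<ominus>\<^bsub>V\<^esub> b) \<ominus>\<^bsub>V\<^esub> a'"
    using c by (simp add: a_minus_def M.a_assoc M.r_neg)
  also have "\<dots> = b' \<ominus>\<^bsub>V\<^esub> b"
    using c unfolding assms(5) by (simp add: a_minus_def M.cancel)
  finally have "a \<ominus>\<^bsub>V\<^esub> a' = \<zero>\<^bsub>V\<^esub>"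
    using part_disjoint[of "a \<ominus>\<^bsub>V\<^esub> a'" p] assms part_minus by metis
  then show ?thesis using c by (simp add: M.minus_zero_iff)
qed

lemma proj_eq:
  assumes "a \<in> part V p" "b \<in> part V (p + 1)" "x = a \<oplus>\<^bsub>V\<^esub> b"
  shows "proj V p x = a"
  unfolding proj_def
proof (rule the_equality)
  note c = assms(1-2)[THEN part_closed]
  show "a \<in> part V p \<and> x \<ominus>\<^bsub>V\<^esub> a \<in> part V (p + 1)"
    using assms c by (simp add: a_minus_def M.cancel)
  fix y assume y: "y \<in> part V p \<and> x \<ominus>\<^bsub>V\<^esub> y \<in> part V (p + 1)"
  then have "y \<in> carrier V" by auto
  then have "y \<oplus>\<^bsub>V\<^esub> (x \<ominus>\<^bsub>V\<^esub> y) = a \<oplus>\<^bsub>V\<^esub> b"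
    using assms(3) c by (simp add: a_minus_def M.cancel)
  with y show "y = a" using decomp_unique[of y p "x \<ominus>\<^bsub>V\<^esub> y" a b] assms by auto
qed

lemma proj_part [simp, intro]: "x \<in> carrier V \<Longrightarrow> proj V p x \<in> part V p"
  using ex_decomp[of x p] proj_eq by auto

lemma proj_closed [simp, intro]: "x \<in> carrier V \<Longrightarrow> proj V p x \<in> carrier V"
  by (rule part_closed[OF proj_part])

lemma proj_sum: "x \<in> carrier V \<Longrightarrow> proj V p x \<oplus>\<^bsub>V\<^esub> proj V (p + 1) x = x"
  using ex_decomp[of x p] proj_eq[of _ p _ x] proj_eq[of _ "p + 1" _ x]
  by (fastforce simp: M.a_comm part_closed add.assoc)

lemma proj_same [simp]: "x \<in> part V p \<Longrightarrow> proj V p x = x"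
  by (rule proj_eq[of _ _ "\<zero>\<^bsub>V\<^esub>"]) (auto simp: part_closed)

lemma proj_other [simp]: "x \<in> part V p \<Longrightarrow> p \<noteq> q \<Longrightarrow> proj V q x = \<zero>\<^bsub>V\<^esub>"
  by (rule proj_eq[of _ _ x]; cases p; cases q) (auto simp: part_closed)

lemma proj_linear: "linear_map K V V (proj V p)"
proof (rule linear_mapI)
  fix x y assume x: "x \<in> carrier V" and y: "y \<in> carrier V"
  show "proj V p (x \<oplus>\<^bsub>V\<^esub> y) = proj V p x \<oplus>\<^bsub>V\<^esub> proj V p y"
  proof (rule proj_eq)
    show "x \<oplus>\<^bsub>V\<^esub> y = proj V p x \<oplus>\<^bsub>V\<^esub> proj V p y \<oplus>\<^bsub>V\<^esub> (proj V (p+1) x \<oplus>\<^bsub>V\<^esub> proj V (p+1) y)"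
      by (subst (1) proj_sum[OF x, of p, symmetric], subst (1) proj_sum[OF y, of p, symmetric])
        (use x y in \<open>simp add: M.a_ac del: proj_part\<close>)
  qed (use x y in auto)
next
  fix c x assume c: "c \<in> carrier K" and x: "x \<in> carrier V"
  show "proj V p (c \<odot>\<^bsub>V\<^esub> x) = c \<odot>\<^bsub>V\<^esub> proj V p x"
  proof (rule proj_eq)
    show "c \<odot>\<^bsub>V\<^esub> x = c \<odot>\<^bsub>V\<^esub> proj V p x \<oplus>\<^bsub>V\<^esub> c \<odot>\<^bsub>V\<^esub> proj V (p+1) x"
      using c x by (metis smult_r_distr proj_closed proj_sum)
  qed (use c x in auto)
qed auto

lemma carrier_part_cases:
  assumes "x \<in> carrier V"
  obtains a b where "a \<in> part V 0" "b \<in> part V 1" "x = a \<oplus>\<^bsub>V\<^esub> b"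
  using ex_decomp[OF assms, of 0] by auto

lemma linear_map_ext:
  assumes f: "linear_map K V W f" and g: "linear_map K V W g"
    and eq: "\<And>p x. x \<in> part V p \<Longrightarrow> f x = g x" and x: "x \<in> carrier V"
  shows "f x = g x"
  using x
proof (cases rule: carrier_part_cases)
  case (1 a b)
  then show ?thesis
    using eq[OF 1(1)] eq[OF 1(2)] linear_map_add[OF f, of a b] linear_map_add[OF g, of a b]
    by (simp add: part_closed)
qed

end

text \<open>Identities stated with signs, on homogeneous elements, thereby become identities of bilinear maps.\<close>

lemma bilinear2_ext:
  assumes V: "super_space K V" and W: "super_space K W"
    and f: "bilinear2 K V W X f" and g: "bilinear2 K V W X g"
    and eq: "\<And>p q x y. x \<in> part V p \<Longrightarrow> y \<in> part W q \<Longrightarrow> f x y = g x y"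
    and x: "x \<in> carrier V" and y: "y \<in> carrier W"
  shows "f x y = g x y"
proof (rule super_space.linear_map_ext[OF V bilinear2_left[OF f y] bilinear2_left[OF g y] _ x])
  fix p x assume x: "x \<in> part V p"
  then have x': "x \<in> carrier V" by (rule super_space.part_closed[OF V])
  show "f x y = g x y"
    by (rule super_space.linear_map_ext[OF W bilinear2_right[OF f x'] bilinear2_right[OF g x'] _ y])
      (rule eq[OF x])
qed

section \<open>Signed formulas as bilinear maps\<close>

lemma bilinear2_proj:
  assumes "super_space K V" "super_space K W" "bilinear2 K V W X f"
  shows "bilinear2 K V W X (\<lambda>x y. f (proj V p x) (proj W q y))"
proof -
  interpret V: super_space K V by fact
  interpret W: super_space K W by fact
  show ?thesis using V.proj_linear[of p] W.proj_linear[of q] assms(3)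
    by (auto simp: bilinear2_def linear_map_def Pi_iff)
qed

lemma UNIV_bit2: "(UNIV :: (bit \<times> bit) set) = {(0,0),(0,1),(1,0),(1,1)}"
  using bit_exhaust by auto

lemma
  assumes V: "super_space K V" and W: "super_space K W" and X: "module K X"
    and f: "\<And>p q. bilinear2 K V W X (f p q)"
  shows homog_ext_bilinear: "bilinear2 K V W X (homog_ext V W X f)"
    and homog_ext_eq: "x \<in> part V p \<Longrightarrow> y \<in> part W q \<Longrightarrow> homog_ext V W X f x y = f p q x y"
proof -
  interpret V: super_space K V by fact
  interpret W: super_space K W by fact
  interpret X: module K X by fact
  \<comment> \<open>the sum over the four pairs of parities, written out\<close>
  let ?s = "\<lambda>x y. f 0 0 (proj V 0 x) (proj W 0 y) \<oplus>\<^bsub>X\<^esub> (f 0 1 (proj V 0 x) (proj W 1 y) \<oplus>\<^bsub>X\<^esub>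
      (f 1 0 (proj V 1 x) (proj W 0 y) \<oplus>\<^bsub>X\<^esub> f 1 1 (proj V 1 x) (proj W 1 y)))"
  have e: "homog_ext V W X f x y = ?s x y" if "x \<in> carrier V" "y \<in> carrier W" for x y
    unfolding homog_ext_def UNIV_bit2
    using that by (simp add: X.M.finsum_insert bilinear2_closed[OF f])
  have b: "bilinear2 K V W X ?s"
    by (intro bilinear2_plus bilinear2_proj f V W X V.module W.module)
  then show "bilinear2 K V W X (homog_ext V W X f)"
    using e by (auto simp: bilinear2_def linear_map_def Pi_iff)
  show "homog_ext V W X f x y = f p q x y" if "x \<in> part V p" "y \<in> part W q"
    using that e[of x y] bilinear2_closed[OF f] bilinear2_zero_left[OF f] bilinear2_zero_right[OF f]
    by (cases p; cases q) (simp_all add: V.part_closed W.part_closed V.module W.module X)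
qed

section \<open>Associative algebras and the free algebra\<close>

text \<open>
  The tensor algebra and its quotients are treated as ungraded algebras first, because the grading of the tensor
  algebra is established by means of its universal property.
\<close>

locale assoc_algebra = module K A + ring A
  for K :: "('k, 'm) ring_scheme" and A :: "('k, 'a, 'n) module_scheme" +
  assumes smult_mult_left: "\<lbrakk>c \<in> carrier K; a \<in> carrier A; b \<in> carrier A\<rbrakk>
      \<Longrightarrow> (c \<odot>\<^bsub>A\<^esub> a) \<otimes>\<^bsub>A\<^esub> b = c \<odot>\<^bsub>A\<^esub> (a \<otimes>\<^bsub>A\<^esub> b)"
    and smult_mult_right: "\<lbrakk>c \<in> carrier K; a \<in> carrier A; b \<in> carrier A\<rbrakk>
      \<Longrightarrow> a \<otimes>\<^bsub>A\<^esub> (c \<odot>\<^bsub>A\<^esub> b) = c \<odot>\<^bsub>A\<^esub> (a \<otimes>\<^bsub>A\<^esub> b)"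

lemma (in superalgebra) assoc_algebra: "assoc_algebra K A"
  by unfold_locales (auto simp: smult_mult_left smult_mult_right)

lemma (in assoc_algebra) mult_bilinear: "bilinear2 K A A A (mult A)"
  by (intro bilinear2I linear_mapI) (auto simp: l_distr r_distr smult_mult_left smult_mult_right)

definition alg_hom where
  "alg_hom K A B f \<longleftrightarrow> linear_map K A B f \<and>
     (\<forall>x\<in>carrier A. \<forall>y\<in>carrier A. f (x \<otimes>\<^bsub>A\<^esub> y) = f x \<otimes>\<^bsub>B\<^esub> f y) \<and> f \<one>\<^bsub>A\<^esub> = \<one>\<^bsub>B\<^esub>"

lemma super_hom_iff: "super_hom K A B f \<longleftrightarrow> alg_hom K A B f \<and> (\<forall>p. f ` part A p \<subseteq> part B p)"
  by (auto simp: super_hom_def alg_hom_def even_linear_def)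

lemma
  assumes "alg_hom K A B f"
  shows alg_hom_linear: "linear_map K A B f"
    and alg_hom_closed: "x \<in> carrier A \<Longrightarrow> f x \<in> carrier B"
    and alg_hom_mult: "x \<in> carrier A \<Longrightarrow> y \<in> carrier A \<Longrightarrow> f (x \<otimes>\<^bsub>A\<^esub> y) = f x \<otimes>\<^bsub>B\<^esub> f y"
    and alg_hom_one: "f \<one>\<^bsub>A\<^esub> = \<one>\<^bsub>B\<^esub>"
  using assms by (auto simp: alg_hom_def linear_map_def)

definition letter_prod where
  "letter_prod B \<phi> w = foldr (\<lambda>x b. \<phi> x \<otimes>\<^bsub>B\<^esub> b) w \<one>\<^bsub>B\<^esub>"

lemma letter_prod_simps [simp]: "letter_prod B \<phi> [] = \<one>\<^bsub>B\<^esub>" "letter_prod B \<phi> (x # w) = \<phi> x \<otimes>\<^bsub>B\<^esub> letter_prod B \<phi> w"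
  by (simp_all add: letter_prod_def)

locale free_alg = cring K for K :: "('k, 'm) ring_scheme" and X :: "'v set"
begin

abbreviation "F \<equiv> free_algebra K X"

lemma carrier_F: "f \<in> carrier F \<longleftrightarrow> (\<forall>w. f w \<in> carrier K) \<and> finite (supp K f) \<and> supp K f \<subseteq> lists X"
  by (auto simp: free_algebra_def)

lemma F_simps:
  "zero F = (\<lambda>_. \<zero>\<^bsub>K\<^esub>)" "one F = word K []" "add F f g = (\<lambda>w. f w \<oplus>\<^bsub>K\<^esub> g w)"
  "smult F c f = (\<lambda>w. c \<otimes>\<^bsub>K\<^esub> f w)"
  "mult F f g = (\<lambda>w. \<Oplus>\<^bsub>K\<^esub>i\<in>{..length w}. f (take i w) \<otimes>\<^bsub>K\<^esub> g (drop i w))"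
  by (auto simp: free_algebra_def)

lemma F_closed: "f \<in> carrier F \<Longrightarrow> f w \<in> carrier K"
  by (simp add: carrier_F)

lemma F_module: "module K F"
proof (intro moduleI abelian_groupI is_cring)
  fix f g assume f: "f \<in> carrier F" and g: "g \<in> carrier F"
  have "supp K (f \<oplus>\<^bsub>F\<^esub> g) \<subseteq> supp K f \<union> supp K g"
    by (auto simp: supp_def F_simps)
  then show "f \<oplus>\<^bsub>F\<^esub> g \<in> carrier F"
    using f g finite_subset[of "supp K (f \<oplus>\<^bsub>F\<^esub> g)" "supp K f \<union> supp K g"]
      subset_trans[of "supp K (f \<oplus>\<^bsub>F\<^esub> g)" "supp K f \<union> supp K g" "lists X"]
    by (simp add: carrier_F F_simps)
next
  fix f assume f: "f \<in> carrier F"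
  have "supp K (\<lambda>w. \<ominus>\<^bsub>K\<^esub> f w) \<subseteq> supp K f"
    by (auto simp: supp_def)
  then have "(\<lambda>w. \<ominus>\<^bsub>K\<^esub> f w) \<in> carrier F"
    using f finite_subset by (fastforce simp: carrier_F)
  then show "\<exists>g\<in>carrier F. g \<oplus>\<^bsub>F\<^esub> f = \<zero>\<^bsub>F\<^esub>"
    using f by (intro bexI[of _ "\<lambda>w. \<ominus>\<^bsub>K\<^esub> f w"]) (auto simp: carrier_F F_simps l_neg)
next
  fix c f assume c: "c \<in> carrier K" and f: "f \<in> carrier F"
  have "supp K (c \<odot>\<^bsub>F\<^esub> f) \<subseteq> supp K f"
    using c by (auto simp: supp_def F_simps)
  then show "c \<odot>\<^bsub>F\<^esub> f \<in> carrier F"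
    using c f finite_subset[of "supp K (c \<odot>\<^bsub>F\<^esub> f)" "supp K f"] by (auto simp: carrier_F F_simps)
qed (auto simp: carrier_F F_simps supp_def a_ac l_distr r_distr m_assoc)

sublocale FM: module K F by (rule F_module)

lemma word_closed [simp]: "w \<in> lists X \<Longrightarrow> word K w \<in> carrier F"
proof -
  assume w: "w \<in> lists X"
  have "supp K (word K w) \<subseteq> {w}" by (auto simp: supp_def word_def)
  then show ?thesis using w finite_subset[of "supp K (word K w)" "{w}"]
    by (auto simp: carrier_F word_def)
qed

lemma F_mult_closed:
  assumes f: "f \<in> carrier F" and g: "g \<in> carrier F"
  shows "f \<otimes>\<^bsub>F\<^esub> g \<in> carrier F"
proof -
  let ?S = "(\<lambda>(u, v). u @ v) ` (supp K f \<times> supp K g)"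
  have "supp K (f \<otimes>\<^bsub>F\<^esub> g) \<subseteq> ?S"
  proof
    fix w assume w: "w \<in> supp K (f \<otimes>\<^bsub>F\<^esub> g)"
    show "w \<in> ?S"
    proof (rule ccontr)
      assume n: "w \<notin> ?S"
      have "f (take i w) \<otimes>\<^bsub>K\<^esub> g (drop i w) = \<zero>\<^bsub>K\<^esub>" for i
      proof -
        have "take i w \<notin> supp K f \<or> drop i w \<notin> supp K g"
          using n by (force simp: image_iff)
        then show ?thesis using f g by (auto simp: supp_def carrier_F)
      qed
      then show False using w by (simp add: supp_def F_simps finsum_zero)
    qed
  qed
  moreover have "finite ?S" "?S \<subseteq> lists X"
    using f g by (force simp: carrier_F simp del: in_lists_conv_set)+
  ultimately show ?thesis
    using f g finite_subset[of "supp K (f \<otimes>\<^bsub>F\<^esub> g)" ?S]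
    by (auto simp: carrier_F F_simps intro!: finsum_closed)
qed

lemma F_mult_bilinear: "bilinear2 K F F F (mult F)"
proof (intro bilinear2I linear_mapI F_mult_closed)
  fix f g h assume c: "f \<in> carrier F" "g \<in> carrier F" "h \<in> carrier F"
  note [simp] = c[THEN F_closed]
  show "f \<otimes>\<^bsub>F\<^esub> (g \<oplus>\<^bsub>F\<^esub> h) = f \<otimes>\<^bsub>F\<^esub> g \<oplus>\<^bsub>F\<^esub> f \<otimes>\<^bsub>F\<^esub> h"
    by (simp add: F_simps r_distr finsum_addf Pi_def)
  show "(g \<oplus>\<^bsub>F\<^esub> h) \<otimes>\<^bsub>F\<^esub> f = g \<otimes>\<^bsub>F\<^esub> f \<oplus>\<^bsub>F\<^esub> h \<otimes>\<^bsub>F\<^esub> f"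
    by (simp add: F_simps l_distr finsum_addf Pi_def)
next
  fix f g c assume c: "f \<in> carrier F" "g \<in> carrier F" "c \<in> carrier K"
  note [simp] = c(1,2)[THEN F_closed] c(3)
  show "f \<otimes>\<^bsub>F\<^esub> (c \<odot>\<^bsub>F\<^esub> g) = c \<odot>\<^bsub>F\<^esub> (f \<otimes>\<^bsub>F\<^esub> g)"
    by (simp add: F_simps m_lcomm finsum_rdistr Pi_def)
  show "(c \<odot>\<^bsub>F\<^esub> f) \<otimes>\<^bsub>F\<^esub> g = c \<odot>\<^bsub>F\<^esub> (f \<otimes>\<^bsub>F\<^esub> g)"
    by (simp add: F_simps m_assoc finsum_rdistr Pi_def)
qed auto

lemma word_mult: "word K u \<otimes>\<^bsub>F\<^esub> word K v = word K (u @ v)"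
proof
  fix w
  show "(word K u \<otimes>\<^bsub>F\<^esub> word K v) w = word K (u @ v) w"
  proof (cases "w = u @ v")
    case True
    have "word K u (take i w) \<otimes>\<^bsub>K\<^esub> word K v (drop i w) = (if length u = i then \<one>\<^bsub>K\<^esub> else \<zero>\<^bsub>K\<^esub>)"
      if "i \<le> length w" for i
    proof -
      have "length u = i" if "take i w = u"
        using that \<open>i \<le> length w\<close> by auto
      then show ?thesis using True by (auto simp: word_def simp del: take_append drop_append)
        (auto simp: take_append drop_append)
    qed
    then have "(word K u \<otimes>\<^bsub>F\<^esub> word K v) w =
        (\<Oplus>\<^bsub>K\<^esub>i\<in>{..length w}. if length u = i then \<one>\<^bsub>K\<^esub> else \<zero>\<^bsub>K\<^esub>)"
      unfolding F_simps by (intro finsum_cong') auto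
    also have "\<dots> = \<one>\<^bsub>K\<^esub>"
      using finsum_singleton[of "length u" "{..length w}" "\<lambda>_. \<one>\<^bsub>K\<^esub>"] True by simp
    finally show ?thesis using True by (simp add: word_def)
  next
    case False
    then have "word K u (take i w) \<otimes>\<^bsub>K\<^esub> word K v (drop i w) = \<zero>\<^bsub>K\<^esub>" for i
      by (auto simp: word_def)
    then show ?thesis using False by (simp add: F_simps word_def finsum_zero)
  qed
qed

text \<open>Induction over a finite set containing the support: one word is split off at a time.\<close>

lemma free_induct_aux:
  assumes "finite S"
  shows "f \<in> carrier F \<Longrightarrow> supp K f \<subseteq> S \<Longrightarrow> P \<zero>\<^bsub>F\<^esub> \<Longrightarrow>
    (\<And>g c w. g \<in> carrier F \<Longrightarrow> c \<in> carrier K \<Longrightarrow> w \<in> lists X \<Longrightarrow> w \<in> S \<Longrightarrow> P g \<Longrightarrow>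
        P (g \<oplus>\<^bsub>F\<^esub> c \<odot>\<^bsub>F\<^esub> word K w)) \<Longrightarrow> P f"
  using assms
proof (induction S arbitrary: f rule: finite_induct)
  case empty
  then have "f = \<zero>\<^bsub>F\<^esub>" by (auto simp: F_simps supp_def)
  with empty show ?case by simp
next
  case (insert w S)
  show ?case
  proof (cases "w \<in> supp K f")
    case True
    let ?g = "f(w := \<zero>\<^bsub>K\<^esub>)"
    have s: "supp K ?g \<subseteq> supp K f - {w}" by (auto simp: supp_def)
    then have g: "?g \<in> carrier F"
      using insert.prems(1) finite_subset[OF s] by (auto simp: carrier_F)
    have wX: "w \<in> lists X" and fw: "f w \<in> carrier K"
      using True insert.prems(1) by (auto simp: carrier_F)
    have "P ?g"
      by (rule insert.IH[OF g]) (use s insert.prems in \<open>auto simp del: fun_upd_apply\<close>)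
    then have "P (?g \<oplus>\<^bsub>F\<^esub> f w \<odot>\<^bsub>F\<^esub> word K w)"
      using insert.prems(4) g fw wX by blast
    also have "?g \<oplus>\<^bsub>F\<^esub> f w \<odot>\<^bsub>F\<^esub> word K w = f"
      using insert.prems(1) by (auto simp: F_simps word_def carrier_F)
    finally show ?thesis .
  next
    case False
    then show ?thesis using insert by blast
  qed
qed

lemma free_induct [consumes 1, case_names zero step]:
  assumes "f \<in> carrier F" "P \<zero>\<^bsub>F\<^esub>"
    "\<And>g c w. g \<in> carrier F \<Longrightarrow> c \<in> carrier K \<Longrightarrow> w \<in> lists X \<Longrightarrow> w \<in> supp K f \<Longrightarrow> P g \<Longrightarrow>
        P (g \<oplus>\<^bsub>F\<^esub> c \<odot>\<^bsub>F\<^esub> word K w)"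
  shows "P f"
  using assms free_induct_aux[of "supp K f" f P] by (auto simp: carrier_F)

lemma F_linear_ext:
  assumes "module K W" and f: "linear_map K F W f" and g: "linear_map K F W g"
    and "\<And>w. w \<in> lists X \<Longrightarrow> f (word K w) = g (word K w)" and x: "x \<in> carrier F"
  shows "f x = g x"
  using x
proof (induction rule: free_induct)
  case zero
  then show ?case using linear_map_zero[OF f F_module assms(1)] linear_map_zero[OF g F_module assms(1)]
    by simp
next
  case (step h c w)
  then show ?case
    using assms(4) by (simp add: linear_map_add[OF f] linear_map_add[OF g]
        linear_map_smult[OF f] linear_map_smult[OF g])
qed

lemma F_bilinear_ext:
  assumes W: "module K W" and f: "bilinear2 K F F W f" and g: "bilinear2 K F F W g"
    and eq: "\<And>u v. u \<in> lists X \<Longrightarrow> v \<in> lists X \<Longrightarrow> f (word K u) (word K v) = g (word K u) (word K v)"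
    and x: "x \<in> carrier F" and y: "y \<in> carrier F"
  shows "f x y = g x y"
  by (rule F_linear_ext[OF W bilinear2_left[OF f y] bilinear2_left[OF g y] _ x],
      rule F_linear_ext[OF W bilinear2_right[OF f] bilinear2_right[OF g] _ y])
    (auto intro: eq)

text \<open>By trilinearity, associativity of convolution reduces to that of concatenation.\<close>

lemma F_ring: "ring F"
proof (intro ringI FM.abelian_group_axioms monoidI F_mult_closed)
  show "\<one>\<^bsub>F\<^esub> \<in> carrier F" by (simp add: F_simps)
  fix f assume f: "f \<in> carrier F"
  have i: "linear_map K F F (\<lambda>f. f)" by (simp add: linear_map_def)
  have o: "word K [] \<in> carrier F" by simp
  show "\<one>\<^bsub>F\<^esub> \<otimes>\<^bsub>F\<^esub> f = f"
    unfolding F_simps(2)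
    by (rule F_linear_ext[OF F_module bilinear2_right[OF F_mult_bilinear o] i]) (auto simp: word_mult f)
  show "f \<otimes>\<^bsub>F\<^esub> \<one>\<^bsub>F\<^esub> = f"
    unfolding F_simps(2)
    by (rule F_linear_ext[OF F_module bilinear2_left[OF F_mult_bilinear o] i]) (auto simp: word_mult f)
  fix g h assume g: "g \<in> carrier F" and h: "h \<in> carrier F"
  note b = F_mult_bilinear
  have l1: "linear_map K F F (\<lambda>f. (f \<otimes>\<^bsub>F\<^esub> g) \<otimes>\<^bsub>F\<^esub> h)"
    by (rule linear_map_comp[OF bilinear2_left[OF b g] bilinear2_left[OF b h]])
  have l2: "linear_map K F F (\<lambda>f. f \<otimes>\<^bsub>F\<^esub> (g \<otimes>\<^bsub>F\<^esub> h))"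
    by (rule bilinear2_left[OF b F_mult_closed[OF g h]])
  show "(f \<otimes>\<^bsub>F\<^esub> g) \<otimes>\<^bsub>F\<^esub> h = f \<otimes>\<^bsub>F\<^esub> (g \<otimes>\<^bsub>F\<^esub> h)"
  proof (rule F_linear_ext[OF F_module l1 l2 _ f])
    fix w assume w: "w \<in> lists X"
    have b1: "bilinear2 K F F F (\<lambda>g h. (word K w \<otimes>\<^bsub>F\<^esub> g) \<otimes>\<^bsub>F\<^esub> h)"
      using w by (intro bilinear2I linear_map_comp[OF bilinear2_right[OF b] bilinear2_left[OF b]]
          bilinear2_right[OF b] F_mult_closed) auto
    have b2: "bilinear2 K F F F (\<lambda>g h. word K w \<otimes>\<^bsub>F\<^esub> (g \<otimes>\<^bsub>F\<^esub> h))"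
      using w by (intro bilinear2I linear_map_comp[OF bilinear2_right[OF b] bilinear2_right[OF b]]
          linear_map_comp[OF bilinear2_left[OF b] bilinear2_right[OF b]]) auto
    show "(word K w \<otimes>\<^bsub>F\<^esub> g) \<otimes>\<^bsub>F\<^esub> h = word K w \<otimes>\<^bsub>F\<^esub> (g \<otimes>\<^bsub>F\<^esub> h)"
      by (rule F_bilinear_ext[OF F_module b1 b2 _ g h]) (auto simp: word_mult)
  qed
qed (simp_all add: bilinear2_add_left[OF F_mult_bilinear] bilinear2_add_right[OF F_mult_bilinear])

lemma F_assoc_algebra: "assoc_algebra K F"
  unfolding assoc_algebra_def assoc_algebra_axioms_def
  using F_module F_ring bilinear2_smult_left[OF F_mult_bilinear]
    bilinear2_smult_right[OF F_mult_bilinear] by auto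

text \<open>Substitution of \<open>\<phi> x\<close> for the letters \<open>x\<close>, the homomorphism provided by the universal property of the free algebra.\<close>

definition evaluate where
  "evaluate B \<phi> f = (\<Oplus>\<^bsub>B\<^esub>w\<in>supp K f. f w \<odot>\<^bsub>B\<^esub> letter_prod B \<phi> w)"

lemma
  assumes B: "assoc_algebra K B" and \<phi>: "\<And>x. x \<in> X \<Longrightarrow> \<phi> x \<in> carrier B"
  shows evaluate_hom: "alg_hom K F B (evaluate B \<phi>)"
    and evaluate_letter: "x \<in> X \<Longrightarrow> evaluate B \<phi> (word K [x]) = \<phi> x"
proof -
  interpret B: assoc_algebra K B by fact
  have letter_prod_closed [simp]: "letter_prod B \<phi> w \<in> carrier B" if "w \<in> lists X" for w
    using that \<phi> by (induction w) auto
  have letter_prod_append: "letter_prod B \<phi> (u @ v) = letter_prod B \<phi> u \<otimes>\<^bsub>B\<^esub> letter_prod B \<phi> v"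
    if "u \<in> lists X" "v \<in> lists X" for u v
    using that \<phi> by (induction u) (auto simp: B.m_assoc)
  \<comment> \<open>the sum may run over any finite set of words containing the support; this makes additivity accessible\<close>
  have sup: "evaluate B \<phi> f = (\<Oplus>\<^bsub>B\<^esub>w\<in>S. f w \<odot>\<^bsub>B\<^esub> letter_prod B \<phi> w)"
    if f: "f \<in> carrier F" and S: "finite S" "supp K f \<subseteq> S" "S \<subseteq> lists X" for f S
  proof -
    have z: "f w = \<zero>\<^bsub>K\<^esub>" if "w \<notin> supp K f" for w using that by (simp add: supp_def)
    have m: "w \<in> S \<Longrightarrow> letter_prod B \<phi> w \<in> carrier B" for w using S letter_prod_closed by blast
    show ?thesis
      unfolding evaluate_def
      by (rule B.M.add.finprod_mono_neutral_cong_left) (use f S z m F_closed in auto)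
  qed
  have lin: "linear_map K F B (evaluate B \<phi>)"
  proof (rule linear_mapI)
    fix f g assume f: "f \<in> carrier F" and g: "g \<in> carrier F"
    show "evaluate B \<phi> f \<in> carrier B"
      unfolding evaluate_def using f letter_prod_closed
      by (intro B.M.finsum_closed) (auto simp: carrier_F subset_iff simp del: in_lists_conv_set)
    let ?S = "supp K f \<union> supp K g"
    have S: "finite ?S" "?S \<subseteq> lists X" using f g by (auto simp: carrier_F)
    have fg: "f \<oplus>\<^bsub>F\<^esub> g \<in> carrier F" using f g by simp
    have sfg: "supp K (f \<oplus>\<^bsub>F\<^esub> g) \<subseteq> ?S" using f g by (auto simp: supp_def F_simps)
    have m: "w \<in> ?S \<Longrightarrow> letter_prod B \<phi> w \<in> carrier B" for w using S letter_prod_closed by blast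
    have "evaluate B \<phi> (f \<oplus>\<^bsub>F\<^esub> g) =
        (\<Oplus>\<^bsub>B\<^esub>w\<in>?S. f w \<odot>\<^bsub>B\<^esub> letter_prod B \<phi> w \<oplus>\<^bsub>B\<^esub> g w \<odot>\<^bsub>B\<^esub> letter_prod B \<phi> w)"
      unfolding sup[OF fg S(1) sfg S(2)]
      by (rule B.M.finsum_cong') (use f g m F_closed in \<open>auto simp: F_simps B.smult_l_distr\<close>)
    also have "\<dots> = evaluate B \<phi> f \<oplus>\<^bsub>B\<^esub> evaluate B \<phi> g"
      unfolding sup[OF f S(1) Un_upper1 S(2)] sup[OF g S(1) Un_upper2 S(2)]
      by (rule B.M.finsum_addf) (use f g m F_closed in auto)
    finally show "evaluate B \<phi> (f \<oplus>\<^bsub>F\<^esub> g) = evaluate B \<phi> f \<oplus>\<^bsub>B\<^esub> evaluate B \<phi> g" .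
  next
    fix c f assume c: "c \<in> carrier K" and f: "f \<in> carrier F"
    have S: "finite (supp K f)" "supp K f \<subseteq> lists X" using f by (auto simp: carrier_F)
    have cf: "c \<odot>\<^bsub>F\<^esub> f \<in> carrier F" using c f by simp
    have scf: "supp K (c \<odot>\<^bsub>F\<^esub> f) \<subseteq> supp K f" using c f by (auto simp: supp_def F_simps)
    have m: "w \<in> supp K f \<Longrightarrow> letter_prod B \<phi> w \<in> carrier B" for w using S letter_prod_closed by blast
    have "evaluate B \<phi> (c \<odot>\<^bsub>F\<^esub> f) = (\<Oplus>\<^bsub>B\<^esub>w\<in>supp K f. c \<odot>\<^bsub>B\<^esub> (f w \<odot>\<^bsub>B\<^esub> letter_prod B \<phi> w))"
      unfolding sup[OF cf S(1) scf S(2)]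
      by (rule B.M.finsum_cong') (use c f m F_closed in \<open>auto simp: F_simps B.smult_assoc1\<close>)
    also have "\<dots> = c \<odot>\<^bsub>B\<^esub> evaluate B \<phi> f"
      unfolding evaluate_def using c f m S F_closed by (intro B.finsum_smult_ldistr[symmetric]) auto
    finally show "evaluate B \<phi> (c \<odot>\<^bsub>F\<^esub> f) = c \<odot>\<^bsub>B\<^esub> evaluate B \<phi> f" .
  qed
  have ew: "evaluate B \<phi> (word K w) = letter_prod B \<phi> w" if w: "w \<in> lists X" for w
  proof -
    have "evaluate B \<phi> (word K w) = (\<Oplus>\<^bsub>B\<^esub>v\<in>{w}. word K w v \<odot>\<^bsub>B\<^esub> letter_prod B \<phi> v)"
      by (rule sup[OF word_closed[OF w]]) (use w in \<open>auto simp: supp_def word_def\<close>)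
    then show ?thesis using w by (simp add: word_def)
  qed
  show "x \<in> X \<Longrightarrow> evaluate B \<phi> (word K [x]) = \<phi> x"
    using ew[of "[x]"] \<phi> by simp
  have b1: "bilinear2 K F F B (\<lambda>x y. evaluate B \<phi> (x \<otimes>\<^bsub>F\<^esub> y))"
    by (intro bilinear2I linear_map_comp[OF bilinear2_right[OF F_mult_bilinear] lin]
        linear_map_comp[OF bilinear2_left[OF F_mult_bilinear] lin]) auto
  have b2: "bilinear2 K F F B (\<lambda>x y. evaluate B \<phi> x \<otimes>\<^bsub>B\<^esub> evaluate B \<phi> y)"
    by (intro bilinear2I linear_map_comp[OF lin bilinear2_right[OF B.mult_bilinear]]
        linear_map_comp[OF lin bilinear2_left[OF B.mult_bilinear]]) (auto intro: linear_map_closed[OF lin])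
  show "alg_hom K F B (evaluate B \<phi>)"
    unfolding alg_hom_def
  proof (intro conjI ballI lin)
    show "evaluate B \<phi> \<one>\<^bsub>F\<^esub> = \<one>\<^bsub>B\<^esub>" using ew[of "[]"] by (simp add: F_simps)
    fix x y assume xy: "x \<in> carrier F" "y \<in> carrier F"
    show "evaluate B \<phi> (x \<otimes>\<^bsub>F\<^esub> y) = evaluate B \<phi> x \<otimes>\<^bsub>B\<^esub> evaluate B \<phi> y"
      by (rule F_bilinear_ext[OF B.module_axioms b1 b2]) (auto simp: ew letter_prod_append word_mult xy)
  qed
qed

end

section \<open>Quotients of algebras by relations\<close>

text \<open>The elements of \<open>P p\<close> represent the component of parity \<open>p\<close> of the quotient.\<close>

locale alg_quot = assoc_algebra K A
  for K :: "('k, 'm) ring_scheme" and A :: "('k, 'a, 'n) module_scheme" +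
  fixes P :: "bit \<Rightarrow> 'a set" and Rel :: "'a set"
  assumes Rel: "Rel \<subseteq> carrier A"
begin

definition "I = genideal A Rel"
definition "Q = quot_algebra A P I"
definition "\<pi> x = I +>\<^bsub>A\<^esub> x"

sublocale id: ideal I A
  unfolding I_def by (rule genideal_ideal[OF Rel])

lemma Q_simps:
  "carrier Q = \<pi> ` carrier A" "zero Q = I" "one Q = \<pi> \<one>\<^bsub>A\<^esub>" "part Q p = \<pi> ` P p"
  by (auto simp: Q_def \<pi>_def[abs_def] quot_algebra_def FactRing_simps)

text \<open>A ring ideal is a subspace, since scalars act as multiples of the unit.\<close>

lemma I_smult: "c \<in> carrier K \<Longrightarrow> i \<in> I \<Longrightarrow> c \<odot>\<^bsub>A\<^esub> i \<in> I"
  using id.I_l_closed[of i "c \<odot>\<^bsub>A\<^esub> \<one>\<^bsub>A\<^esub>"] smult_mult_left[of c "\<one>\<^bsub>A\<^esub>" i] by auto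

lemma \<pi>_eq_iff: "x \<in> carrier A \<Longrightarrow> y \<in> carrier A \<Longrightarrow> \<pi> x = \<pi> y \<longleftrightarrow> x \<ominus>\<^bsub>A\<^esub> y \<in> I"
  unfolding \<pi>_def
  by (metis id.a_rcos_module_minus ring_axioms id.a_repr_independence' id.a_rcos_self)

lemma Q_mult: "x \<in> carrier A \<Longrightarrow> y \<in> carrier A \<Longrightarrow> \<pi> x \<otimes>\<^bsub>Q\<^esub> \<pi> y = \<pi> (x \<otimes>\<^bsub>A\<^esub> y)"
  by (simp add: Q_def \<pi>_def quot_algebra_def FactRing_def id.rcoset_mult_add)

lemma Q_add: "x \<in> carrier A \<Longrightarrow> y \<in> carrier A \<Longrightarrow> \<pi> x \<oplus>\<^bsub>Q\<^esub> \<pi> y = \<pi> (x \<oplus>\<^bsub>A\<^esub> y)"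
  by (simp add: Q_def \<pi>_def quot_algebra_def FactRing_def id.a_rcos_sum)

lemma Q_smult:
  assumes c: "c \<in> carrier K" and x: "x \<in> carrier A"
  shows "c \<odot>\<^bsub>Q\<^esub> \<pi> x = \<pi> (c \<odot>\<^bsub>A\<^esub> x)"
proof -
  have "\<pi> (c \<odot>\<^bsub>A\<^esub> y) = \<pi> (c \<odot>\<^bsub>A\<^esub> x)" if y: "y \<in> \<pi> x" for y
  proof -
    obtain i where i: "i \<in> I" "y = i \<oplus>\<^bsub>A\<^esub> x"
      using y by (auto simp: \<pi>_def a_r_coset_def r_coset_def)
    note [simp] = id.a_Hcarr[OF i(1)]
    have "c \<odot>\<^bsub>A\<^esub> y \<ominus>\<^bsub>A\<^esub> c \<odot>\<^bsub>A\<^esub> x = c \<odot>\<^bsub>A\<^esub> i"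
      using c x i by (simp add: smult_r_distr M.cancel)
    then show ?thesis using c x i I_smult by (subst \<pi>_eq_iff) auto
  qed
  moreover have "x \<in> \<pi> x" using x unfolding \<pi>_def by (rule id.a_rcos_self)
  ultimately have "(\<Union>y\<in>\<pi> x. \<pi> (c \<odot>\<^bsub>A\<^esub> y)) = \<pi> (c \<odot>\<^bsub>A\<^esub> x)" by blast
  then show ?thesis by (simp add: Q_def quot_algebra_def \<pi>_def[abs_def])
qed

lemma Q_zero: "zero Q = \<pi> \<zero>\<^bsub>A\<^esub>"
  unfolding Q_simps \<pi>_def by (simp add: id.a_rcos_const)

lemma Q_assoc_algebra: "assoc_algebra K Q"
proof -
  have m: "module K Q"
  proof (intro moduleI abelian_groupI R.is_cring)
    fix x assume "x \<in> carrier Q"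
    then obtain a where "a \<in> carrier A" "x = \<pi> a" by (auto simp: Q_simps)
    then show "\<exists>y\<in>carrier Q. y \<oplus>\<^bsub>Q\<^esub> x = \<zero>\<^bsub>Q\<^esub>"
      by (intro bexI[of _ "\<pi> (\<ominus>\<^bsub>A\<^esub> a)"]) (auto simp: Q_simps(1) Q_add Q_zero M.l_neg)
  qed (auto simp: Q_simps(1) Q_zero Q_add Q_smult M.a_ac smult_l_distr smult_r_distr smult_assoc1)
  then interpret Q: module K Q .
  have "ring Q"
    by (intro ringI Q.M.abelian_group_axioms monoidI)
      (auto simp: Q_simps(1,3) Q_add Q_mult m_assoc l_distr r_distr)
  then show ?thesis
    unfolding assoc_algebra_def assoc_algebra_axioms_def using m
    by (auto simp: Q_simps(1) Q_smult Q_mult smult_mult_left smult_mult_right)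
qed

lemma \<pi>_hom: "alg_hom K A Q \<pi>"
  by (auto simp: alg_hom_def linear_map_def Q_simps(1,3) Q_add Q_mult Q_smult)

lemma \<pi>_Rel: "r \<in> Rel \<Longrightarrow> \<pi> r = \<zero>\<^bsub>Q\<^esub>"
  unfolding Q_simps \<pi>_def using genideal_self[OF Rel] by (intro id.a_rcos_const) (auto simp: I_def)

lemma factor:
  assumes B: "assoc_algebra K B" and f: "alg_hom K A B f" and r: "\<And>r. r \<in> Rel \<Longrightarrow> f r = \<zero>\<^bsub>B\<^esub>"
  shows "\<exists>g. alg_hom K Q B g \<and> (\<forall>x\<in>carrier A. g (\<pi> x) = f x)"
proof -
  interpret B: assoc_algebra K B by fact
  note fl = alg_hom_linear[OF f]
  note [simp] = alg_hom_closed[OF f] alg_hom_mult[OF f] alg_hom_one[OF f]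
    linear_map_add[OF fl] linear_map_smult[OF fl]
    linear_map_neg[OF fl module_axioms B.module_axioms]
    linear_map_zero[OF fl module_axioms B.module_axioms]
  let ?N = "{x \<in> carrier A. f x = \<zero>\<^bsub>B\<^esub>}"
  have "ideal ?N A"
    by (rule idealI) (auto simp: M.a_group add.group_axioms ring_axioms B.l_null B.r_null
        simp flip: a_inv_def intro!: M.add.subgroupI)
  then have IN: "I \<subseteq> ?N" unfolding I_def using r Rel by (intro genideal_minimal) auto
  have fe: "f x = f y" if "x \<in> carrier A" "y \<in> carrier A" "\<pi> x = \<pi> y" for x y
  proof -
    have "f (x \<ominus>\<^bsub>A\<^esub> y) = \<zero>\<^bsub>B\<^esub>" using that IN \<pi>_eq_iff by auto
    then show ?thesis using that linear_map_minus[OF fl module_axioms B.module_axioms]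
      by (simp add: B.M.minus_zero_iff)
  qed
  define g where "g X = f (SOME x. x \<in> carrier A \<and> \<pi> x = X)" for X
  have g: "g (\<pi> x) = f x" if "x \<in> carrier A" for x
  proof -
    let ?y = "SOME y. y \<in> carrier A \<and> \<pi> y = \<pi> x"
    have "?y \<in> carrier A \<and> \<pi> ?y = \<pi> x" by (rule someI[of _ x]) (use that in simp)
    then show ?thesis unfolding g_def using fe that by blast
  qed
  then show ?thesis
    by (intro exI[of _ g]) (auto simp: alg_hom_def linear_map_def Q_simps(1,3) Q_add Q_smult Q_mult)
qed

end

section \<open>The tensor superalgebra\<close>

text \<open>
  \<open>A\<close> is generated by the image of \<open>V\<close> under \<open>j\<close>, as an induction principle for homogeneous elements:
  only sums of elements of equal parity are formed, so that statements with signs can be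
  proved by induction.
\<close>

definition graded_generated where
  "graded_generated K V A j \<longleftrightarrow> (\<forall>Q. (\<forall>p. Q p \<zero>\<^bsub>A\<^esub>) \<and> Q 0 \<one>\<^bsub>A\<^esub> \<and>
     (\<forall>p. \<forall>x\<in>part V p. Q p (j x)) \<and>
     (\<forall>p. \<forall>a\<in>part A p. \<forall>b\<in>part A p. Q p a \<longrightarrow> Q p b \<longrightarrow> Q p (a \<oplus>\<^bsub>A\<^esub> b)) \<and>
     (\<forall>p. \<forall>c\<in>carrier K. \<forall>a\<in>part A p. Q p a \<longrightarrow> Q p (c \<odot>\<^bsub>A\<^esub> a)) \<and>
     (\<forall>p q. \<forall>a\<in>part A p. \<forall>b\<in>part A q. Q p a \<longrightarrow> Q q b \<longrightarrow> Q (p + q) (a \<otimes>\<^bsub>A\<^esub> b)) \<longrightarrow>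
     (\<forall>p. \<forall>a\<in>part A p. Q p a))"

lemma graded_generatedD [consumes 2, case_names zero one gen add smult mult]:
  assumes "graded_generated K V A j" "a \<in> part A p"
    "\<And>p. Q p \<zero>\<^bsub>A\<^esub>" "Q 0 \<one>\<^bsub>A\<^esub>" "\<And>p x. x \<in> part V p \<Longrightarrow> Q p (j x)"
    "\<And>p a b. a \<in> part A p \<Longrightarrow> b \<in> part A p \<Longrightarrow> Q p a \<Longrightarrow> Q p b \<Longrightarrow> Q p (a \<oplus>\<^bsub>A\<^esub> b)"
    "\<And>p c a. c \<in> carrier K \<Longrightarrow> a \<in> part A p \<Longrightarrow> Q p a \<Longrightarrow> Q p (c \<odot>\<^bsub>A\<^esub> a)"
    "\<And>p q a b. a \<in> part A p \<Longrightarrow> b \<in> part A q \<Longrightarrow> Q p a \<Longrightarrow> Q q b \<Longrightarrow> Q (p + q) (a \<otimes>\<^bsub>A\<^esub> b)"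
  shows "Q p a"
  using assms(1) unfolding graded_generated_def
  by (elim allE[of _ Q]) (use assms(2-) in blast)

lemma homog_word_append:
  "homog_word V p u \<Longrightarrow> homog_word V q v \<Longrightarrow> homog_word V (p + q) (u @ v)"
  by (induction u arbitrary: p) (auto simp: add.assoc, blast)

lemma (in super_space) homog_word_lists: "homog_word V p w \<Longrightarrow> w \<in> lists (carrier V)"
  by (induction w arbitrary: p) (auto simp: part_closed)

text \<open>Invertibility of 2 makes the eigenspaces of an involution for the eigenvalues 1 and -1 meet trivially.\<close>

locale tensor = super_space K V
  for K :: "('k, 'm) ring_scheme" and V :: "('k, 'a, 'n) super_scheme" +
  assumes two: "\<one>\<^bsub>K\<^esub> \<oplus>\<^bsub>K\<^esub> \<one>\<^bsub>K\<^esub> \<noteq> \<zero>\<^bsub>K\<^esub>"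
begin

sublocale FA: free_alg K "carrier V" ..

abbreviation "F \<equiv> free_algebra K (carrier V)"
abbreviation "T \<equiv> tensor_algebra K V"
abbreviation "t \<equiv> tensor_incl K V"

definition "homogF p = {f \<in> carrier F. \<forall>w\<in>supp K f. homog_word V p w}"

definition "linRel = {word K [x \<oplus>\<^bsub>V\<^esub> y] \<ominus>\<^bsub>F\<^esub> (word K [x] \<oplus>\<^bsub>F\<^esub> word K [y]) | x y. x \<in> carrier V \<and> y \<in> carrier V} \<union>
       {word K [c \<odot>\<^bsub>V\<^esub> x] \<ominus>\<^bsub>F\<^esub> c \<odot>\<^bsub>F\<^esub> word K [x] | c x. c \<in> carrier K \<and> x \<in> carrier V}"

sublocale TQ: alg_quot K F homogF linRel
  by (intro alg_quot.intro alg_quot_axioms.intro FA.F_assoc_algebra) (auto simp: linRel_def)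

lemma lin_ideal_eq: "lin_ideal K V = TQ.I"
  unfolding TQ.I_def by (simp add: lin_ideal_def linRel_def Let_def)

lemma T_eq: "T = TQ.Q"
  unfolding TQ.Q_def lin_ideal_eq[symmetric] by (simp add: tensor_algebra_def homogF_def[abs_def] Let_def)

lemma t_eq: "t x = TQ.\<pi> (word K [x])"
  unfolding TQ.\<pi>_def lin_ideal_eq[symmetric] by (simp add: tensor_incl_def)

sublocale TA: assoc_algebra K T
  unfolding T_eq by (rule TQ.Q_assoc_algebra)

lemma pi_hom: "alg_hom K F T TQ.\<pi>"
  unfolding T_eq by (rule TQ.\<pi>_hom)

lemma t_linear: "linear_map K V T t"
proof (rule linear_mapI)
  note l = alg_hom_linear[OF pi_hom]
  note [simp] = linear_map_minus[OF l FA.F_module TA.module_axioms] linear_map_add[OF l]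
    linear_map_smult[OF l] linear_map_closed[OF l]
  show "t x \<in> carrier T" if "x \<in> carrier V" for x
    using that by (auto simp: t_eq)
  fix x y assume xy: "x \<in> carrier V" "y \<in> carrier V"
  have "TQ.\<pi> (word K [x \<oplus>\<^bsub>V\<^esub> y] \<ominus>\<^bsub>F\<^esub> (word K [x] \<oplus>\<^bsub>F\<^esub> word K [y])) = \<zero>\<^bsub>T\<^esub>"
    unfolding T_eq using xy by (intro TQ.\<pi>_Rel) (auto simp: linRel_def)
  then show "t (x \<oplus>\<^bsub>V\<^esub> y) = t x \<oplus>\<^bsub>T\<^esub> t y"
    using xy by (simp add: t_eq TA.M.minus_zero_iff)
next
  note l = alg_hom_linear[OF pi_hom]
  note [simp] = linear_map_minus[OF l FA.F_module TA.module_axioms] linear_map_add[OF l]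
    linear_map_smult[OF l] linear_map_closed[OF l]
  fix c x assume xy: "c \<in> carrier K" "x \<in> carrier V"
  have "TQ.\<pi> (word K [c \<odot>\<^bsub>V\<^esub> x] \<ominus>\<^bsub>F\<^esub> c \<odot>\<^bsub>F\<^esub> word K [x]) = \<zero>\<^bsub>T\<^esub>"
    unfolding T_eq using xy by (intro TQ.\<pi>_Rel) (auto simp: linRel_def)
  then show "t (c \<odot>\<^bsub>V\<^esub> x) = c \<odot>\<^bsub>T\<^esub> t x"
    using xy by (simp add: t_eq TA.M.minus_zero_iff)
qed

lemma T_universal_algebra:
  assumes B: "assoc_algebra K B" and \<phi>: "linear_map K V B \<phi>"
  shows "\<exists>f. alg_hom K T B f \<and> (\<forall>x\<in>carrier V. f (t x) = \<phi> x)"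
proof -
  interpret B: assoc_algebra K B by fact
  note c = linear_map_closed[OF \<phi>]
  note h = FA.evaluate_hom[OF B c] and e = FA.evaluate_letter[OF B c]
  note l = alg_hom_linear[OF h]
  have "FA.evaluate B \<phi> r = \<zero>\<^bsub>B\<^esub>" if "r \<in> linRel" for r
    using that unfolding linRel_def
    by (auto simp: linear_map_minus[OF l FA.F_module B.module_axioms] linear_map_add[OF l]
        linear_map_smult[OF l] e linear_map_add[OF \<phi>] linear_map_smult[OF \<phi>] c
        B.M.minus_zero_iff)
  from TQ.factor[OF B h this] obtain g where
    "alg_hom K T B g" "\<forall>x\<in>carrier F. g (TQ.\<pi> x) = FA.evaluate B \<phi> x"
    unfolding T_eq by auto
  then show ?thesis using e by (intro exI[of _ g]) (auto simp: t_eq)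
qed

lemma part_T: "part T p = TQ.\<pi> ` homogF p"
  unfolding T_eq TQ.Q_simps ..

lemma homogF_submodule: "submodule (homogF p) K F"
proof (rule FA.FM.submoduleI)
  have s: "supp K (f \<oplus>\<^bsub>F\<^esub> g) \<subseteq> supp K f \<union> supp K g" if "f \<in> carrier F" "g \<in> carrier F" for f g
    using that by (auto simp: supp_def FA.F_simps)
  have c: "supp K (c \<odot>\<^bsub>F\<^esub> f) \<subseteq> supp K f" if "c \<in> carrier K" "f \<in> carrier F" for c f
    using that by (auto simp: supp_def FA.F_simps)
  have sm: "c \<odot>\<^bsub>F\<^esub> f \<in> homogF p" if "c \<in> carrier K" "f \<in> homogF p" for c f
    using that c[of c f] by (auto simp: homogF_def)
  show "\<ominus>\<^bsub>F\<^esub> f \<in> homogF p" if f: "f \<in> homogF p" for f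
  proof -
    have "\<ominus>\<^bsub>F\<^esub> f = (\<ominus>\<^bsub>K\<^esub> \<one>\<^bsub>K\<^esub>) \<odot>\<^bsub>F\<^esub> f"
      using f by (subst FA.FM.smult_l_minus) (auto simp: homogF_def)
    then show ?thesis using sm[OF _ f] by simp
  qed
  show "\<zero>\<^bsub>F\<^esub> \<in> homogF p"
    using FA.FM.M.zero_closed by (simp add: homogF_def) (simp add: FA.F_simps supp_def)
  show "f \<oplus>\<^bsub>F\<^esub> g \<in> homogF p" if "f \<in> homogF p" "g \<in> homogF p" for f g
    using that s[of f g] by (auto simp: homogF_def)
  show "c \<odot>\<^bsub>F\<^esub> f \<in> homogF p" if "c \<in> carrier K" "f \<in> homogF p" for c f
    by (rule sm[OF that])
qed (auto simp: homogF_def)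

lemmas homogF_closed = FA.FM.submoduleE[OF homogF_submodule]

lemma homogF_mult:
  assumes "f \<in> homogF p" "g \<in> homogF q"
  shows "f \<otimes>\<^bsub>F\<^esub> g \<in> homogF (p + q)"
proof -
  have c: "f \<in> carrier F" "g \<in> carrier F" using assms by (auto simp: homogF_def)
  have "homog_word V (p + q) w" if w: "w \<in> supp K (f \<otimes>\<^bsub>F\<^esub> g)" for w
  proof (rule ccontr)
    assume n: "\<not> homog_word V (p + q) w"
    have "f (take i w) \<otimes>\<^bsub>K\<^esub> g (drop i w) = \<zero>\<^bsub>K\<^esub>" for i
    proof -
      have "take i w \<notin> supp K f \<or> drop i w \<notin> supp K g"
        using n assms homog_word_append[of V p "take i w" q "drop i w"] by (auto simp: homogF_def)
      then show ?thesis using c by (auto simp: supp_def FA.carrier_F)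
    qed
    then show False using w by (simp add: supp_def FA.F_simps finsum_zero)
  qed
  then show ?thesis using c FA.F_mult_closed by (simp add: homogF_def)
qed

lemma word_homogF: "homog_word V p w \<Longrightarrow> word K w \<in> homogF p"
  using FA.word_closed[OF homog_word_lists] by (auto simp: homogF_def) (auto simp: supp_def word_def split: if_splits)

lemma homogF_induct:
  assumes f: "f \<in> homogF p" and z: "Q \<zero>\<^bsub>F\<^esub>"
    and s: "\<And>g c w. g \<in> homogF p \<Longrightarrow> c \<in> carrier K \<Longrightarrow> homog_word V p w \<Longrightarrow> Q g \<Longrightarrow>
        Q (g \<oplus>\<^bsub>F\<^esub> c \<odot>\<^bsub>F\<^esub> word K w)"
  shows "Q f"
proof -
  have "f \<in> carrier F" using f by (simp add: homogF_def)
  then have "f \<in> homogF p \<and> Q f"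
  proof (rule FA.free_induct[where P = "\<lambda>f. f \<in> homogF p \<and> Q f"])
    show "\<zero>\<^bsub>F\<^esub> \<in> homogF p \<and> Q \<zero>\<^bsub>F\<^esub>"
      using z subgroup.one_closed[OF submodule.axioms(1)[OF homogF_submodule[of p]]] by simp
    fix g c w assume *: "c \<in> carrier K" "w \<in> supp K f" "g \<in> homogF p \<and> Q g"
    then have w: "homog_word V p w" using f by (auto simp: homogF_def)
    show "g \<oplus>\<^bsub>F\<^esub> c \<odot>\<^bsub>F\<^esub> word K w \<in> homogF p \<and> Q (g \<oplus>\<^bsub>F\<^esub> c \<odot>\<^bsub>F\<^esub> word K w)"
      using * s[OF _ _ w] homogF_closed(5)[OF _ homogF_closed(4)[OF *(1) word_homogF[OF w]]] by blast
  qed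
  then show ?thesis ..
qed

lemma part_T_submodule: "submodule (part T p) K T"
proof (rule TA.submoduleI)
  note l = alg_hom_linear[OF pi_hom]
  note l' = linear_map_add[OF l, symmetric] linear_map_smult[OF l, symmetric]
    linear_map_neg[OF l FA.F_module TA.module_axioms, symmetric]
  have h: "f \<in> homogF p \<Longrightarrow> f \<in> carrier F" for f p by (simp add: homogF_def)
  show "part T p \<subseteq> carrier T" using h linear_map_closed[OF l] by (auto simp: part_T)
  show "\<zero>\<^bsub>T\<^esub> \<in> part T p"
    unfolding part_T
    using linear_map_zero[OF l FA.F_module TA.module_axioms]
      subgroup.one_closed[OF submodule.axioms(1)[OF homogF_submodule[of p]]] by force
  show "\<ominus>\<^bsub>T\<^esub> a \<in> part T p" if "a \<in> part T p" for a
    using that h homogF_closed by (auto simp: part_T l')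
  show "a \<oplus>\<^bsub>T\<^esub> b \<in> part T p" if "a \<in> part T p" "b \<in> part T p" for a b
    using that h homogF_closed by (auto simp: part_T l')
  show "c \<odot>\<^bsub>T\<^esub> a \<in> part T p" if "c \<in> carrier K" "a \<in> part T p" for c a
    using that h homogF_closed by (auto simp: part_T l')
qed

lemmas part_T_closed = TA.submoduleE[OF part_T_submodule]

lemma part_T_carrier: "a \<in> part T p \<Longrightarrow> a \<in> carrier T"
  using part_T_closed(1) by blast

lemma part_T_mult: "a \<in> part T p \<Longrightarrow> b \<in> part T q \<Longrightarrow> a \<otimes>\<^bsub>T\<^esub> b \<in> part T (p + q)"
proof -
  assume "a \<in> part T p" "b \<in> part T q"
  then obtain f g where "f \<in> homogF p" "g \<in> homogF q" "a = TQ.\<pi> f" "b = TQ.\<pi> g"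
    by (auto simp: part_T)
  moreover from this have "f \<in> carrier F" "g \<in> carrier F" by (simp_all add: homogF_def)
  ultimately have "a \<otimes>\<^bsub>T\<^esub> b = TQ.\<pi> (f \<otimes>\<^bsub>F\<^esub> g)" "f \<otimes>\<^bsub>F\<^esub> g \<in> homogF (p + q)"
    using alg_hom_mult[OF pi_hom, of f g] by (simp_all add: homogF_mult)
  then show ?thesis unfolding part_T by blast
qed

lemma t_part: "x \<in> part V p \<Longrightarrow> t x \<in> part T p"
  unfolding t_eq part_T by (intro imageI word_homogF) auto

lemma one_part: "\<one>\<^bsub>T\<^esub> \<in> part T 0"
proof -
  have "word K [] \<in> homogF 0" by (rule word_homogF) simp
  then show ?thesis
    unfolding part_T using alg_hom_one[OF pi_hom] by (force simp: FA.F_simps)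
qed

lemma pi_Cons:
  "x \<in> carrier V \<Longrightarrow> w \<in> lists (carrier V) \<Longrightarrow>
    TQ.\<pi> (word K (x # w)) = t x \<otimes>\<^bsub>T\<^esub> TQ.\<pi> (word K w)"
  using alg_hom_mult[OF pi_hom, of "word K [x]" "word K w"] by (simp add: t_eq FA.word_mult)

text \<open>
  The letters of a word need not be homogeneous. Splitting each letter into its even and odd part, one letter at a
  time, writes the class of the word as a sum of classes of homogeneous words.
\<close>

lemma T_carrier_sum:
  assumes "X \<in> carrier T"
  shows "\<exists>a\<in>part T 0. \<exists>b\<in>part T 1. X = a \<oplus>\<^bsub>T\<^esub> b"
proof -
  let ?D = "\<lambda>X. \<exists>a\<in>part T 0. \<exists>b\<in>part T 1. X = a \<oplus>\<^bsub>T\<^esub> b"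
  note l = alg_hom_linear[OF pi_hom]
  have z: "\<zero>\<^bsub>T\<^esub> \<in> part T p" for p
    using subgroup.one_closed[OF submodule.axioms(1)[OF part_T_submodule[of p]]] by simp
  have Dadd: "?D (X \<oplus>\<^bsub>T\<^esub> Y)" if X: "?D X" and Y: "?D Y" for X Y
  proof -
    from X Y obtain a b a' b' where p: "a \<in> part T 0" "a' \<in> part T 0" "b \<in> part T 1" "b' \<in> part T 1"
      and e: "X = a \<oplus>\<^bsub>T\<^esub> b" "Y = a' \<oplus>\<^bsub>T\<^esub> b'" by blast
    have "X \<oplus>\<^bsub>T\<^esub> Y = (a \<oplus>\<^bsub>T\<^esub> a') \<oplus>\<^bsub>T\<^esub> (b \<oplus>\<^bsub>T\<^esub> b')"
      using p[THEN part_T_carrier] by (simp add: e TA.M.a_ac)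
    then show ?thesis using p part_T_closed(5) by blast
  qed
  have Dsm: "?D (c \<odot>\<^bsub>T\<^esub> X)" if c: "c \<in> carrier K" and X: "?D X" for c X
    using X c TA.smult_r_distr part_T_closed(4) part_T_carrier by metis
  have Dw: "?D (TQ.\<pi> (word K w))" if "w \<in> lists (carrier V)" for w
    using that
  proof (induction w)
    case Nil
    have "TQ.\<pi> (word K []) = \<one>\<^bsub>T\<^esub>" using alg_hom_one[OF pi_hom] by (simp add: FA.F_simps)
    then have "TQ.\<pi> (word K []) = \<one>\<^bsub>T\<^esub> \<oplus>\<^bsub>T\<^esub> \<zero>\<^bsub>T\<^esub>" by simp
    then show ?case using one_part z[of 1] by blast
  next
    case (Cons x w)
    obtain x0 x1 where x: "x0 \<in> part V 0" "x1 \<in> part V 1" "x = x0 \<oplus>\<^bsub>V\<^esub> x1"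
      using carrier_part_cases[of x] Cons by auto
    obtain a b where ab: "a \<in> part T 0" "b \<in> part T 1" "TQ.\<pi> (word K w) = a \<oplus>\<^bsub>T\<^esub> b"
      using Cons by auto
    note xc = x(1,2)[THEN part_closed]
    note tc = x(1,2)[THEN t_part]
    note c = tc[THEN part_T_carrier] ab(1,2)[THEN part_T_carrier]
    have "TQ.\<pi> (word K (x # w)) = (t x0 \<oplus>\<^bsub>T\<^esub> t x1) \<otimes>\<^bsub>T\<^esub> (a \<oplus>\<^bsub>T\<^esub> b)"
      using Cons ab x xc by (simp add: pi_Cons linear_map_add[OF t_linear])
    also have "\<dots> = (t x0 \<otimes>\<^bsub>T\<^esub> a \<oplus>\<^bsub>T\<^esub> t x1 \<otimes>\<^bsub>T\<^esub> b) \<oplus>\<^bsub>T\<^esub> (t x0 \<otimes>\<^bsub>T\<^esub> b \<oplus>\<^bsub>T\<^esub> t x1 \<otimes>\<^bsub>T\<^esub> a)"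
      using c by (simp add: TA.l_distr TA.r_distr TA.M.a_ac)
    moreover have "t x0 \<otimes>\<^bsub>T\<^esub> a \<oplus>\<^bsub>T\<^esub> t x1 \<otimes>\<^bsub>T\<^esub> b \<in> part T 0"
      using part_T_mult[OF tc(1) ab(1)] part_T_mult[OF tc(2) ab(2)] by (intro part_T_closed(5)) auto
    moreover have "t x0 \<otimes>\<^bsub>T\<^esub> b \<oplus>\<^bsub>T\<^esub> t x1 \<otimes>\<^bsub>T\<^esub> a \<in> part T 1"
      using part_T_mult[OF tc(1) ab(2)] part_T_mult[OF tc(2) ab(1)] by (intro part_T_closed(5)) auto
    ultimately show ?case by blast
  qed
  obtain f where f: "f \<in> carrier F" "X = TQ.\<pi> f"
    using assms unfolding T_eq TQ.Q_simps by auto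
  have "?D (TQ.\<pi> f)"
    using f(1)
  proof (induction rule: FA.free_induct)
    case zero
    have "TQ.\<pi> \<zero>\<^bsub>F\<^esub> = \<zero>\<^bsub>T\<^esub> \<oplus>\<^bsub>T\<^esub> \<zero>\<^bsub>T\<^esub>"
      using linear_map_zero[OF l FA.F_module TA.module_axioms] by simp
    then show ?case using z[of 0] z[of 1] by blast
  next
    case (step g c w)
    have "TQ.\<pi> (g \<oplus>\<^bsub>F\<^esub> c \<odot>\<^bsub>F\<^esub> word K w) = TQ.\<pi> g \<oplus>\<^bsub>T\<^esub> c \<odot>\<^bsub>T\<^esub> TQ.\<pi> (word K w)"
      using step by (simp add: linear_map_add[OF l] linear_map_smult[OF l])
    then show ?case using Dadd[OF step(5) Dsm[OF step(2) Dw[OF step(3)]]] by simp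
  qed
  then show ?thesis using f by simp
qed

text \<open>
  The parity involution \<open>\<tau>\<close> of \<open>V\<close> extends to \<open>T(V)\<close>, where it acts by 1 on the even and by
  \<open>-1\<close> on the odd component. An element of both components therefore satisfies \<open>2a = 0\<close>.
\<close>

lemma T_part_inter:
  assumes "a \<in> part T 0" "a \<in> part T 1"
  shows "a = \<zero>\<^bsub>T\<^esub>"
proof -
  have "linear_map K V V (\<lambda>x. proj V 0 x \<oplus>\<^bsub>V\<^esub> \<ominus>\<^bsub>V\<^esub> proj V 1 x)"
    by (intro linear_map_plus linear_map_uminus proj_linear module)
  from T_universal_algebra[OF TA.assoc_algebra_axioms linear_map_comp[OF this t_linear]]
  obtain \<tau> where \<tau>: "alg_hom K T T \<tau>"
    and \<tau>t: "\<And>x. x \<in> carrier V \<Longrightarrow> \<tau> (t x) = t (proj V 0 x \<oplus>\<^bsub>V\<^esub> \<ominus>\<^bsub>V\<^esub> proj V 1 x)" by blast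
  note l = alg_hom_linear[OF \<tau>] and lp = alg_hom_linear[OF pi_hom]
  have \<tau>g: "\<tau> (t x) = sgnmul T p (t x)" if "x \<in> part V p" for x p
    using that part_closed[OF that] \<tau>t[OF part_closed[OF that]] linear_map_neg[OF t_linear module TA.module_axioms]
    by (cases p) (simp_all add: sgnmul_def)
  have \<tau>w: "\<tau> (TQ.\<pi> (word K w)) = sgnmul T p (TQ.\<pi> (word K w))" if "homog_word V p w" for w p
    using that
  proof (induction w arbitrary: p)
    case Nil
    have "TQ.\<pi> (word K []) = \<one>\<^bsub>T\<^esub>" using alg_hom_one[OF pi_hom] by (simp add: FA.F_simps)
    then show ?case using Nil alg_hom_one[OF \<tau>] by simp
  next
    case (Cons x w)
    then obtain q r where qr: "p = q + r" "x \<in> part V q" "homog_word V r w" by auto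
    have wl: "w \<in> lists (carrier V)" by (rule homog_word_lists[OF qr(3)])
    have c: "t x \<in> carrier T" "TQ.\<pi> (word K w) \<in> carrier T"
      using linear_map_closed[OF t_linear part_closed[OF qr(2)]] alg_hom_closed[OF pi_hom] wl by auto
    show ?case
      using c Cons.IH[OF qr(3)] \<tau>g[OF qr(2)] qr(1)
      by (simp add: pi_Cons[OF part_closed[OF qr(2)] wl] alg_hom_mult[OF \<tau>]
          bilinear2_sgn_left[OF TA.mult_bilinear TA.module_axioms TA.module_axioms TA.module_axioms]
          bilinear2_sgn_right[OF TA.mult_bilinear TA.module_axioms TA.module_axioms TA.module_axioms] add.commute)
  qed
  have \<tau>p: "\<tau> a = sgnmul T p a" if a: "a \<in> part T p" for a p
  proof -
    obtain f where f: "f \<in> homogF p" "a = TQ.\<pi> f" using a by (auto simp: part_T)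
    have "\<tau> (TQ.\<pi> f) = sgnmul T p (TQ.\<pi> f)"
      using f(1)
    proof (rule homogF_induct)
      show "\<tau> (TQ.\<pi> \<zero>\<^bsub>F\<^esub>) = sgnmul T p (TQ.\<pi> \<zero>\<^bsub>F\<^esub>)"
        using linear_map_zero[OF lp FA.F_module TA.module_axioms]
          linear_map_zero[OF l TA.module_axioms TA.module_axioms] by simp
      fix g c w assume a: "g \<in> homogF p" "c \<in> carrier K" "homog_word V p w"
        "\<tau> (TQ.\<pi> g) = sgnmul T p (TQ.\<pi> g)"
      have c: "g \<in> carrier F" "word K w \<in> carrier F"
        using a homog_word_lists by (auto simp: homogF_def)
      have "TQ.\<pi> g \<in> carrier T" "TQ.\<pi> (word K w) \<in> carrier T"
        using c alg_hom_closed[OF pi_hom] by blast+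
      then show "\<tau> (TQ.\<pi> (g \<oplus>\<^bsub>F\<^esub> c \<odot>\<^bsub>F\<^esub> word K w)) = sgnmul T p (TQ.\<pi> (g \<oplus>\<^bsub>F\<^esub> c \<odot>\<^bsub>F\<^esub> word K w))"
        using a c by (simp add: linear_map_add[OF lp] linear_map_smult[OF lp] linear_map_add[OF l]
            linear_map_smult[OF l] \<tau>w TA.sgnmul_add TA.sgnmul_smult)
    qed
    then show ?thesis using f by simp
  qed
  have a: "a \<in> carrier T" using assms part_T_carrier by blast
  have "a = \<ominus>\<^bsub>T\<^esub> a" using \<tau>p[OF assms(1)] \<tau>p[OF assms(2)] by (simp add: sgnmul_def)
  then have "a \<oplus>\<^bsub>T\<^esub> a = \<zero>\<^bsub>T\<^esub>" using a by (metis TA.M.r_neg)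
  then have e: "(\<one>\<^bsub>K\<^esub> \<oplus>\<^bsub>K\<^esub> \<one>\<^bsub>K\<^esub>) \<odot>\<^bsub>T\<^esub> a = \<zero>\<^bsub>T\<^esub>"
    using a by (simp add: TA.smult_l_distr)
  let ?c = "\<one>\<^bsub>K\<^esub> \<oplus>\<^bsub>K\<^esub> \<one>\<^bsub>K\<^esub>"
  have u: "?c \<in> Units K" using two by (simp add: field_Units)
  have "a = (inv\<^bsub>K\<^esub> ?c \<otimes>\<^bsub>K\<^esub> ?c) \<odot>\<^bsub>T\<^esub> a" using u a Units_l_inv[OF u] by simp
  also have "\<dots> = inv\<^bsub>K\<^esub> ?c \<odot>\<^bsub>T\<^esub> (?c \<odot>\<^bsub>T\<^esub> a)"
    using u a by (intro TA.smult_assoc1) auto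
  also have "\<dots> = \<zero>\<^bsub>T\<^esub>" unfolding e using u by (intro TA.smult_r_null) auto
  finally show ?thesis .
qed

lemma T_superalgebra: "superalgebra K T"
proof (intro superalgebra.intro superalgebra_axioms.intro super_space.intro super_space_axioms.intro
    field_axioms TA.module_axioms TA.ring_axioms part_T_submodule one_part)
  show "part T 0 <+>\<^bsub>T\<^esub> part T 1 = carrier T"
    using part_T_carrier T_carrier_sum by (auto simp: set_add_def set_mult_def)
  show "part T 0 \<inter> part T 1 = {\<zero>\<^bsub>T\<^esub>}"
    using T_part_inter subgroup.one_closed[OF submodule.axioms(1)[OF part_T_submodule]] by auto
qed (auto simp: TA.smult_mult_left TA.smult_mult_right part_T_mult)

lemma t_even: "even_linear K V T t"
  using t_linear t_part by (auto simp: even_linear_def)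

lemma T_generated: "graded_generated K V T t"
  unfolding graded_generated_def
proof (intro allI impI ballI, elim conjE)
  fix Q p a assume a: "a \<in> part T p"
    and Q: "\<forall>p. Q p \<zero>\<^bsub>T\<^esub>" "Q 0 \<one>\<^bsub>T\<^esub>" "\<forall>p. \<forall>x\<in>part V p. Q p (t x)"
     "\<forall>p. \<forall>a\<in>part T p. \<forall>b\<in>part T p. Q p a \<longrightarrow> Q p b \<longrightarrow> Q p (a \<oplus>\<^bsub>T\<^esub> b)"
     "\<forall>p. \<forall>c\<in>carrier K. \<forall>a\<in>part T p. Q p a \<longrightarrow> Q p (c \<odot>\<^bsub>T\<^esub> a)"
     "\<forall>p q. \<forall>a\<in>part T p. \<forall>b\<in>part T q. Q p a \<longrightarrow> Q q b \<longrightarrow> Q (p + q) (a \<otimes>\<^bsub>T\<^esub> b)"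
  note l = alg_hom_linear[OF pi_hom]
  have pw: "TQ.\<pi> f \<in> part T p" if "f \<in> homogF p" for f p using that by (auto simp: part_T)
  have w: "Q p (TQ.\<pi> (word K w))" if "homog_word V p w" for p w
    using that
  proof (induction w arbitrary: p)
    case Nil
    then show ?case using Q(2) alg_hom_one[OF pi_hom] by (simp add: FA.F_simps)
  next
    case (Cons x w)
    then obtain q r where qr: "p = q + r" "x \<in> part V q" "homog_word V r w" by auto
    show ?case
      using Q(3,6) t_part[OF qr(2)] pw[OF word_homogF[OF qr(3)]] Cons.IH[OF qr(3)] qr(1,2)
      by (simp add: pi_Cons[OF part_closed[OF qr(2)] homog_word_lists[OF qr(3)]])
  qed
  obtain f where f: "f \<in> homogF p" "a = TQ.\<pi> f" using a by (auto simp: part_T)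
  have "Q p (TQ.\<pi> f)"
    using f(1)
  proof (rule homogF_induct)
    show "Q p (TQ.\<pi> \<zero>\<^bsub>F\<^esub>)" using Q(1) linear_map_zero[OF l FA.F_module TA.module_axioms] by simp
    fix g c w assume a: "g \<in> homogF p" "c \<in> carrier K" "homog_word V p w" "Q p (TQ.\<pi> g)"
    have c: "g \<in> carrier F" "word K w \<in> carrier F"
      using a homog_word_lists by (auto simp: homogF_def)
    have "c \<odot>\<^bsub>T\<^esub> TQ.\<pi> (word K w) \<in> part T p"
      using part_T_closed(4)[OF a(2) pw[OF word_homogF[OF a(3)]]] .
    then show "Q p (TQ.\<pi> (g \<oplus>\<^bsub>F\<^esub> c \<odot>\<^bsub>F\<^esub> word K w))"
      using a c Q(4,5) pw[OF a(1)] pw[OF word_homogF[OF a(3)]] w[OF a(3)]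
      by (simp add: linear_map_add[OF l] linear_map_smult[OF l])
  qed
  then show "Q p a" using f by simp
qed

end

section \<open>Quotients of superalgebras by homogeneous relations\<close>

lemma even_linearI:
  assumes "linear_map K V W f" "\<And>p x. x \<in> part V p \<Longrightarrow> f x \<in> part W p"
  shows "even_linear K V W f"
  using assms by (auto simp: even_linear_def)

lemma
  assumes "even_linear K V W f"
  shows even_linear_linear: "linear_map K V W f"
    and even_linear_part: "x \<in> part V p \<Longrightarrow> f x \<in> part W p"
  using assms by (auto simp: even_linear_def)

lemma even_linear_comp:
  assumes "even_linear K V W f" "even_linear K W X g"
  shows "even_linear K V X (\<lambda>x. g (f x))"
  by (intro even_linearI linear_map_comp[OF assms[THEN even_linear_linear]])
    (rule even_linear_part[OF assms(2) even_linear_part[OF assms(1)]])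

lemma super_homI:
  assumes "alg_hom K A B f" "\<And>p x. x \<in> part A p \<Longrightarrow> f x \<in> part B p"
  shows "super_hom K A B f"
  using assms by (auto simp: super_hom_iff)

lemma
  assumes "super_hom K A B f"
  shows super_hom_alg: "alg_hom K A B f"
    and super_hom_even: "even_linear K A B f"
    and super_hom_part: "x \<in> part A p \<Longrightarrow> f x \<in> part B p"
  using assms by (auto simp: super_hom_iff even_linear_def alg_hom_linear)

lemma alg_hom_even:
  assumes "superalgebra K A" "superalgebra K B" "graded_generated K V A j" "alg_hom K A B f"
    "\<And>p x. x \<in> part V p \<Longrightarrow> f (j x) \<in> part B p"
  shows "super_hom K A B f"
proof -
  interpret A: superalgebra K A by fact
  interpret B: superalgebra K B by fact
  note l = alg_hom_linear[OF assms(4)]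
  show ?thesis
  proof (rule super_homI[OF assms(4)])
    fix p a assume "a \<in> part A p"
    from assms(3) this show "f a \<in> part B p"
    proof (induction rule: graded_generatedD)
      case (add p a b)
      then show ?case by (simp add: linear_map_add[OF l] A.part_closed B.part_add)
    next
      case (mult p q a b)
      then show ?case by (simp add: alg_hom_mult[OF assms(4)] A.part_closed B.part_mult)
    next
      case (smult p c a)
      then show ?case by (simp add: linear_map_smult[OF l] A.part_closed B.part_smult)
    qed (use linear_map_zero[OF l A.module B.module] alg_hom_one[OF assms(4)] B.one_even assms(5) in auto)
  qed
qed

locale super_quot = superalgebra K A
  for K :: "('k, 'm) ring_scheme" and A :: "('k, 'a, 'n) super_scheme" +
  fixes Rel :: "'a set"
  assumes Rel_homog: "Rel \<subseteq> (\<Union>p. part A p)"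
begin

sublocale AQ: alg_quot K A "part A" Rel
  using Rel_homog assoc_algebra by (intro alg_quot.intro alg_quot_axioms.intro) (auto simp: part_closed)

text \<open>
  The sums of an even and an odd element of \<open>I\<close> form an ideal. It contains the homogeneous relations, hence all
  of \<open>I\<close>.
\<close>

lemma ideal_graded:
  assumes "i \<in> AQ.I"
  shows "\<exists>a\<in>part A 0 \<inter> AQ.I. \<exists>b\<in>part A 1 \<inter> AQ.I. i = a \<oplus>\<^bsub>A\<^esub> b"
proof -
  let ?J = "{i. \<exists>a\<in>part A 0 \<inter> AQ.I. \<exists>b\<in>part A 1 \<inter> AQ.I. i = a \<oplus>\<^bsub>A\<^esub> b}"
  note zI = AQ.id.zero_closed
  have J: "i \<in> ?J" if "a \<in> part A 0" "a \<in> AQ.I" "b \<in> part A 1" "b \<in> AQ.I" "i = a \<oplus>\<^bsub>A\<^esub> b" for i a b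
    using that by blast
  have Jmem: "i \<in> ?J" if i: "i \<in> part A p" "i \<in> AQ.I" for i p
  proof (cases p)
    case zero
    then show ?thesis using J[of i "\<zero>\<^bsub>A\<^esub>" i] i zI by (simp add: part_closed)
  next
    case one
    then show ?thesis using J[of "\<zero>\<^bsub>A\<^esub>" i i] i zI by (simp add: part_closed)
  qed
  have Jadd: "i \<oplus>\<^bsub>A\<^esub> j \<in> ?J" if i: "i \<in> ?J" and j: "j \<in> ?J" for i j
  proof -
    from i obtain a b where i: "a \<in> part A 0" "a \<in> AQ.I" "b \<in> part A 1" "b \<in> AQ.I" "i = a \<oplus>\<^bsub>A\<^esub> b" by blast
    from j obtain c d where j: "c \<in> part A 0" "c \<in> AQ.I" "d \<in> part A 1" "d \<in> AQ.I" "j = c \<oplus>\<^bsub>A\<^esub> d" by blast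
    have "i \<oplus>\<^bsub>A\<^esub> j = (a \<oplus>\<^bsub>A\<^esub> c) \<oplus>\<^bsub>A\<^esub> (b \<oplus>\<^bsub>A\<^esub> d)"
      using i j by (simp add: part_closed M.a_ac)
    then show ?thesis using i j by (intro J[of "a \<oplus>\<^bsub>A\<^esub> c" "b \<oplus>\<^bsub>A\<^esub> d"] part_add AQ.id.a_closed) auto
  qed
  have Jneg: "\<ominus>\<^bsub>A\<^esub> i \<in> ?J" if i: "i \<in> ?J" for i
  proof -
    from i obtain a b where i: "a \<in> part A 0" "a \<in> AQ.I" "b \<in> part A 1" "b \<in> AQ.I" "i = a \<oplus>\<^bsub>A\<^esub> b" by blast
    have "\<ominus>\<^bsub>A\<^esub> i = \<ominus>\<^bsub>A\<^esub> a \<oplus>\<^bsub>A\<^esub> \<ominus>\<^bsub>A\<^esub> b"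
      using i by (simp add: part_closed M.minus_add M.a_comm)
    then show ?thesis using i by (intro J[of "\<ominus>\<^bsub>A\<^esub> a" "\<ominus>\<^bsub>A\<^esub> b"] part_neg AQ.id.a_inv_closed) auto
  qed
  have Jmult: "i \<otimes>\<^bsub>A\<^esub> x \<in> ?J \<and> x \<otimes>\<^bsub>A\<^esub> i \<in> ?J" if i: "i \<in> ?J" and x: "x \<in> carrier A" for i x
  proof -
    from i obtain a b where i: "a \<in> part A 0" "a \<in> AQ.I" "b \<in> part A 1" "b \<in> AQ.I" "i = a \<oplus>\<^bsub>A\<^esub> b" by blast
    from x obtain c d where x: "c \<in> part A 0" "d \<in> part A 1" "x = c \<oplus>\<^bsub>A\<^esub> d"
      by (rule carrier_part_cases)
    note c = i(1,3)[THEN part_closed] x(1,2)[THEN part_closed]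
    have h: "y \<otimes>\<^bsub>A\<^esub> z \<in> ?J" if "y \<in> part A p" "z \<in> part A q" "y \<in> AQ.I \<or> z \<in> AQ.I" for y z p q
      using that by (intro Jmem[OF part_mult]) (auto simp: part_closed AQ.id.I_l_closed AQ.id.I_r_closed)
    have e: "i \<otimes>\<^bsub>A\<^esub> x = (a \<otimes>\<^bsub>A\<^esub> c \<oplus>\<^bsub>A\<^esub> a \<otimes>\<^bsub>A\<^esub> d) \<oplus>\<^bsub>A\<^esub> (b \<otimes>\<^bsub>A\<^esub> c \<oplus>\<^bsub>A\<^esub> b \<otimes>\<^bsub>A\<^esub> d)"
        "x \<otimes>\<^bsub>A\<^esub> i = (c \<otimes>\<^bsub>A\<^esub> a \<oplus>\<^bsub>A\<^esub> c \<otimes>\<^bsub>A\<^esub> b) \<oplus>\<^bsub>A\<^esub> (d \<otimes>\<^bsub>A\<^esub> a \<oplus>\<^bsub>A\<^esub> d \<otimes>\<^bsub>A\<^esub> b)"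
      using c by (simp_all add: i(5) x(3) l_distr r_distr M.a_ac)
    show ?thesis
      unfolding e using h[OF i(1) x(1)] h[OF i(1) x(2)] h[OF i(3) x(1)] h[OF i(3) x(2)]
        h[OF x(1) i(1)] h[OF x(2) i(1)] h[OF x(1) i(3)] h[OF x(2) i(3)] i by (intro conjI Jadd) auto
  qed
  have Jc: "i \<in> carrier A" if "i \<in> ?J" for i
    using that by (auto simp: part_closed)
  have "ideal ?J A"
  proof (rule idealI)
    show "subgroup ?J (add_monoid A)"
    proof (rule group.subgroupI[OF M.a_group])
      show "?J \<subseteq> carrier (add_monoid A)" using Jc by auto
      show "?J \<noteq> {}" using Jmem[OF part_zero zI] by blast
      show "inv\<^bsub>add_monoid A\<^esub> i \<in> ?J" if "i \<in> ?J" for i using Jneg[OF that] by (simp add: a_inv_def)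
      show "i \<otimes>\<^bsub>add_monoid A\<^esub> j \<in> ?J" if "i \<in> ?J" "j \<in> ?J" for i j using Jadd[OF that] by simp
    qed
  qed (use Jmult ring_axioms in auto)
  moreover have "Rel \<subseteq> ?J"
  proof
    fix r assume r: "r \<in> Rel"
    then obtain p where "r \<in> part A p" using Rel_homog by blast
    moreover have "r \<in> AQ.I" using r genideal_self[OF AQ.Rel] by (auto simp: AQ.I_def)
    ultimately show "r \<in> ?J" by (rule Jmem)
  qed
  ultimately have "AQ.I \<subseteq> ?J" unfolding AQ.I_def by (rule genideal_minimal)
  with assms show ?thesis by blast
qed

text \<open>The two components of the quotient meet trivially because the ideal is graded.\<close>

lemma Q_superalgebra: "superalgebra K AQ.Q"
proof -
  interpret Q: assoc_algebra K AQ.Q by (rule AQ.Q_assoc_algebra)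
  note pl = alg_hom_linear[OF AQ.\<pi>_hom]
  note pm = linear_map_neg[OF pl module Q.module_axioms, symmetric]
    linear_map_zero[OF pl module Q.module_axioms]
  have part: "part AQ.Q p = AQ.\<pi> ` part A p" for p by (rule AQ.Q_simps)
  have pz: "\<zero>\<^bsub>AQ.Q\<^esub> \<in> AQ.\<pi> ` part A p" for p using part_zero[of p] pm(2) by (metis imageI)
  have sub: "submodule (part AQ.Q p) K AQ.Q" for p
    by (rule Q.submoduleI)
      (auto simp: part pz AQ.Q_simps(1) AQ.Q_add AQ.Q_smult pm(1) part_closed part_add part_smult part_neg)
  have inter: "x = \<zero>\<^bsub>AQ.Q\<^esub>" if x: "x \<in> part AQ.Q 0" "x \<in> part AQ.Q 1" for x
  proof -
    obtain a b where ab: "a \<in> part A 0" "b \<in> part A 1" "x = AQ.\<pi> a" "x = AQ.\<pi> b"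
      using x unfolding part by blast
    note c = ab(1,2)[THEN part_closed]
    have "a \<ominus>\<^bsub>A\<^esub> b \<in> AQ.I" using ab c by (simp flip: AQ.\<pi>_eq_iff)
    then obtain i j where ij: "i \<in> part A 0" "i \<in> AQ.I" "j \<in> part A 1" "a \<ominus>\<^bsub>A\<^esub> b = i \<oplus>\<^bsub>A\<^esub> j"
      using ideal_graded by blast
    have "a = i"
      by (rule decomp_unique[of a 0 "\<ominus>\<^bsub>A\<^esub> b" i j]) (use ab ij in \<open>auto simp: a_minus_def\<close>)
    then have "AQ.\<pi> a = AQ.\<pi> \<zero>\<^bsub>A\<^esub>"
      using ij c by (subst AQ.\<pi>_eq_iff) (auto simp: a_minus_def)
    then show ?thesis using ab pm(2) by simp
  qed
  show ?thesis
  proof (intro superalgebra.intro superalgebra_axioms.intro super_space.intro super_space_axioms.intro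
      field_axioms Q.module_axioms Q.ring_axioms sub)
    show "part AQ.Q 0 <+>\<^bsub>AQ.Q\<^esub> part AQ.Q 1 = carrier AQ.Q"
    proof (intro equalityI subsetI)
      fix x assume "x \<in> carrier AQ.Q"
      then obtain a where a: "a \<in> carrier A" "x = AQ.\<pi> a" by (auto simp: AQ.Q_simps)
      from a(1) obtain b c where "b \<in> part A 0" "c \<in> part A 1" "a = b \<oplus>\<^bsub>A\<^esub> c"
        by (rule carrier_part_cases)
      then show "x \<in> part AQ.Q 0 <+>\<^bsub>AQ.Q\<^esub> part AQ.Q 1"
        using a by (auto simp: set_add_def set_mult_def part AQ.Q_add part_closed simp flip: AQ.Q_add)
    qed (auto simp: set_add_def set_mult_def part AQ.Q_add part_closed AQ.Q_simps(1))
    show "part AQ.Q 0 \<inter> part AQ.Q 1 = {\<zero>\<^bsub>AQ.Q\<^esub>}"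
      using inter pz by (auto simp: part)
    show "\<one>\<^bsub>AQ.Q\<^esub> \<in> part AQ.Q 0" by (simp add: part AQ.Q_simps(3) one_even)
  qed (auto simp: Q.smult_mult_left Q.smult_mult_right part AQ.Q_mult part_closed part_mult)
qed

lemma pi_super_hom: "super_hom K A AQ.Q AQ.\<pi>"
  by (rule super_homI[OF AQ.\<pi>_hom]) (simp add: AQ.Q_simps(4))

lemma Q_generated:
  assumes g: "graded_generated K V A j"
  shows "graded_generated K V AQ.Q (\<lambda>x. AQ.\<pi> (j x))"
  unfolding graded_generated_def
proof (intro allI impI ballI, elim conjE)
  fix Q p x assume x: "x \<in> part AQ.Q p"
    and Q: "\<forall>p. Q p \<zero>\<^bsub>AQ.Q\<^esub>" "Q 0 \<one>\<^bsub>AQ.Q\<^esub>" "\<forall>p. \<forall>x\<in>part V p. Q p (AQ.\<pi> (j x))"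
     "\<forall>p. \<forall>a\<in>part AQ.Q p. \<forall>b\<in>part AQ.Q p. Q p a \<longrightarrow> Q p b \<longrightarrow> Q p (a \<oplus>\<^bsub>AQ.Q\<^esub> b)"
     "\<forall>p. \<forall>c\<in>carrier K. \<forall>a\<in>part AQ.Q p. Q p a \<longrightarrow> Q p (c \<odot>\<^bsub>AQ.Q\<^esub> a)"
     "\<forall>p q. \<forall>a\<in>part AQ.Q p. \<forall>b\<in>part AQ.Q q. Q p a \<longrightarrow> Q q b \<longrightarrow> Q (p + q) (a \<otimes>\<^bsub>AQ.Q\<^esub> b)"
  obtain a where a: "a \<in> part A p" "x = AQ.\<pi> a" using x by (auto simp: AQ.Q_simps)
  from g a(1) have "Q p (AQ.\<pi> a)"
  proof (induction rule: graded_generatedD)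
    case (add p a b)
    then show ?case using Q(4) by (auto simp: AQ.Q_simps(4) part_closed simp flip: AQ.Q_add)
  next
    case (mult p q a b)
    then show ?case using Q(6) by (auto simp: AQ.Q_simps(4) part_closed simp flip: AQ.Q_mult)
  next
    case (smult p c a)
    then show ?case using Q(5) by (auto simp: AQ.Q_simps(4) part_closed simp flip: AQ.Q_smult)
  qed (use Q(1-3) AQ.Q_zero AQ.Q_simps(3) in auto)
  then show "Q p x" using a by simp
qed

lemma Q_factor:
  assumes "superalgebra K B" "super_hom K A B f" "\<And>r. r \<in> Rel \<Longrightarrow> f r = \<zero>\<^bsub>B\<^esub>"
  shows "\<exists>g. super_hom K AQ.Q B g \<and> (\<forall>x\<in>carrier A. g (AQ.\<pi> x) = f x)"
proof -
  interpret B: superalgebra K B by fact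
  obtain g where g: "alg_hom K AQ.Q B g" "\<forall>x\<in>carrier A. g (AQ.\<pi> x) = f x"
    using AQ.factor[OF B.assoc_algebra super_hom_alg[OF assms(2)] assms(3)] by blast
  have "super_hom K AQ.Q B g"
    by (rule super_homI[OF g(1)]) (use g(2) super_hom_part[OF assms(2)] in \<open>auto simp: AQ.Q_simps(4) part_closed\<close>)
  with g(2) show ?thesis by blast
qed

end

section \<open>The supersymmetric algebra\<close>

context tensor
begin

lemma T_universal:
  assumes "superalgebra K B" "even_linear K V B \<phi>"
  shows "\<exists>f. super_hom K T B f \<and> (\<forall>x\<in>carrier V. f (t x) = \<phi> x)"
proof -
  interpret B: superalgebra K B by fact
  obtain f where f: "alg_hom K T B f" "\<forall>x\<in>carrier V. f (t x) = \<phi> x"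
    using T_universal_algebra[OF B.assoc_algebra even_linear_linear[OF assms(2)]] by blast
  have "super_hom K T B f"
    by (rule alg_hom_even[OF T_superalgebra assms(1) T_generated f(1)])
      (use f(2) even_linear_part[OF assms(2)] part_closed in auto)
  with f(2) show ?thesis by blast
qed

definition "symRel = {t x \<otimes>\<^bsub>T\<^esub> t y \<ominus>\<^bsub>T\<^esub> sgnmul T (p * q) (t y \<otimes>\<^bsub>T\<^esub> t x) | p q x y.
       x \<in> part V p \<and> y \<in> part V q}"

sublocale TS: superalgebra K T by (rule T_superalgebra)

lemma t_closed: "x \<in> part V p \<Longrightarrow> t x \<in> carrier T"
  by (rule part_T_carrier[OF t_part])

sublocale SQ: super_quot K T symRel
proof
  show "symRel \<subseteq> (\<Union>p. part T p)"
  proof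
    fix r assume "r \<in> symRel"
    then obtain p q x y where xy: "x \<in> part V p" "y \<in> part V q"
      and r: "r = t x \<otimes>\<^bsub>T\<^esub> t y \<ominus>\<^bsub>T\<^esub> sgnmul T (p * q) (t y \<otimes>\<^bsub>T\<^esub> t x)"
      by (auto simp: symRel_def)
    have "t y \<otimes>\<^bsub>T\<^esub> t x \<in> part T (p + q)"
      using part_T_mult[OF t_part[OF xy(2)] t_part[OF xy(1)]] by (simp add: add.commute)
    then have "r \<in> part T (p + q)"
      unfolding r using part_T_mult[OF t_part[OF xy(1)] t_part[OF xy(2)]]
      by (intro TS.part_minus TS.part_sgnmul)
    then show "r \<in> (\<Union>p. part T p)" by blast
  qed
qed

abbreviation "S \<equiv> sym_algebra K V"
abbreviation "s \<equiv> sym_incl K V"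

lemma sym_ideal_eq: "sym_ideal K V = SQ.AQ.I"
  unfolding SQ.AQ.I_def by (simp add: sym_ideal_def symRel_def Let_def)

lemma S_eq: "S = SQ.AQ.Q"
  unfolding SQ.AQ.Q_def sym_ideal_eq[symmetric] by (simp add: sym_algebra_def)

lemma s_eq: "s x = SQ.AQ.\<pi> (t x)"
  unfolding SQ.AQ.\<pi>_def sym_ideal_eq[symmetric] by (simp add: sym_incl_def)

lemma S_superalgebra: "superalgebra K S"
  unfolding S_eq by (rule SQ.Q_superalgebra)

lemma S_generated: "graded_generated K V S s"
  unfolding S_eq s_eq[abs_def] by (rule SQ.Q_generated[OF T_generated])

lemma s_even: "even_linear K V S s"
  unfolding S_eq s_eq[abs_def] by (rule even_linear_comp[OF t_even super_hom_even[OF SQ.pi_super_hom]])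

lemma s_comm:
  assumes x: "x \<in> part V p" and y: "y \<in> part V q"
  shows "s x \<otimes>\<^bsub>S\<^esub> s y = sgnmul S (p * q) (s y \<otimes>\<^bsub>S\<^esub> s x)"
proof -
  interpret S: superalgebra K S by (rule S_superalgebra)
  have h: "alg_hom K T S SQ.AQ.\<pi>" unfolding S_eq by (rule SQ.AQ.\<pi>_hom)
  note l = alg_hom_linear[OF h]
  have "SQ.AQ.\<pi> (t x \<otimes>\<^bsub>T\<^esub> t y \<ominus>\<^bsub>T\<^esub> sgnmul T (p * q) (t y \<otimes>\<^bsub>T\<^esub> t x)) = \<zero>\<^bsub>S\<^esub>"
    unfolding S_eq using x y by (intro SQ.AQ.\<pi>_Rel) (auto simp: symRel_def)
  then show ?thesis
    using t_closed[OF x] t_closed[OF y] alg_hom_closed[OF h]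
    by (simp add: linear_map_minus[OF l TA.module_axioms S.module] linear_map_sgn[OF l TA.module_axioms S.module]
        alg_hom_mult[OF h] s_eq S.M.minus_zero_iff)
qed

lemma S_universal:
  assumes B: "superalgebra K B" and \<phi>: "even_linear K V B \<phi>"
    and c: "\<And>p q x y. x \<in> part V p \<Longrightarrow> y \<in> part V q \<Longrightarrow>
      \<phi> x \<otimes>\<^bsub>B\<^esub> \<phi> y = sgnmul B (p * q) (\<phi> y \<otimes>\<^bsub>B\<^esub> \<phi> x)"
  shows "\<exists>f. super_hom K S B f \<and> (\<forall>x\<in>carrier V. f (s x) = \<phi> x)"
proof -
  interpret B: superalgebra K B by fact
  obtain f where f: "super_hom K T B f" "\<forall>x\<in>carrier V. f (t x) = \<phi> x"
    using T_universal[OF B \<phi>] by blast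
  note h = super_hom_alg[OF f(1)]
  note l = alg_hom_linear[OF h]
  have "f r = \<zero>\<^bsub>B\<^esub>" if r: "r \<in> symRel" for r
  proof -
    obtain p q x y where xy: "x \<in> part V p" "y \<in> part V q"
      and r: "r = t x \<otimes>\<^bsub>T\<^esub> t y \<ominus>\<^bsub>T\<^esub> sgnmul T (p * q) (t y \<otimes>\<^bsub>T\<^esub> t x)"
      using r by (auto simp: symRel_def)
    have "\<phi> x \<in> carrier B" "\<phi> y \<in> carrier B"
      using linear_map_closed[OF even_linear_linear[OF \<phi>]] xy part_closed by auto
    then show ?thesis
      unfolding r using xy[THEN t_closed] f(2) xy[THEN part_closed] c[OF xy]
      by (simp add: linear_map_minus[OF l TA.module_axioms B.module] linear_map_sgn[OF l TA.module_axioms B.module]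
        alg_hom_mult[OF h] B.M.minus_zero_iff)
  qed
  from SQ.Q_factor[OF B f(1) this] f(2) show ?thesis
    unfolding S_eq s_eq using linear_map_closed[OF t_linear] by auto
qed

end

text \<open>
  For fixed \<open>b\<close>, the homogeneous elements that supercommute with \<open>b\<close> are closed under the algebra operations. This is
  applied twice: to extend from generators in the first factor, and then in the second.
\<close>

lemma supercommutative_generated:
  assumes "superalgebra K A" "graded_generated K V A j"
    and c: "\<And>p q x y. x \<in> part V p \<Longrightarrow> y \<in> part V q \<Longrightarrow>
      j x \<otimes>\<^bsub>A\<^esub> j y = sgnmul A (p * q) (j y \<otimes>\<^bsub>A\<^esub> j x)"
    and j: "\<And>p x. x \<in> part V p \<Longrightarrow> j x \<in> part A p"
  shows "supercommutative_superalgebra K A"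
proof -
  interpret A: superalgebra K A by fact
  note sgl = bilinear2_sgn_left[OF assoc_algebra.mult_bilinear[OF A.assoc_algebra] A.module A.module A.module]
  note sgr = bilinear2_sgn_right[OF assoc_algebra.mult_bilinear[OF A.assoc_algebra] A.module A.module A.module]
  let ?C = "\<lambda>b q p a. a \<otimes>\<^bsub>A\<^esub> b = sgnmul A (p * q) (b \<otimes>\<^bsub>A\<^esub> a)"
  have step: "?C b q p a"
    if a: "a \<in> part A p" and b: "b \<in> part A q" and gen: "\<And>r x. x \<in> part V r \<Longrightarrow> ?C b q r (j x)" for a b p q
    using assms(2) a
  proof (induction rule: graded_generatedD)
    case (add p a a')
    then show ?case using b by (simp add: A.part_closed A.l_distr A.r_distr A.sgnmul_add)
  next
    case (smult p c a)
    then show ?case using b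
      by (simp add: A.part_closed A.smult_mult_left A.smult_mult_right A.sgnmul_smult)
  next
    case (mult p r a a')
    note cl = mult(1,2)[THEN A.part_closed] A.part_closed[OF b]
    have "(a \<otimes>\<^bsub>A\<^esub> a') \<otimes>\<^bsub>A\<^esub> b = a \<otimes>\<^bsub>A\<^esub> sgnmul A (r * q) (b \<otimes>\<^bsub>A\<^esub> a')"
      using cl mult by (simp add: A.m_assoc)
    also have "\<dots> = sgnmul A (r * q) ((a \<otimes>\<^bsub>A\<^esub> b) \<otimes>\<^bsub>A\<^esub> a')"
      using cl by (simp add: sgr A.m_assoc)
    also have "\<dots> = sgnmul A (r * q) (sgnmul A (p * q) (b \<otimes>\<^bsub>A\<^esub> (a \<otimes>\<^bsub>A\<^esub> a')))"
      using cl mult by (simp add: sgl A.m_assoc)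
    finally show ?case using cl by (simp add: distrib_right add.commute)
  qed (use A.part_closed[OF b] gen in auto)
  have flip: "?C a p q b" if "?C b q p a" "a \<in> part A p" "b \<in> part A q" for a b p q
    using that by (simp add: A.part_closed mult.commute)
  have gen: "?C (j y) q p a" if "a \<in> part A p" "y \<in> part V q" for a p y q
    by (rule step[OF that(1) j[OF that(2)] c[OF _ that(2)]])
  have "?C b q p a" if "a \<in> part A p" "b \<in> part A q" for a b p q
    by (rule step[OF that flip[OF gen[OF that(2)]]]) (use that j in auto)
  then show ?thesis by unfold_locales
qed

context tensor
begin

lemma S_supercommutative: "supercommutative_superalgebra K S"
  using s_comm even_linear_part[OF s_even]
  by (rule supercommutative_generated[OF S_superalgebra S_generated])

end

section \<open>The Sridharan superalgebra\<close>

text \<open>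
  The assumptions on the bracket and on \<open>\<sigma>\<close> make the defining relations of the Sridharan superalgebra homogeneous,
  so that it inherits a grading from the tensor algebra.
\<close>

locale sridharan_setting = tensor K V
  for K :: "('k, 'm) ring_scheme" and V :: "('k, 'a, 'n) bsuper_scheme" +
  fixes \<sigma> :: "'a \<Rightarrow> 'a \<Rightarrow> 'k"
  assumes br_part: "\<lbrakk>x \<in> part V p; y \<in> part V q\<rbrakk> \<Longrightarrow> \<lbrace>x, y\<rbrace>\<^bsub>V\<^esub> \<in> part V (p + q)"
    and \<sigma>_closed: "\<lbrakk>x \<in> part V p; y \<in> part V q\<rbrakk> \<Longrightarrow> \<sigma> x y \<in> carrier K"
    and \<sigma>_even: "\<lbrakk>x \<in> part V p; y \<in> part V q; p + q = 1\<rbrakk> \<Longrightarrow> \<sigma> x y = \<zero>\<^bsub>K\<^esub>"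
begin

abbreviation "rel p q x y \<equiv> t x \<otimes>\<^bsub>T\<^esub> t y \<ominus>\<^bsub>T\<^esub> sgnmul T (p * q) (t y \<otimes>\<^bsub>T\<^esub> t x) \<ominus>\<^bsub>T\<^esub> t \<lbrace>x, y\<rbrace>\<^bsub>V\<^esub> \<ominus>\<^bsub>T\<^esub> \<sigma> x y \<odot>\<^bsub>T\<^esub> \<one>\<^bsub>T\<^esub>"

definition "uRel = {rel p q x y | p q x y. x \<in> part V p \<and> y \<in> part V q}"

lemma \<sigma>_one_part:
  assumes "superalgebra K B" "x \<in> part V p" "y \<in> part V q"
  shows "\<sigma> x y \<odot>\<^bsub>B\<^esub> \<one>\<^bsub>B\<^esub> \<in> part B (p + q)"
proof -
  interpret B: superalgebra K B by fact
  show ?thesis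
    using bit_exhaust[of "p + q"] \<sigma>_even[OF assms(2,3)] \<sigma>_closed[OF assms(2,3)] B.one_even
    by (auto simp: B.part_smult)
qed

lemma rel_part:
  assumes x: "x \<in> part V p" and y: "y \<in> part V q"
  shows "rel p q x y \<in> part T (p + q)"
proof -
  have "t y \<otimes>\<^bsub>T\<^esub> t x \<in> part T (p + q)"
    using part_T_mult[OF t_part[OF y] t_part[OF x]] by (simp add: add.commute)
  then show ?thesis
    using part_T_mult[OF t_part[OF x] t_part[OF y]] t_part[OF br_part[OF x y]]
      \<sigma>_one_part[OF T_superalgebra x y]
    by (intro TS.part_minus TS.part_sgnmul)
qed

sublocale UQ: super_quot K T uRel
  by unfold_locales (auto simp: uRel_def intro: rel_part)

abbreviation "U \<equiv> sridharan K V \<sigma>"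
abbreviation "u \<equiv> sridharan_incl K V \<sigma>"

lemma u_ideal_eq: "sridharan_ideal K V \<sigma> = UQ.AQ.I"
  unfolding UQ.AQ.I_def by (simp add: sridharan_ideal_def uRel_def Let_def)

lemma U_eq: "U = UQ.AQ.Q"
  unfolding UQ.AQ.Q_def u_ideal_eq[symmetric] by (simp add: sridharan_def)

lemma u_eq: "u x = UQ.AQ.\<pi> (t x)"
  unfolding UQ.AQ.\<pi>_def u_ideal_eq[symmetric] by (simp add: sridharan_incl_def)

lemma U_superalgebra: "superalgebra K U"
  unfolding U_eq by (rule UQ.Q_superalgebra)

lemma U_generated: "graded_generated K V U u"
  unfolding U_eq u_eq[abs_def] by (rule UQ.Q_generated[OF T_generated])

lemma u_even: "even_linear K V U u"
  unfolding U_eq u_eq[abs_def] by (rule even_linear_comp[OF t_even super_hom_even[OF UQ.pi_super_hom]])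

lemma rel_image:
  assumes B: "superalgebra K B" and h: "alg_hom K T B f" and x: "x \<in> part V p" and y: "y \<in> part V q"
  shows "f (rel p q x y) = \<zero>\<^bsub>B\<^esub> \<longleftrightarrow>
    f (t x) \<otimes>\<^bsub>B\<^esub> f (t y) \<ominus>\<^bsub>B\<^esub> sgnmul B (p * q) (f (t y) \<otimes>\<^bsub>B\<^esub> f (t x)) =
      f (t \<lbrace>x, y\<rbrace>\<^bsub>V\<^esub>) \<oplus>\<^bsub>B\<^esub> \<sigma> x y \<odot>\<^bsub>B\<^esub> \<one>\<^bsub>B\<^esub>"
proof -
  interpret B: superalgebra K B by fact
  note l = alg_hom_linear[OF h]
  note c = t_closed[OF x] t_closed[OF y] t_closed[OF br_part[OF x y]] \<sigma>_closed[OF x y]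
  note fc = c(1-3)[THEN alg_hom_closed[OF h]]
  have a: "a \<ominus>\<^bsub>B\<^esub> b \<ominus>\<^bsub>B\<^esub> d \<ominus>\<^bsub>B\<^esub> e = \<zero>\<^bsub>B\<^esub> \<longleftrightarrow> a \<ominus>\<^bsub>B\<^esub> b = d \<oplus>\<^bsub>B\<^esub> e"
    if "a \<in> carrier B" "b \<in> carrier B" "d \<in> carrier B" "e \<in> carrier B" for a b d e
  proof -
    have "a \<ominus>\<^bsub>B\<^esub> b \<ominus>\<^bsub>B\<^esub> d \<ominus>\<^bsub>B\<^esub> e = (a \<ominus>\<^bsub>B\<^esub> b) \<ominus>\<^bsub>B\<^esub> (d \<oplus>\<^bsub>B\<^esub> e)"
      using that by (simp add: B.M.cancel)
    then show ?thesis using that B.M.minus_zero_iff[of "a \<ominus>\<^bsub>B\<^esub> b" "d \<oplus>\<^bsub>B\<^esub> e"] by simp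
  qed
  show ?thesis
    using c fc
    by (subst a[symmetric])
      (simp_all add: linear_map_minus[OF l TA.module_axioms B.module] linear_map_sgn[OF l TA.module_axioms B.module]
        linear_map_smult[OF l] alg_hom_mult[OF h] alg_hom_one[OF h])
qed

lemma u_rel:
  assumes x: "x \<in> part V p" and y: "y \<in> part V q"
  shows "u x \<otimes>\<^bsub>U\<^esub> u y \<ominus>\<^bsub>U\<^esub> sgnmul U (p * q) (u y \<otimes>\<^bsub>U\<^esub> u x) = u \<lbrace>x, y\<rbrace>\<^bsub>V\<^esub> \<oplus>\<^bsub>U\<^esub> \<sigma> x y \<odot>\<^bsub>U\<^esub> \<one>\<^bsub>U\<^esub>"
proof -
  have h: "alg_hom K T U UQ.AQ.\<pi>" unfolding U_eq by (rule UQ.AQ.\<pi>_hom)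
  have "UQ.AQ.\<pi> (rel p q x y) = \<zero>\<^bsub>U\<^esub>"
    unfolding U_eq using x y by (intro UQ.AQ.\<pi>_Rel) (auto simp: uRel_def)
  then show ?thesis
    unfolding rel_image[OF U_superalgebra h x y] by (simp add: u_eq)
qed

lemma U_universal:
  assumes B: "superalgebra K B" and \<phi>: "even_linear K V B \<phi>"
    and c: "\<And>p q x y. x \<in> part V p \<Longrightarrow> y \<in> part V q \<Longrightarrow>
      \<phi> x \<otimes>\<^bsub>B\<^esub> \<phi> y \<ominus>\<^bsub>B\<^esub> sgnmul B (p * q) (\<phi> y \<otimes>\<^bsub>B\<^esub> \<phi> x) = \<phi> \<lbrace>x, y\<rbrace>\<^bsub>V\<^esub> \<oplus>\<^bsub>B\<^esub> \<sigma> x y \<odot>\<^bsub>B\<^esub> \<one>\<^bsub>B\<^esub>"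
  shows "\<exists>f. super_hom K U B f \<and> (\<forall>x\<in>carrier V. f (u x) = \<phi> x)"
proof -
  obtain f where f: "super_hom K T B f" "\<forall>x\<in>carrier V. f (t x) = \<phi> x"
    using T_universal[OF B \<phi>] by blast
  have "f r = \<zero>\<^bsub>B\<^esub>" if r: "r \<in> uRel" for r
  proof -
    obtain p q x y where xy: "x \<in> part V p" "y \<in> part V q" and r: "r = rel p q x y"
      using r by (auto simp: uRel_def)
    show ?thesis
      unfolding r rel_image[OF B super_hom_alg[OF f(1)] xy]
      using c[OF xy] f(2) xy[THEN part_closed] part_closed[OF br_part[OF xy]] by simp
  qed
  from UQ.Q_factor[OF B f(1) this] f(2) show ?thesis
    unfolding U_eq u_eq using linear_map_closed[OF t_linear] by auto
qed

end

section \<open>Direct sums and spaces of linear maps\<close>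

lemma super_space_prod:
  assumes "super_space K V" "super_space K W"
    and P: "carrier P = carrier V \<times> carrier W" "zero P = (\<zero>\<^bsub>V\<^esub>, \<zero>\<^bsub>W\<^esub>)"
    "\<And>a b c d. (a, b) \<oplus>\<^bsub>P\<^esub> (c, d) = (a \<oplus>\<^bsub>V\<^esub> c, b \<oplus>\<^bsub>W\<^esub> d)"
    "\<And>k a b. k \<odot>\<^bsub>P\<^esub> (a, b) = (k \<odot>\<^bsub>V\<^esub> a, k \<odot>\<^bsub>W\<^esub> b)"
    "\<And>p. part P p = part V p \<times> part W p"
  shows "super_space K P"
proof -
  interpret V: super_space K V by fact
  interpret W: super_space K W by fact
  have "abelian_group P"
  proof (rule abelian_groupI)
    fix x assume "x \<in> carrier P"
    then obtain a b where "a \<in> carrier V" "b \<in> carrier W" "x = (a, b)" by (auto simp: P)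
    then show "\<exists>y\<in>carrier P. y \<oplus>\<^bsub>P\<^esub> x = \<zero>\<^bsub>P\<^esub>"
      by (intro bexI[of _ "(\<ominus>\<^bsub>V\<^esub> a, \<ominus>\<^bsub>W\<^esub> b)"]) (auto simp: P V.M.l_neg W.M.l_neg)
  qed (auto simp: P V.M.a_ac W.M.a_ac)
  then interpret P: module K P
    by (intro moduleI V.is_cring)
      (auto simp: P V.smult_l_distr W.smult_l_distr V.smult_r_distr W.smult_r_distr
        V.smult_assoc1 W.smult_assoc1)
  have neg: "\<ominus>\<^bsub>P\<^esub> (a, b) = (\<ominus>\<^bsub>V\<^esub> a, \<ominus>\<^bsub>W\<^esub> b)" if "a \<in> carrier V" "b \<in> carrier W" for a b
    by (rule P.M.minus_equality) (use that in \<open>auto simp: P V.M.l_neg W.M.l_neg\<close>)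
  show ?thesis
  proof (intro super_space.intro super_space_axioms.intro V.field_axioms P.module_axioms P.submoduleI)
    show "part P 0 <+>\<^bsub>P\<^esub> part P 1 = carrier P"
    proof (intro equalityI subsetI)
      fix x assume "x \<in> carrier P"
      then obtain a b where ab: "a \<in> carrier V" "b \<in> carrier W" "x = (a, b)" by (auto simp: P)
      obtain a0 a1 where a: "a0 \<in> part V 0" "a1 \<in> part V 1" "a = a0 \<oplus>\<^bsub>V\<^esub> a1"
        using ab(1) by (rule V.carrier_part_cases)
      obtain b0 b1 where b: "b0 \<in> part W 0" "b1 \<in> part W 1" "b = b0 \<oplus>\<^bsub>W\<^esub> b1"
        using ab(2) by (rule W.carrier_part_cases)
      have "(a0, b0) \<in> part P 0" "(a1, b1) \<in> part P 1" "x = (a0, b0) \<oplus>\<^bsub>P\<^esub> (a1, b1)"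
        using a b ab by (auto simp: P)
      then show "x \<in> part P 0 <+>\<^bsub>P\<^esub> part P 1" unfolding set_add_def set_mult_def by auto
    qed (auto simp: set_add_def set_mult_def P V.part_closed W.part_closed)
    show "part P 0 \<inter> part P 1 = {\<zero>\<^bsub>P\<^esub>}"
      using V.part_inter W.part_inter by (auto simp: P)
  qed (auto simp: P neg V.part_closed W.part_closed V.part_add W.part_add V.part_neg W.part_neg
      V.part_smult W.part_smult)
qed

text \<open>
  Linear maps extended by zero outside the carrier, so that equal maps are equal as functions and the
  operations can be taken pointwise. A map of parity \<open>p\<close> shifts parities by \<open>p\<close>.
\<close>

definition hom_space :: "('k, 'm) ring_scheme \<Rightarrow> ('k, 'a, 'r) super_scheme \<Rightarrow> ('k, 'b, 's) super_scheme \<Rightarrow>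
  ('k, 'a \<Rightarrow> 'b) super" where
  "hom_space K V W = \<lparr>carrier = {f. linear_map K V W f \<and> (\<forall>x. x \<notin> carrier V \<longrightarrow> f x = \<zero>\<^bsub>W\<^esub>)},
     mult = undefined, one = undefined, zero = (\<lambda>x. \<zero>\<^bsub>W\<^esub>), add = (\<lambda>f g x. f x \<oplus>\<^bsub>W\<^esub> g x),
     smult = (\<lambda>c f x. c \<odot>\<^bsub>W\<^esub> f x),
     part = (\<lambda>p. {f. linear_map K V W f \<and> (\<forall>x. x \<notin> carrier V \<longrightarrow> f x = \<zero>\<^bsub>W\<^esub>) \<and>
        (\<forall>q. \<forall>x\<in>part V q. f x \<in> part W (p + q))})\<rparr>"

definition end_algebra :: "('k, 'm) ring_scheme \<Rightarrow> ('k, 'a, 'r) super_scheme \<Rightarrow> ('k, 'a \<Rightarrow> 'a) super" where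
  "end_algebra K V = (hom_space K V V)
     \<lparr>mult := (\<lambda>f g x. f (g x)), one := (\<lambda>x. if x \<in> carrier V then x else \<zero>\<^bsub>V\<^esub>)\<rparr>"

lemma hom_space_simps:
  "f \<in> carrier (hom_space K V W) \<longleftrightarrow> linear_map K V W f \<and> (\<forall>x. x \<notin> carrier V \<longrightarrow> f x = \<zero>\<^bsub>W\<^esub>)"
  "f \<in> part (hom_space K V W) p \<longleftrightarrow> linear_map K V W f \<and> (\<forall>x. x \<notin> carrier V \<longrightarrow> f x = \<zero>\<^bsub>W\<^esub>) \<and>
        (\<forall>q. \<forall>x\<in>part V q. f x \<in> part W (p + q))"
  "zero (hom_space K V W) = (\<lambda>x. \<zero>\<^bsub>W\<^esub>)"
  "f \<oplus>\<^bsub>hom_space K V W\<^esub> g = (\<lambda>x. f x \<oplus>\<^bsub>W\<^esub> g x)"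
  "c \<odot>\<^bsub>hom_space K V W\<^esub> f = (\<lambda>x. c \<odot>\<^bsub>W\<^esub> f x)"
  by (auto simp: hom_space_def)

lemma end_algebra_simps:
  "carrier (end_algebra K V) = carrier (hom_space K V V)"
  "part (end_algebra K V) = part (hom_space K V V)"
  "zero (end_algebra K V) = zero (hom_space K V V)"
  "add (end_algebra K V) = add (hom_space K V V)"
  "smult (end_algebra K V) = smult (hom_space K V V)"
  "f \<otimes>\<^bsub>end_algebra K V\<^esub> g = (\<lambda>x. f (g x))"
  "one (end_algebra K V) = (\<lambda>x. if x \<in> carrier V then x else \<zero>\<^bsub>V\<^esub>)"
  by (auto simp: end_algebra_def hom_space_def)

lemma
  assumes "super_space K V" "super_space K W"
  shows hom_super_space: "super_space K (hom_space K V W)"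
    and hom_space_neg: "f \<in> carrier (hom_space K V W) \<Longrightarrow> \<ominus>\<^bsub>hom_space K V W\<^esub> f = (\<lambda>x. \<ominus>\<^bsub>W\<^esub> f x)"
proof -
  interpret V: super_space K V by fact
  interpret W: super_space K W by fact
  let ?H = "hom_space K V W"
  have val: "f x \<in> carrier W" if "f \<in> carrier ?H" for f x
    using that linear_map_closed[of K V W f] by (cases "x \<in> carrier V") (auto simp: hom_space_simps)
  have negc: "(\<lambda>x. \<ominus>\<^bsub>W\<^esub> f x) \<in> carrier ?H" if "f \<in> carrier ?H" for f
    using that by (auto simp: hom_space_simps intro!: linear_map_uminus V.module W.module)
  have ab: "abelian_group ?H"
  proof (rule abelian_groupI)
    fix f assume f: "f \<in> carrier ?H"
    show "\<exists>g\<in>carrier ?H. g \<oplus>\<^bsub>?H\<^esub> f = \<zero>\<^bsub>?H\<^esub>"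
      by (rule bexI[OF _ negc[OF f]]) (use val[OF f] in \<open>auto simp: hom_space_simps W.M.l_neg\<close>)
    fix g assume g: "g \<in> carrier ?H"
    show "f \<oplus>\<^bsub>?H\<^esub> g \<in> carrier ?H"
      using f g by (auto simp: hom_space_simps intro!: linear_map_plus V.module W.module)
    show "f \<oplus>\<^bsub>?H\<^esub> g = g \<oplus>\<^bsub>?H\<^esub> f"
      using val[OF f] val[OF g] by (auto simp: hom_space_simps(4) W.M.a_comm)
    show "\<zero>\<^bsub>?H\<^esub> \<oplus>\<^bsub>?H\<^esub> f = f"
      using val[OF f] by (auto simp: hom_space_simps(3,4))
    fix h assume h: "h \<in> carrier ?H"
    show "(f \<oplus>\<^bsub>?H\<^esub> g) \<oplus>\<^bsub>?H\<^esub> h = f \<oplus>\<^bsub>?H\<^esub> (g \<oplus>\<^bsub>?H\<^esub> h)"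
      using val[OF f] val[OF g] val[OF h] by (auto simp: hom_space_simps(4) W.M.a_assoc)
  qed (auto simp: hom_space_simps intro!: linear_map_const_zero W.module)
  then interpret H: module K ?H
    by (intro moduleI V.is_cring)
      (auto simp: hom_space_simps(4,5) val W.smult_l_distr W.smult_r_distr W.smult_assoc1,
       auto simp: hom_space_simps intro!: linear_map_scale V.module W.module)
  have neg: "\<ominus>\<^bsub>?H\<^esub> f = (\<lambda>x. \<ominus>\<^bsub>W\<^esub> f x)" if "f \<in> carrier ?H" for f
    by (rule H.M.minus_equality[OF _ that negc[OF that]])
      (use val[OF that] in \<open>auto simp: hom_space_simps W.M.l_neg\<close>)
  then show "f \<in> carrier ?H \<Longrightarrow> \<ominus>\<^bsub>?H\<^esub> f = (\<lambda>x. \<ominus>\<^bsub>W\<^esub> f x)" .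
  have pc: "f \<in> carrier ?H" if "f \<in> part ?H p" for f p using that by (simp add: hom_space_simps)
  have pI: "f \<in> part ?H p" if "f \<in> carrier ?H" "\<And>q x. x \<in> part V q \<Longrightarrow> f x \<in> part W (p + q)" for f p
    using that by (simp add: hom_space_simps)
  have pD: "f x \<in> part W (p + q)" if "f \<in> part ?H p" "x \<in> part V q" for f p q x
    using that by (simp add: hom_space_simps)
  show "super_space K ?H"
  proof (intro super_space.intro super_space_axioms.intro V.field_axioms H.module_axioms H.submoduleI)
    show "part ?H 0 <+>\<^bsub>?H\<^esub> part ?H 1 = carrier ?H"
    proof (intro equalityI subsetI)
      fix f assume f: "f \<in> carrier ?H"
      then have fl: "linear_map K V W f" by (simp add: hom_space_simps)
      \<comment> \<open>the component of parity \<open>p\<close> of \<open>f\<close>\<close>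
      define g where "g p x = (if x \<in> carrier V then
          proj W p (f (proj V 0 x)) \<oplus>\<^bsub>W\<^esub> proj W (p + 1) (f (proj V 1 x)) else \<zero>\<^bsub>W\<^esub>)" for p x
      have "linear_map K V W (\<lambda>x. proj W p (f (proj V 0 x)) \<oplus>\<^bsub>W\<^esub> proj W (p + 1) (f (proj V 1 x)))" for p
        by (intro linear_map_plus V.module W.module linear_map_comp[OF _ W.proj_linear]
            linear_map_comp[OF _ fl] V.proj_linear)
      then have gl: "linear_map K V W (g p)" for p
        by (auto simp: g_def linear_map_def Pi_iff)
      have gc: "g p \<in> carrier ?H" for p using gl by (simp add: hom_space_simps g_def)
      have gp: "g p \<in> part ?H p" for p
      proof (rule pI[OF gc])
        fix q x assume x: "x \<in> part V q"
        then show "g p x \<in> part W (p + q)"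
          using val[OF f] linear_map_zero[OF fl V.module W.module] W.proj_same[OF W.part_zero]
          by (cases q) (auto simp: g_def V.part_closed)
      qed
      have "f = g 0 \<oplus>\<^bsub>?H\<^esub> g 1"
      proof
        fix x
        show "f x = (g 0 \<oplus>\<^bsub>?H\<^esub> g 1) x"
        proof (cases "x \<in> carrier V")
          case True
          have "f x = f (proj V 0 x) \<oplus>\<^bsub>W\<^esub> f (proj V 1 x)"
            using True V.proj_sum[OF True, of 0] linear_map_add[OF fl, of "proj V 0 x" "proj V 1 x"] by simp
          also have "\<dots> = (proj W 0 (f (proj V 0 x)) \<oplus>\<^bsub>W\<^esub> proj W 1 (f (proj V 0 x))) \<oplus>\<^bsub>W\<^esub>
              (proj W 0 (f (proj V 1 x)) \<oplus>\<^bsub>W\<^esub> proj W 1 (f (proj V 1 x)))"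
            using W.proj_sum[of "f (proj V 0 x)" 0] W.proj_sum[of "f (proj V 1 x)" 0] val[OF f] by simp
          also have "\<dots> = (g 0 \<oplus>\<^bsub>?H\<^esub> g 1) x"
            using True val[OF f] by (simp add: g_def hom_space_simps(4) W.M.a_ac del: W.proj_part)
          finally show ?thesis .
        qed (use f in \<open>auto simp: hom_space_simps g_def\<close>)
      qed
      then show "f \<in> part ?H 0 <+>\<^bsub>?H\<^esub> part ?H 1"
        using gp[of 0] gp[of 1] by (auto simp: set_add_def set_mult_def)
    qed (auto simp: set_add_def set_mult_def pc H.M.a_closed)
    show "part ?H 0 \<inter> part ?H 1 = {\<zero>\<^bsub>?H\<^esub>}"
    proof (intro equalityI subsetI)
      fix f assume f: "f \<in> part ?H 0 \<inter> part ?H 1"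
      then have fl: "linear_map K V W f" by (simp add: hom_space_simps)
      have "f x = \<zero>\<^bsub>W\<^esub>" if "x \<in> part V q" for x q
        using W.part_disjoint[of "f x" q] pD[of f 0 x q] pD[of f 1 x q] f that by (simp add: add.commute)
      from V.linear_map_ext[OF fl linear_map_const_zero[OF W.module] this]
      have "f x = \<zero>\<^bsub>W\<^esub>" for x
        using f by (cases "x \<in> carrier V") (auto simp: hom_space_simps)
      then show "f \<in> {\<zero>\<^bsub>?H\<^esub>}" by (auto simp: hom_space_simps)
    qed (auto simp: hom_space_simps intro!: linear_map_const_zero W.module)
  next
    fix p
    show "\<zero>\<^bsub>?H\<^esub> \<in> part ?H p"
      by (rule pI[OF H.M.zero_closed]) (simp add: hom_space_simps(3))
    show "part ?H p \<subseteq> carrier ?H" using pc by blast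
    fix f assume f: "f \<in> part ?H p"
    show "\<ominus>\<^bsub>?H\<^esub> f \<in> part ?H p"
      using f pD[OF f] by (intro pI H.M.a_inv_closed pc[OF f]) (simp add: neg pc W.part_neg)
    show "c \<odot>\<^bsub>?H\<^esub> f \<in> part ?H p" if "c \<in> carrier K" for c
      using f pD[OF f] that by (intro pI H.smult_closed pc[OF f]) (auto simp: hom_space_simps(5) W.part_smult)
    fix g assume g: "g \<in> part ?H p"
    show "f \<oplus>\<^bsub>?H\<^esub> g \<in> part ?H p"
      using pD[OF f] pD[OF g] by (intro pI H.M.a_closed pc[OF f] pc[OF g]) (simp add: hom_space_simps(4) W.part_add)
  qed
qed

lemma end_superalgebra:
  assumes "super_space K V"
  shows "superalgebra K (end_algebra K V)"
proof -
  interpret V: super_space K V by fact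
  let ?E = "end_algebra K V"
  interpret E: super_space K ?E
    by (rule super_space_transfer[OF hom_super_space[OF assms assms]]) (simp_all add: end_algebra_simps)
  note e = end_algebra_simps hom_space_simps
  have lin: "linear_map K V V f" if "f \<in> carrier ?E" for f using that by (simp add: e)
  have val: "f x \<in> carrier V" if "f \<in> carrier ?E" for f x
    using that linear_map_closed[of K V V f] by (cases "x \<in> carrier V") (auto simp: e)
  have z: "f \<zero>\<^bsub>V\<^esub> = \<zero>\<^bsub>V\<^esub>" if "f \<in> carrier ?E" for f
    by (rule linear_map_zero[OF lin[OF that] V.module V.module])
  have one: "\<one>\<^bsub>?E\<^esub> \<in> carrier ?E" by (auto simp: e linear_map_def)
  have mult: "f \<otimes>\<^bsub>?E\<^esub> g \<in> carrier ?E" if f: "f \<in> carrier ?E" and g: "g \<in> carrier ?E" for f g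
  proof -
    have "linear_map K V V (\<lambda>x. f (g x))" by (rule linear_map_comp[OF lin[OF g] lin[OF f]])
    moreover have "g x = \<zero>\<^bsub>V\<^esub>" if "x \<notin> carrier V" for x using g that by (simp add: e)
    ultimately show ?thesis using z[OF f] by (simp add: e)
  qed
  have ring: "ring ?E"
  proof (intro ringI E.M.abelian_group_axioms monoidI mult one)
    fix f assume f: "f \<in> carrier ?E"
    show "\<one>\<^bsub>?E\<^esub> \<otimes>\<^bsub>?E\<^esub> f = f" using val[OF f] by (simp add: end_algebra_simps)
    show "f \<otimes>\<^bsub>?E\<^esub> \<one>\<^bsub>?E\<^esub> = f" using z[OF f] f by (auto simp: e)
    fix g h assume "g \<in> carrier ?E" "h \<in> carrier ?E"
    then show "f \<otimes>\<^bsub>?E\<^esub> (g \<oplus>\<^bsub>?E\<^esub> h) = f \<otimes>\<^bsub>?E\<^esub> g \<oplus>\<^bsub>?E\<^esub> f \<otimes>\<^bsub>?E\<^esub> h"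
      using linear_map_add[OF lin[OF f]] val by (auto simp: end_algebra_simps hom_space_simps(4))
  qed (auto simp: end_algebra_simps hom_space_simps(4))
  show ?thesis
  proof (intro superalgebra.intro superalgebra_axioms.intro E.super_space_axioms ring)
    show "\<one>\<^bsub>?E\<^esub> \<in> part ?E 0" using one by (auto simp: e V.part_closed)
    fix f g p q assume f: "f \<in> part ?E p" and g: "g \<in> part ?E q"
    have "f (g x) \<in> part V (p + q + r)" if "x \<in> part V r" for x r
      using f g that by (simp add: e add.assoc)
    then show "f \<otimes>\<^bsub>?E\<^esub> g \<in> part ?E (p + q)"
      using mult[OF E.part_closed[OF f] E.part_closed[OF g]] by (simp add: e)
  next
    fix c f g assume c: "c \<in> carrier K" "f \<in> carrier ?E" "g \<in> carrier ?E"
    show "c \<odot>\<^bsub>?E\<^esub> f \<otimes>\<^bsub>?E\<^esub> g = c \<odot>\<^bsub>?E\<^esub> (f \<otimes>\<^bsub>?E\<^esub> g)"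
      by (simp add: end_algebra_simps hom_space_simps(5))
    show "f \<otimes>\<^bsub>?E\<^esub> (c \<odot>\<^bsub>?E\<^esub> g) = c \<odot>\<^bsub>?E\<^esub> (f \<otimes>\<^bsub>?E\<^esub> g)"
      using linear_map_smult[OF lin[OF c(2)] c(1)] val[OF c(3)] by (simp add: end_algebra_simps hom_space_simps(5))
  qed
qed

section \<open>Extension of derivations\<close>

lemma trilinear_ext:
  assumes A: "super_space K A" and B: "super_space K B" and C: "super_space K C"
    and F: "\<And>b c. b \<in> carrier B \<Longrightarrow> c \<in> carrier C \<Longrightarrow> linear_map K A X (\<lambda>a. F a b c)"
      "\<And>a. a \<in> carrier A \<Longrightarrow> bilinear2 K B C X (F a)"
    and G: "\<And>b c. b \<in> carrier B \<Longrightarrow> c \<in> carrier C \<Longrightarrow> linear_map K A X (\<lambda>a. G a b c)"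
      "\<And>a. a \<in> carrier A \<Longrightarrow> bilinear2 K B C X (G a)"
    and eq: "\<And>p q r a b c. a \<in> part A p \<Longrightarrow> b \<in> part B q \<Longrightarrow> c \<in> part C r \<Longrightarrow> F a b c = G a b c"
    and c: "a \<in> carrier A" "b \<in> carrier B" "c \<in> carrier C"
  shows "F a b c = G a b c"
proof (rule super_space.linear_map_ext[OF A F(1)[OF c(2,3)] G(1)[OF c(2,3)] _ c(1)])
  fix p a assume a: "a \<in> part A p"
  have "a \<in> carrier A" by (rule super_space.part_closed[OF A a])
  from bilinear2_ext[OF B C F(2)[OF this] G(2)[OF this] _ c(2,3)]
  show "F a b c = G a b c" using eq[OF a] by blast
qed

text \<open>Only a left action is given; supercommutativity of \<open>S\<close> turns it into a right action by the sign rule.\<close>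

locale supermodule = S: supercommutative_superalgebra K S + M: super_space K M
  for K :: "('k, 'm) ring_scheme" and S :: "('k, 's, 'r) super_scheme" and M :: "('k, 'b, 'n) super_scheme" +
  fixes act :: "'s \<Rightarrow> 'b \<Rightarrow> 'b"
  assumes act: "bilinear2 K S M M act"
    and act_one: "u \<in> carrier M \<Longrightarrow> act \<one>\<^bsub>S\<^esub> u = u"
    and act_mult: "a \<in> carrier S \<Longrightarrow> b \<in> carrier S \<Longrightarrow> u \<in> carrier M \<Longrightarrow> act (a \<otimes>\<^bsub>S\<^esub> b) u = act a (act b u)"
    and act_part: "a \<in> part S p \<Longrightarrow> u \<in> part M q \<Longrightarrow> act a u \<in> part M (p + q)"
begin

text \<open>The right action \<open>u b = (-1)\<^bsup>|u||b|\<^esup> b u\<close> makes \<open>M\<close> a bimodule.\<close>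

definition "ract = homog_ext M S M (\<lambda>p q u b. sgnmul M (p * q) (act b u))"

lemma signed_act: "bilinear2 K M S M (\<lambda>u b. sgnmul M r (act b u))"
  by (rule bilinear2_sgnmul[OF M.module S.module M.module bilinear2_flip[OF act]])

lemma ract: "bilinear2 K M S M ract"
  unfolding ract_def
  by (rule homog_ext_bilinear[OF M.super_space_axioms S.super_space_axioms M.module signed_act])

lemma ract_eq: "u \<in> part M p \<Longrightarrow> b \<in> part S q \<Longrightarrow> ract u b = sgnmul M (p * q) (act b u)"
  unfolding ract_def
  by (rule homog_ext_eq[OF M.super_space_axioms S.super_space_axioms M.module signed_act])

lemmas act_closed = bilinear2_closed[OF act]
lemmas ract_closed = bilinear2_closed[OF ract]
lemmas act_sgn = bilinear2_sgn_left[OF act S.module M.module M.module]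
  bilinear2_sgn_right[OF act S.module M.module M.module]

lemmas S_mult = assoc_algebra.mult_bilinear[OF S.assoc_algebra]

lemma act_swap:
  "a \<in> part S p \<Longrightarrow> b \<in> part S q \<Longrightarrow> u \<in> carrier M \<Longrightarrow> act a (act b u) = sgnmul M (p * q) (act b (act a u))"
  by (simp add: S.part_closed S.super_comm[of a p b q] act_sgn flip: act_mult)

lemma ract_part: "u \<in> part M p \<Longrightarrow> b \<in> part S q \<Longrightarrow> ract u b \<in> part M (p + q)"
  using act_part[of b q u p] by (auto simp: ract_eq add.commute)

lemma ract_ract:
  assumes "u \<in> carrier M" "b \<in> carrier S" "c \<in> carrier S"
  shows "ract (ract u b) c = ract u (b \<otimes>\<^bsub>S\<^esub> c)"
proof (rule trilinear_ext[where F = "\<lambda>u b c. ract (ract u b) c" and G = "\<lambda>u b c. ract u (b \<otimes>\<^bsub>S\<^esub> c)",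
      OF M.super_space_axioms S.super_space_axioms S.super_space_axioms _ _ _ _ _ assms])
  fix p q r u b c assume a: "u \<in> part M p" "b \<in> part S q" "c \<in> part S r"
  note cl = M.part_closed[OF a(1)] a(2,3)[THEN S.part_closed]
  have e: "(p + q) * r + (p * q) = p * (q + r) + q * r" by (cases p; cases q; cases r) auto
  have "ract u (b \<otimes>\<^bsub>S\<^esub> c) = sgnmul M (p * (q + r)) (act b (act c u))"
    using a cl by (simp add: ract_eq[OF a(1) S.part_mult[OF a(2,3)]] act_mult)
  also have "\<dots> = sgnmul M ((p + q) * r + p * q) (act c (act b u))"
    using a cl by (simp add: act_swap[OF a(2,3)] act_closed e)
  also have "\<dots> = sgnmul M ((p + q) * r) (act c (ract u b))"
    using cl by (simp add: ract_eq[OF a(1,2)] act_sgn act_closed)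
  also have "\<dots> = ract (ract u b) c"
    by (rule ract_eq[OF ract_part[OF a(1,2)] a(3), symmetric])
  finally show "ract (ract u b) c = ract u (b \<otimes>\<^bsub>S\<^esub> c)" ..
qed (auto intro!: bilinear2I linear_map_comp[OF bilinear2_left[OF ract] bilinear2_left[OF ract]]
    linear_map_comp[OF bilinear2_right[OF ract] bilinear2_left[OF ract]]
    linear_map_comp[OF bilinear2_right[OF S_mult] bilinear2_right[OF ract]]
    linear_map_comp[OF bilinear2_left[OF S_mult] bilinear2_right[OF ract]]
    bilinear2_left[OF ract] bilinear2_right[OF ract] ract_closed)

lemma ract_act:
  assumes "a \<in> carrier S" "u \<in> carrier M" "c \<in> carrier S"
  shows "ract (act a u) c = act a (ract u c)"
proof (rule trilinear_ext[where F = "\<lambda>a u c. ract (act a u) c" and G = "\<lambda>a u c. act a (ract u c)",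
      OF S.super_space_axioms M.super_space_axioms S.super_space_axioms _ _ _ _ _ assms])
  fix p q r a u c assume a: "a \<in> part S p" "u \<in> part M q" "c \<in> part S r"
  note cl = M.part_closed[OF a(2)] a(1,3)[THEN S.part_closed]
  have e: "(p + q) * r = q * r + p * r" by (simp add: algebra_simps)
  show "ract (act a u) c = act a (ract u c)"
    using a cl by (simp add: ract_eq[OF act_part[OF a(1,2)] a(3)] ract_eq[OF a(2,3)] act_sgn act_closed
        act_swap[OF a(1,3)] e)
qed (auto intro!: bilinear2I linear_map_comp[OF bilinear2_left[OF act] bilinear2_left[OF ract]]
    linear_map_comp[OF bilinear2_right[OF act] bilinear2_left[OF ract]]
    linear_map_comp[OF bilinear2_right[OF ract] bilinear2_right[OF act]]
    linear_map_comp[OF bilinear2_left[OF ract] bilinear2_right[OF act]]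
    bilinear2_left[OF act] bilinear2_right[OF ract] ract_closed act_closed)

lemma ract_one: "u \<in> carrier M \<Longrightarrow> ract u \<one>\<^bsub>S\<^esub> = u"
proof (rule M.linear_map_ext[OF bilinear2_left[OF ract]])
  show "linear_map K M M (\<lambda>u. u)" by (simp add: linear_map_def)
qed (auto simp: ract_eq[OF _ S.one_even] act_one M.part_closed)

text \<open>The square-zero extension of \<open>S\<close> by the bimodule \<open>M\<close>.\<close>

definition square_zero :: "('k, 's \<times> 'b) super" where
  "square_zero = \<lparr>carrier = carrier S \<times> carrier M,
     mult = (\<lambda>(a, u) (b, v). (a \<otimes>\<^bsub>S\<^esub> b, act a v \<oplus>\<^bsub>M\<^esub> ract u b)), one = (\<one>\<^bsub>S\<^esub>, \<zero>\<^bsub>M\<^esub>),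
     zero = (\<zero>\<^bsub>S\<^esub>, \<zero>\<^bsub>M\<^esub>), add = (\<lambda>(a, u) (b, v). (a \<oplus>\<^bsub>S\<^esub> b, u \<oplus>\<^bsub>M\<^esub> v)),
     smult = (\<lambda>c (a, u). (c \<odot>\<^bsub>S\<^esub> a, c \<odot>\<^bsub>M\<^esub> u)), part = (\<lambda>p. part S p \<times> part M p)\<rparr>"

lemma square_zero_simps:
  "carrier square_zero = carrier S \<times> carrier M" "(a, u) \<otimes>\<^bsub>square_zero\<^esub> (b, v) = (a \<otimes>\<^bsub>S\<^esub> b, act a v \<oplus>\<^bsub>M\<^esub> ract u b)"
  "\<one>\<^bsub>square_zero\<^esub> = (\<one>\<^bsub>S\<^esub>, \<zero>\<^bsub>M\<^esub>)" "\<zero>\<^bsub>square_zero\<^esub> = (\<zero>\<^bsub>S\<^esub>, \<zero>\<^bsub>M\<^esub>)" "(a, u) \<oplus>\<^bsub>square_zero\<^esub> (b, v) = (a \<oplus>\<^bsub>S\<^esub> b, u \<oplus>\<^bsub>M\<^esub> v)"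
  "c \<odot>\<^bsub>square_zero\<^esub> (a, u) = (c \<odot>\<^bsub>S\<^esub> a, c \<odot>\<^bsub>M\<^esub> u)" "part square_zero p = part S p \<times> part M p"
  by (auto simp: square_zero_def)

lemma square_zero_superalgebra: "superalgebra K square_zero"
proof -
  interpret P: super_space K square_zero
    by (rule super_space_prod[OF S.super_space_axioms M.super_space_axioms]) (auto simp: square_zero_simps)
  note l = bilinear2_add_left[OF act] bilinear2_add_right[OF act] bilinear2_add_left[OF ract] bilinear2_add_right[OF ract]
    bilinear2_smult_left[OF act] bilinear2_smult_right[OF act] bilinear2_smult_left[OF ract] bilinear2_smult_right[OF ract]
    bilinear2_zero_right[OF act S.module M.module M.module]
    bilinear2_zero_left[OF ract M.module S.module M.module]
  have r: "ring square_zero"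
    by (intro ringI P.M.abelian_group_axioms monoidI)
      (auto simp: square_zero_simps l act_closed ract_closed act_mult ract_act ract_ract act_one ract_one
        S.m_assoc S.l_distr S.r_distr M.M.a_ac)
  show ?thesis
    by (intro superalgebra.intro superalgebra_axioms.intro P.super_space_axioms r)
      (auto simp: square_zero_simps l act_closed ract_closed S.smult_mult_left S.smult_mult_right M.smult_r_distr
        S.one_even S.part_mult intro!: M.part_add act_part ract_part)
qed

end

context tensor
begin

text \<open>
  In the square-zero extension the elements \<open>(s x, f x)\<close> supercommute, by the definition of the right action, so they
  determine a homomorphism out of \<open>S(V)\<close>. Its first component is the identity, and multiplicativity of
  the second component is the Leibniz rule.
\<close>

lemma derivation_exists:
  assumes "supermodule K S M act" and f: "even_linear K V M f"
  obtains D where "even_linear K S M D" "\<And>x. x \<in> carrier V \<Longrightarrow> D (s x) = f x"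
    "\<And>p q a b. a \<in> part S p \<Longrightarrow> b \<in> part S q \<Longrightarrow>
      D (a \<otimes>\<^bsub>S\<^esub> b) = act a (D b) \<oplus>\<^bsub>M\<^esub> sgnmul M (p * q) (act b (D a))"
proof -
  interpret supermodule K S M act by fact
  interpret Q: superalgebra K square_zero by (rule square_zero_superalgebra)
  let ?\<phi> = "\<lambda>x. (s x, f x)"
  note sl = even_linear_linear[OF s_even] and fl = even_linear_linear[OF f]
  have \<phi>: "even_linear K V square_zero ?\<phi>"
    using even_linear_part[OF s_even] even_linear_part[OF f]
    by (intro even_linearI linear_mapI)
      (auto simp: square_zero_simps linear_map_closed[OF sl] linear_map_closed[OF fl] linear_map_add[OF sl]
        linear_map_add[OF fl] linear_map_smult[OF sl] linear_map_smult[OF fl])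
  have sgn: "sgnmul square_zero p (a, u) = (sgnmul S p a, sgnmul M p u)" if "a \<in> carrier S" "u \<in> carrier M" for p a u
  proof -
    have "\<ominus>\<^bsub>square_zero\<^esub> (a, u) = (\<ominus>\<^bsub>S\<^esub> a, \<ominus>\<^bsub>M\<^esub> u)"
      by (rule Q.M.minus_equality) (use that in \<open>auto simp: square_zero_simps S.M.l_neg M.M.l_neg\<close>)
    then show ?thesis by (simp add: sgnmul_def)
  qed
  have c: "?\<phi> x \<otimes>\<^bsub>square_zero\<^esub> ?\<phi> y = sgnmul square_zero (p * q) (?\<phi> y \<otimes>\<^bsub>square_zero\<^esub> ?\<phi> x)"
    if x: "x \<in> part V p" and y: "y \<in> part V q" for x y p q
  proof -
    note px = even_linear_part[OF s_even x] even_linear_part[OF s_even y]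
      even_linear_part[OF f x] even_linear_part[OF f y]
    note cl = px(1,2)[THEN S.part_closed] px(3,4)[THEN M.part_closed]
    show ?thesis
      using cl by (simp add: square_zero_simps sgn act_closed ract_closed s_comm[OF x y] ract_eq[OF px(3,2)]
          ract_eq[OF px(4,1)] M.sgnmul_add M.M.a_comm mult.commute)
  qed
  obtain F where F: "super_hom K S square_zero F" "\<And>x. x \<in> carrier V \<Longrightarrow> F (s x) = ?\<phi> x"
    using S_universal[OF square_zero_superalgebra \<phi> c] by blast
  note h = super_hom_alg[OF F(1)]
  note hl = alg_hom_linear[OF h]
  have Fc: "F a \<in> carrier S \<times> carrier M" if "a \<in> carrier S" for a
    using alg_hom_closed[OF h that] by (simp add: square_zero_simps)
  have fst: "fst (F a) = a" if "a \<in> part S p" for a p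
    using S_generated that
  proof (induction rule: graded_generatedD)
    case (zero p)
    then show ?case using linear_map_zero[OF hl S.module Q.module] by (simp add: square_zero_simps)
  next
    case one
    then show ?case using alg_hom_one[OF h] by (simp add: square_zero_simps)
  next
    case (gen p x)
    then show ?case using F(2) by (simp add: part_closed)
  next
    case (add p a b)
    then show ?case using linear_map_add[OF hl, of a b]
      by (cases "F a"; cases "F b") (simp add: S.part_closed square_zero_simps)
  next
    case (smult p c a)
    then show ?case using linear_map_smult[OF hl, of c a]
      by (cases "F a") (simp add: S.part_closed square_zero_simps)
  next
    case (mult p q a b)
    then show ?case using alg_hom_mult[OF h, of a b]
      by (cases "F a"; cases "F b") (simp add: S.part_closed square_zero_simps)
  qed
  let ?D = "\<lambda>a. snd (F a)"
  have evaluate: "even_linear K S M ?D"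
  proof (intro even_linearI linear_mapI)
    fix a b assume ab: "a \<in> carrier S" "b \<in> carrier S"
    show "?D (a \<oplus>\<^bsub>S\<^esub> b) = ?D a \<oplus>\<^bsub>M\<^esub> ?D b"
      using linear_map_add[OF hl ab] by (cases "F a"; cases "F b") (simp add: square_zero_simps)
  next
    fix c a assume "c \<in> carrier K" "a \<in> carrier S"
    then show "?D (c \<odot>\<^bsub>S\<^esub> a) = c \<odot>\<^bsub>M\<^esub> ?D a"
      using linear_map_smult[OF hl] by (cases "F a") (simp add: square_zero_simps)
  next
    fix p a assume "a \<in> part S p"
    then show "?D a \<in> part M p" using super_hom_part[OF F(1)] by (fastforce simp: square_zero_simps)
  qed (use Fc in \<open>force\<close>)
  show thesis
  proof (rule that[of ?D])
    show "even_linear K S M ?D" by (rule evaluate)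
    show "?D (s x) = f x" if "x \<in> carrier V" for x using F(2)[OF that] by simp
    fix p q a b assume a: "a \<in> part S p" and b: "b \<in> part S q"
    have "F a = (a, ?D a)" "F b = (b, ?D b)" using fst[OF a] fst[OF b] by (metis prod.collapse)+
    then have "?D (a \<otimes>\<^bsub>S\<^esub> b) = act a (?D b) \<oplus>\<^bsub>M\<^esub> ract (?D a) b"
      using alg_hom_mult[OF h S.part_closed[OF a] S.part_closed[OF b]] by (metis snd_conv square_zero_simps(2))
    then show "?D (a \<otimes>\<^bsub>S\<^esub> b) = act a (?D b) \<oplus>\<^bsub>M\<^esub> sgnmul M (p * q) (act b (?D a))"
      using ract_eq[OF even_linear_part[OF evaluate a] b] by simp
  qed
qed

end

section \<open>Supercommutators\<close>

context superalgebra
begin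

lemmas mult_bilinear = assoc_algebra.mult_bilinear[OF assoc_algebra]

lemma sgn_left: "x \<in> carrier A \<Longrightarrow> y \<in> carrier A \<Longrightarrow> sgnmul A p x \<otimes>\<^bsub>A\<^esub> y = sgnmul A p (x \<otimes>\<^bsub>A\<^esub> y)"
  by (rule bilinear2_sgn_left[OF mult_bilinear module module module])

lemma sgn_right: "x \<in> carrier A \<Longrightarrow> y \<in> carrier A \<Longrightarrow> x \<otimes>\<^bsub>A\<^esub> sgnmul A p y = sgnmul A p (x \<otimes>\<^bsub>A\<^esub> y)"
  by (rule bilinear2_sgn_right[OF mult_bilinear module module module])

text \<open>
  The supercommutator with the parities of the arguments supplied from outside: a bilinear expression on all of \<open>A\<close>,
  which agrees with the supercommutator on arguments of these parities.
\<close>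

definition "scomm p q x y = x \<otimes>\<^bsub>A\<^esub> y \<ominus>\<^bsub>A\<^esub> sgnmul A (p * q) (y \<otimes>\<^bsub>A\<^esub> x)"

lemma scomm_closed: "x \<in> carrier A \<Longrightarrow> y \<in> carrier A \<Longrightarrow> scomm p q x y \<in> carrier A"
  by (simp add: scomm_def)

lemma scomm_mult_right:
  assumes "x \<in> carrier A" "y \<in> carrier A" "z \<in> carrier A"
  shows "scomm p (q + r) x (y \<otimes>\<^bsub>A\<^esub> z) = scomm p q x y \<otimes>\<^bsub>A\<^esub> z \<oplus>\<^bsub>A\<^esub> sgnmul A (p * q) (y \<otimes>\<^bsub>A\<^esub> scomm p r x z)"
  using assms unfolding scomm_def
  by (cases p; cases q; cases r; simp add: sgnmul_def l_distr r_distr l_minus r_minus m_assoc M.cancel)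

lemma scomm_mult_left:
  assumes "x \<in> carrier A" "y \<in> carrier A" "z \<in> carrier A"
  shows "scomm (p + q) r (x \<otimes>\<^bsub>A\<^esub> y) z = x \<otimes>\<^bsub>A\<^esub> scomm q r y z \<oplus>\<^bsub>A\<^esub> sgnmul A (q * r) (scomm p r x z \<otimes>\<^bsub>A\<^esub> y)"
  using assms unfolding scomm_def
  by (cases p; cases q; cases r; simp add: sgnmul_def l_distr r_distr l_minus r_minus m_assoc M.cancel)

lemma scomm_skew:
  assumes "x \<in> carrier A" "y \<in> carrier A"
  shows "scomm p q x y = \<ominus>\<^bsub>A\<^esub> sgnmul A (p * q) (scomm q p y x)"
  using assms unfolding scomm_def
  by (cases p; cases q; simp add: sgnmul_def M.cancel)

lemma scomm_bilinear: "bilinear2 K A A A (scomm p q)"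
  unfolding scomm_def[abs_def] a_minus_def
  by (intro bilinear2_plus bilinear2_uminus bilinear2_sgnmul module mult_bilinear
      bilinear2_flip[OF mult_bilinear])

lemmas scomm_simps = bilinear2_add_left[OF scomm_bilinear] bilinear2_add_right[OF scomm_bilinear]
  bilinear2_smult_left[OF scomm_bilinear] bilinear2_smult_right[OF scomm_bilinear]
  bilinear2_zero_left[OF scomm_bilinear module module module]
  bilinear2_zero_right[OF scomm_bilinear module module module]
  bilinear2_sgn_left[OF scomm_bilinear module module module]
  bilinear2_sgn_right[OF scomm_bilinear module module module]

lemma scomm_one: "x \<in> carrier A \<Longrightarrow> scomm p 0 x \<one>\<^bsub>A\<^esub> = \<zero>\<^bsub>A\<^esub>"
  by (simp add: scomm_def M.cancel)

lemma super_commutator_eq: "super_commutator A = homog_ext A A A scomm"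
  by (simp add: super_commutator_def scomm_def[abs_def])

lemma super_commutator_bilinear: "bilinear2 K A A A (super_commutator A)"
  unfolding super_commutator_eq
  by (rule homog_ext_bilinear[OF super_space_axioms super_space_axioms module scomm_bilinear])

lemma super_commutator_part:
  "x \<in> part A p \<Longrightarrow> y \<in> part A q \<Longrightarrow> super_commutator A x y = scomm p q x y"
  unfolding super_commutator_eq
  by (rule homog_ext_eq[OF super_space_axioms super_space_axioms module scomm_bilinear])

end

text \<open>From \<open>1 = 1 1\<close> one gets \<open>\<beta>(1) = 2 \<beta>(1)\<close>.\<close>

lemma derivation_one:
  assumes "superalgebra K A" "superalgebra K B" "super_hom K A B \<alpha>" "even_superderivation K A B \<alpha> \<beta>"
  shows "\<beta> \<one>\<^bsub>A\<^esub> = \<zero>\<^bsub>B\<^esub>"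
proof -
  interpret A: superalgebra K A by fact
  interpret B: superalgebra K B by fact
  have c: "\<beta> \<one>\<^bsub>A\<^esub> \<in> carrier B"
    using assms(4) linear_map_closed[of K A B \<beta>] by (auto simp: even_superderivation_def even_linear_def)
  have "\<beta> (\<one>\<^bsub>A\<^esub> \<otimes>\<^bsub>A\<^esub> \<one>\<^bsub>A\<^esub>) = \<alpha> \<one>\<^bsub>A\<^esub> \<otimes>\<^bsub>B\<^esub> \<beta> \<one>\<^bsub>A\<^esub> \<oplus>\<^bsub>B\<^esub> sgnmul B (0 * 0) (\<alpha> \<one>\<^bsub>A\<^esub> \<otimes>\<^bsub>B\<^esub> \<beta> \<one>\<^bsub>A\<^esub>)"
  proof -
    have "\<And>p q a b. a \<in> part A p \<Longrightarrow> b \<in> part A q \<Longrightarrow>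
        \<beta> (a \<otimes>\<^bsub>A\<^esub> b) = \<alpha> a \<otimes>\<^bsub>B\<^esub> \<beta> b \<oplus>\<^bsub>B\<^esub> sgnmul B (p * q) (\<alpha> b \<otimes>\<^bsub>B\<^esub> \<beta> a)"
      using assms(4) by (auto simp: even_superderivation_def)
    from this[OF A.one_even A.one_even] show ?thesis .
  qed
  then have "\<beta> \<one>\<^bsub>A\<^esub> = \<beta> \<one>\<^bsub>A\<^esub> \<oplus>\<^bsub>B\<^esub> \<beta> \<one>\<^bsub>A\<^esub>"
    using c alg_hom_one[OF super_hom_alg[OF assms(3)]] by simp
  then show ?thesis using c by (metis B.M.add.l_cancel_one')
qed

section \<open>Biderivations and relations between brackets\<close>

text \<open>Everything in the definition of a Poisson bracket except the Jacobi identity.\<close>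

locale biderivation = supercommutative_superalgebra K S
  for K :: "('k, 'm) ring_scheme" and S :: "('k, 's, 'r) super_scheme" +
  fixes br :: "'s \<Rightarrow> 's \<Rightarrow> 's"
  assumes br: "bilinear2 K S S S br"
    and br_part: "\<lbrakk>x \<in> part S p; y \<in> part S q\<rbrakk> \<Longrightarrow> br x y \<in> part S (p + q)"
    and br_skew: "\<lbrakk>x \<in> part S p; y \<in> part S q\<rbrakk> \<Longrightarrow> br x y = \<ominus>\<^bsub>S\<^esub> sgnmul S (p * q) (br y x)"
    and br_leibniz: "\<lbrakk>x \<in> part S p; y \<in> part S q; z \<in> part S r\<rbrakk> \<Longrightarrow>
      br x (y \<otimes>\<^bsub>S\<^esub> z) = sgnmul S (p * q) (y \<otimes>\<^bsub>S\<^esub> br x z) \<oplus>\<^bsub>S\<^esub> br x y \<otimes>\<^bsub>S\<^esub> z"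
begin

lemmas br_closed = bilinear2_closed[OF br]

lemmas br_simps = bilinear2_add_left[OF br] bilinear2_add_right[OF br]
  bilinear2_smult_left[OF br] bilinear2_smult_right[OF br]
  bilinear2_zero_left[OF br module module module] bilinear2_zero_right[OF br module module module]
  bilinear2_sgn_left[OF br module module module] bilinear2_sgn_right[OF br module module module]
  bilinear2_neg_left[OF br module module module] bilinear2_neg_right[OF br module module module]

lemma br_one_right: "x \<in> part S p \<Longrightarrow> br x \<one>\<^bsub>S\<^esub> = \<zero>\<^bsub>S\<^esub>"
proof -
  assume x: "x \<in> part S p"
  have c: "br x \<one>\<^bsub>S\<^esub> \<in> carrier S" using x by (auto intro: br_closed)
  then have "br x \<one>\<^bsub>S\<^esub> = br x \<one>\<^bsub>S\<^esub> \<oplus>\<^bsub>S\<^esub> br x \<one>\<^bsub>S\<^esub>"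
    using br_leibniz[OF x one_even one_even] by simp
  then show ?thesis using c by (metis M.add.l_cancel_one')
qed

lemma br_one_left: "x \<in> part S p \<Longrightarrow> br \<one>\<^bsub>S\<^esub> x = \<zero>\<^bsub>S\<^esub>"
  using br_skew[OF one_even, of x p] br_one_right[of x p] by simp

lemma br_leibniz_left:
  assumes x: "x \<in> part S p" and y: "y \<in> part S q" and z: "z \<in> part S r"
  shows "br (x \<otimes>\<^bsub>S\<^esub> y) z = x \<otimes>\<^bsub>S\<^esub> br y z \<oplus>\<^bsub>S\<^esub> sgnmul S (p * q) (y \<otimes>\<^bsub>S\<^esub> br x z)"
proof -
  note c = x[THEN part_closed] y[THEN part_closed] z[THEN part_closed]
  note [simp] = c br_closed[OF c(1,3)] br_closed[OF c(2,3)] br_closed[OF c(3,1)] br_closed[OF c(3,2)]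
  have 1: "br (x \<otimes>\<^bsub>S\<^esub> y) z = \<ominus>\<^bsub>S\<^esub> sgnmul S ((p + q) * r) (sgnmul S (r * p) (x \<otimes>\<^bsub>S\<^esub> br z y) \<oplus>\<^bsub>S\<^esub> br z x \<otimes>\<^bsub>S\<^esub> y)"
    using br_skew[OF part_mult[OF x y] z] br_leibniz[OF z x y] by simp
  have 2: "br z x \<otimes>\<^bsub>S\<^esub> y = sgnmul S ((r + p) * q) (y \<otimes>\<^bsub>S\<^esub> br z x)"
    by (rule super_comm[OF br_part[OF z x] y])
  show ?thesis
    unfolding 1 2 br_skew[OF y z] br_skew[OF x z]
    by (cases p; cases q; cases r; simp add: sgnmul_def r_minus M.cancel)
qed

text \<open>
  The two bracket conditions of property P for a pair \<open>(\<alpha>, \<beta>)\<close>, assumed for generators only, are now extended to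
  all homogeneous elements.
\<close>

context
  fixes V :: "('k, 'v, 'n) super_scheme" and s :: "'v \<Rightarrow> 's" and B :: "('k, 'b, 'o) super_scheme" and \<alpha> \<beta>
  assumes gen: "graded_generated K V S s"
    and s_part: "\<And>p x. x \<in> part V p \<Longrightarrow> s x \<in> part S p"
    and B: "superalgebra K B" and \<alpha>: "super_hom K S B \<alpha>" and \<beta>: "even_superderivation K S B \<alpha> \<beta>"
    and \<alpha>_gen: "\<And>p q x y. x \<in> part V p \<Longrightarrow> y \<in> part V q \<Longrightarrow>
        \<alpha> (br (s x) (s y)) = superalgebra.scomm B p q (\<beta> (s x)) (\<alpha> (s y))"
begin

interpretation B: superalgebra K B by (rule B)

lemma \<beta>l: "linear_map K S B \<beta>"
  using \<beta> by (simp add: even_superderivation_def even_linear_def)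

lemma \<alpha>l: "linear_map K S B \<alpha>"
  by (rule alg_hom_linear[OF super_hom_alg[OF \<alpha>]])

lemma \<beta>_mult: "x \<in> part S p \<Longrightarrow> y \<in> part S q \<Longrightarrow>
    \<beta> (x \<otimes>\<^bsub>S\<^esub> y) = \<alpha> x \<otimes>\<^bsub>B\<^esub> \<beta> y \<oplus>\<^bsub>B\<^esub> sgnmul B (p * q) (\<alpha> y \<otimes>\<^bsub>B\<^esub> \<beta> x)"
  using \<beta> by (auto simp: even_superderivation_def)

lemmas \<alpha>_mult = alg_hom_mult[OF super_hom_alg[OF \<alpha>]]
lemmas \<alpha>_one = alg_hom_one[OF super_hom_alg[OF \<alpha>]]
lemmas \<beta>_one = derivation_one[OF superalgebra_axioms B \<alpha> \<beta>]
lemmas map_simps = linear_map_add[OF \<alpha>l] linear_map_add[OF \<beta>l] linear_map_smult[OF \<alpha>l] linear_map_smult[OF \<beta>l]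
  linear_map_zero[OF \<alpha>l module B.module] linear_map_zero[OF \<beta>l module B.module]
  linear_map_sgn[OF \<alpha>l module B.module] linear_map_sgn[OF \<beta>l module B.module]
  linear_map_neg[OF \<alpha>l module B.module] linear_map_neg[OF \<beta>l module B.module]
lemmas map_closed [simp] = linear_map_closed[OF \<alpha>l] linear_map_closed[OF \<beta>l]

lemma \<alpha>_comm:
  assumes "x \<in> part S p" "y \<in> part S q"
  shows "B.scomm p q (\<alpha> x) (\<alpha> y) = \<zero>\<^bsub>B\<^esub>"
  using assms[THEN part_closed] super_comm[OF assms] unfolding B.scomm_def
  by (simp add: map_simps B.M.minus_zero_iff flip: \<alpha>_mult)

text \<open>Both sides are derivations in the second argument.\<close>

lemma \<alpha>_step_right:
  assumes a: "a \<in> part S p" and b: "b \<in> part S q" and c: "c \<in> part S r"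
    and ab: "\<alpha> (br a b) = B.scomm p q (\<beta> a) (\<alpha> b)" and ac: "\<alpha> (br a c) = B.scomm p r (\<beta> a) (\<alpha> c)"
  shows "\<alpha> (br a (b \<otimes>\<^bsub>S\<^esub> c)) = B.scomm p (q + r) (\<beta> a) (\<alpha> (b \<otimes>\<^bsub>S\<^esub> c))"
proof -
  note cl [simp] = a[THEN part_closed] b[THEN part_closed] c[THEN part_closed]
  note [simp] = br_closed[OF cl(1,2)] br_closed[OF cl(1,3)] B.scomm_closed
  show ?thesis
    by (simp add: br_leibniz[OF a b c] map_simps \<alpha>_mult ab ac B.scomm_mult_right B.M.a_comm)
qed

lemma \<alpha>_br_gen:
  assumes x: "x \<in> part V p" and b: "b \<in> part S q"
  shows "\<alpha> (br (s x) b) = B.scomm p q (\<beta> (s x)) (\<alpha> b)"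
  using gen b
proof (induction rule: graded_generatedD)
  note sx = s_part[OF x]
  note [simp] = part_closed[OF sx]
  { case zero then show ?case by (simp add: map_simps br_simps B.scomm_simps) }
  { case one then show ?case by (simp add: map_simps \<alpha>_one br_one_right[OF sx] B.scomm_one) }
  { case gen then show ?case by (rule \<alpha>_gen[OF x]) }
  { case add then show ?case by (simp add: map_simps br_simps B.scomm_simps part_closed br_closed) }
  { case smult then show ?case by (simp add: map_simps br_simps B.scomm_simps part_closed br_closed) }
  { case mult then show ?case by (intro \<alpha>_step_right sx) }
qed

text \<open>
  In the first argument the right-hand side satisfies the same Leibniz rule as the bracket because \<open>\<beta>\<close> is an
  \<open>\<alpha>\<close>-derivation and the values of \<open>\<alpha>\<close> supercommute with each other.
\<close>

lemma \<alpha>_br: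
  assumes a: "a \<in> part S p" and b: "b \<in> part S q"
  shows "\<alpha> (br a b) = B.scomm p q (\<beta> a) (\<alpha> b)"
  using gen a
proof (induction rule: graded_generatedD)
  note [simp] = part_closed[OF b]
  { case zero then show ?case by (simp add: map_simps br_simps B.scomm_simps) }
  { case one then show ?case by (simp add: map_simps \<beta>_one br_one_left[OF b] B.scomm_simps) }
  { case gen then show ?case by (rule \<alpha>_br_gen[OF _ b]) }
  { case add then show ?case by (simp add: map_simps br_simps B.scomm_simps part_closed br_closed) }
  { case smult then show ?case by (simp add: map_simps br_simps B.scomm_simps part_closed br_closed) }
  case (mult p r a c)
  note cl [simp] = mult(1,2)[THEN part_closed]
  note [simp] = br_closed B.scomm_closed
  have 1: "B.scomm (p + r) q (\<alpha> a \<otimes>\<^bsub>B\<^esub> \<beta> c) (\<alpha> b) = \<alpha> a \<otimes>\<^bsub>B\<^esub> B.scomm r q (\<beta> c) (\<alpha> b)"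
    by (simp add: B.scomm_mult_left \<alpha>_comm[OF mult(1) b])
  have 2: "B.scomm (p + r) q (\<alpha> c \<otimes>\<^bsub>B\<^esub> \<beta> a) (\<alpha> b) = \<alpha> c \<otimes>\<^bsub>B\<^esub> B.scomm p q (\<beta> a) (\<alpha> b)"
    using B.scomm_mult_left[of "\<alpha> c" "\<beta> a" "\<alpha> b" r p q] \<alpha>_comm[OF mult(2) b]
    by (simp add: add.commute)
  show ?case
    using mult(3,4)
    by (simp add: br_leibniz_left[OF mult(1,2) b] \<beta>_mult[OF mult(1,2)] map_simps \<alpha>_mult B.scomm_simps 1 2)
qed

text \<open>
  Expanding \<open>\<beta>{a, bc}\<close> and \<open>[\<beta>(a), \<beta>(bc)]\<close> by the Leibniz rules gives four terms each. Two of them agree by the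
  hypotheses; the other two contain \<open>\<alpha>{a, b}\<close> and \<open>\<alpha>{a, c}\<close>, and agree by \<open>\<alpha>_br\<close>.
\<close>

lemma \<beta>_step_right:
  assumes a: "a \<in> part S p" and b: "b \<in> part S q" and c: "c \<in> part S r"
    and ab: "\<beta> (br a b) = B.scomm p q (\<beta> a) (\<beta> b)" and ac: "\<beta> (br a c) = B.scomm p r (\<beta> a) (\<beta> c)"
  shows "\<beta> (br a (b \<otimes>\<^bsub>S\<^esub> c)) = B.scomm p (q + r) (\<beta> a) (\<beta> (b \<otimes>\<^bsub>S\<^esub> c))"
proof -
  note cl [simp] = a[THEN part_closed] b[THEN part_closed] c[THEN part_closed]
  note [simp] = br_closed[OF cl(1,2)] br_closed[OF cl(1,3)] B.scomm_closed
  have e: "p * q + q * (p + r) = q * r" by (cases p; cases q; cases r) auto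
  have "\<beta> (br a (b \<otimes>\<^bsub>S\<^esub> c)) =
      sgnmul B (p * q) (\<alpha> b \<otimes>\<^bsub>B\<^esub> \<beta> (br a c)) \<oplus>\<^bsub>B\<^esub> sgnmul B (q * r) (\<alpha> (br a c) \<otimes>\<^bsub>B\<^esub> \<beta> b) \<oplus>\<^bsub>B\<^esub>
      (\<alpha> (br a b) \<otimes>\<^bsub>B\<^esub> \<beta> c \<oplus>\<^bsub>B\<^esub> sgnmul B ((p + q) * r) (\<alpha> c \<otimes>\<^bsub>B\<^esub> \<beta> (br a b)))"
    by (simp add: br_leibniz[OF a b c] map_simps \<beta>_mult[OF b br_part[OF a c]] \<beta>_mult[OF br_part[OF a b] c]
        B.sgnmul_add e)
  also have "\<dots> = B.scomm p (q + r) (\<beta> a) (\<alpha> b \<otimes>\<^bsub>B\<^esub> \<beta> c) \<oplus>\<^bsub>B\<^esub>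
      sgnmul B (q * r) (B.scomm p (r + q) (\<beta> a) (\<alpha> c \<otimes>\<^bsub>B\<^esub> \<beta> b))"
    unfolding \<alpha>_br[OF a b] \<alpha>_br[OF a c] ab ac
    by (simp add: B.scomm_mult_right[of _ _ _ p q r] B.scomm_mult_right[of _ _ _ p r q] B.sgnmul_add
        distrib_right mult.commute[of r] add.commute[of "q * r"] B.M.a_ac)
  also have "\<dots> = B.scomm p (q + r) (\<beta> a) (\<beta> (b \<otimes>\<^bsub>S\<^esub> c))"
    by (simp add: \<beta>_mult[OF b c] B.scomm_simps add.commute[of r q])
  finally show ?thesis .
qed

context
  assumes \<beta>_gen: "\<And>p q x y. x \<in> part V p \<Longrightarrow> y \<in> part V q \<Longrightarrow>
        \<beta> (br (s x) (s y)) = superalgebra.scomm B p q (\<beta> (s x)) (\<beta> (s y))"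
begin

lemma \<beta>_br_gen:
  assumes x: "x \<in> part V p" and b: "b \<in> part S q"
  shows "\<beta> (br (s x) b) = B.scomm p q (\<beta> (s x)) (\<beta> b)"
  using gen b
proof (induction rule: graded_generatedD)
  note sx = s_part[OF x]
  note [simp] = part_closed[OF sx]
  { case zero then show ?case by (simp add: map_simps br_simps B.scomm_simps) }
  { case one then show ?case by (simp add: map_simps \<beta>_one br_one_right[OF sx] B.scomm_simps) }
  { case gen then show ?case by (rule \<beta>_gen[OF x]) }
  { case add then show ?case by (simp add: map_simps br_simps B.scomm_simps part_closed br_closed) }
  { case smult then show ?case by (simp add: map_simps br_simps B.scomm_simps part_closed br_closed) }
  { case mult then show ?case by (intro \<beta>_step_right sx) }
qed

lemma \<beta>_br_flip:
  assumes a: "a \<in> part S p" and b: "b \<in> part S q" and ab: "\<beta> (br a b) = B.scomm p q (\<beta> a) (\<beta> b)"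
  shows "\<beta> (br b a) = B.scomm q p (\<beta> b) (\<beta> a)"
proof -
  note cl [simp] = a[THEN part_closed] b[THEN part_closed]
  show ?thesis
    unfolding br_skew[OF b a] B.scomm_skew[of "\<beta> b" "\<beta> a" q p, OF map_closed(2)[OF cl(2)] map_closed(2)[OF cl(1)]] ab[symmetric]
    using br_closed[OF cl] by (simp add: map_simps)
qed

text \<open>
  Both sides are skew-symmetric, so the first argument is treated like the second one.
\<close>

lemma \<beta>_br:
  assumes a: "a \<in> part S p" and b: "b \<in> part S q"
  shows "\<beta> (br a b) = B.scomm p q (\<beta> a) (\<beta> b)"
  using gen a
proof (induction rule: graded_generatedD)
  note [simp] = part_closed[OF b]
  { case zero then show ?case by (simp add: map_simps br_simps B.scomm_simps) }
  { case one then show ?case by (simp add: map_simps \<beta>_one br_one_left[OF b] B.scomm_simps) }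
  { case gen then show ?case by (rule \<beta>_br_gen[OF _ b]) }
  { case add then show ?case by (simp add: map_simps br_simps B.scomm_simps part_closed br_closed) }
  { case smult then show ?case by (simp add: map_simps br_simps B.scomm_simps part_closed br_closed) }
  case (mult p r a c)
  show ?case
    by (rule \<beta>_br_flip[OF b part_mult[OF mult(1,2)]
        \<beta>_step_right[OF b mult(1,2) \<beta>_br_flip[OF mult(1) b mult(3)] \<beta>_br_flip[OF mult(2) b mult(4)]]])
qed

end

end

end

section \<open>The Poisson bracket of the supersymmetric algebra\<close>

lemma supermodule_transfer:
  assumes "supermodule K S M act" "carrier N = carrier M" "zero N = zero M" "add N = add M"
    "smult N = smult M" "part N = part M"
  shows "supermodule K S N act"
proof -
  interpret supermodule K S M act by fact
  interpret N: super_space K N by (rule super_space_transfer[OF M.super_space_axioms assms(2-)])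
  show ?thesis
    by unfold_locales
      (use act act_one act_mult act_part assms(2-) in \<open>auto simp: bilinear2_def linear_map_def\<close>)
qed

context supercommutative_superalgebra
begin

lemma hom_supermodule:
  assumes V: "super_space K V"
  shows "supermodule K A (hom_space K V A) (\<lambda>a f x. a \<otimes>\<^bsub>A\<^esub> f x)"
proof -
  interpret V: super_space K V by fact
  interpret H: super_space K "hom_space K V A" by (rule hom_super_space[OF V super_space_axioms])
  have val: "f x \<in> carrier A" if "f \<in> carrier (hom_space K V A)" for f x
    using that linear_map_closed[of K V A f] by (cases "x \<in> carrier V") (auto simp: hom_space_simps)
  have act: "(\<lambda>x. a \<otimes>\<^bsub>A\<^esub> f x) \<in> carrier (hom_space K V A)"
    if "a \<in> carrier A" "f \<in> carrier (hom_space K V A)" for a f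
    using that linear_map_comp[OF _ bilinear2_right[OF mult_bilinear], of V f a]
    by (auto simp: hom_space_simps)
  show ?thesis
  proof unfold_locales
    show "bilinear2 K A (hom_space K V A) (hom_space K V A) (\<lambda>a f x. a \<otimes>\<^bsub>A\<^esub> f x)"
      by (intro bilinear2I linear_mapI act)
        (auto simp: hom_space_simps(4,5) val l_distr r_distr smult_mult_left smult_mult_right)
    fix a p f q assume a: "a \<in> part A p" and f: "f \<in> part (hom_space K V A) q"
    have "a \<otimes>\<^bsub>A\<^esub> f x \<in> part A (p + q + r)" if "x \<in> part V r" for x r
      using part_mult[OF a, of "f x" "q + r"] f that by (simp add: hom_space_simps add.assoc)
    then show "(\<lambda>x. a \<otimes>\<^bsub>A\<^esub> f x) \<in> part (hom_space K V A) (p + q)"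
      using act[OF part_closed[OF a] H.part_closed[OF f]] by (simp add: hom_space_simps)
  qed (auto simp: val m_assoc)
qed

lemma end_supermodule: "supermodule K A (end_algebra K A) (\<lambda>a f x. a \<otimes>\<^bsub>A\<^esub> f x)"
  by (rule supermodule_transfer[OF hom_supermodule[OF super_space_axioms]]) (simp_all add: end_algebra_simps)

end

text \<open>
  In the commutator of two superderivations \<open>X\<close> and \<open>Y\<close>, the mixed terms \<open>X(a) Y(b)\<close> and \<open>Y(a) X(b)\<close> of the two
  double applications to \<open>ab\<close> cancel.
\<close>

lemma (in superalgebra) derivation_commutator:
  assumes X: "linear_map K A A X" "\<And>r a. a \<in> part A r \<Longrightarrow> X a \<in> part A (p + r)"
      "\<And>r a b. a \<in> part A r \<Longrightarrow> b \<in> carrier A \<Longrightarrow>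
        X (a \<otimes>\<^bsub>A\<^esub> b) = sgnmul A (p * r) (a \<otimes>\<^bsub>A\<^esub> X b) \<oplus>\<^bsub>A\<^esub> X a \<otimes>\<^bsub>A\<^esub> b"
    and Y: "linear_map K A A Y" "\<And>r a. a \<in> part A r \<Longrightarrow> Y a \<in> part A (q + r)"
      "\<And>r a b. a \<in> part A r \<Longrightarrow> b \<in> carrier A \<Longrightarrow>
        Y (a \<otimes>\<^bsub>A\<^esub> b) = sgnmul A (q * r) (a \<otimes>\<^bsub>A\<^esub> Y b) \<oplus>\<^bsub>A\<^esub> Y a \<otimes>\<^bsub>A\<^esub> b"
    and a: "a \<in> part A r" and b: "b \<in> carrier A"
  defines "C \<equiv> \<lambda>a. X (Y a) \<ominus>\<^bsub>A\<^esub> sgnmul A (p * q) (Y (X a))"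
  shows "C (a \<otimes>\<^bsub>A\<^esub> b) = sgnmul A ((p + q) * r) (a \<otimes>\<^bsub>A\<^esub> C b) \<oplus>\<^bsub>A\<^esub> C a \<otimes>\<^bsub>A\<^esub> b"
proof -
  note [simp] = linear_map_closed[OF X(1)] linear_map_closed[OF Y(1)]
  note c [simp] = part_closed[OF a] b
  have 1: "X (Y (a \<otimes>\<^bsub>A\<^esub> b)) =
      sgnmul A (q * r) (sgnmul A (p * r) (a \<otimes>\<^bsub>A\<^esub> X (Y b)) \<oplus>\<^bsub>A\<^esub> X a \<otimes>\<^bsub>A\<^esub> Y b) \<oplus>\<^bsub>A\<^esub>
      (sgnmul A (p * (q + r)) (Y a \<otimes>\<^bsub>A\<^esub> X b) \<oplus>\<^bsub>A\<^esub> X (Y a) \<otimes>\<^bsub>A\<^esub> b)"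
    by (simp add: Y(3)[OF a b] linear_map_add[OF X(1)] linear_map_sgn[OF X(1) module module]
        X(3)[OF a] X(3)[OF Y(2)[OF a]])
  have 2: "Y (X (a \<otimes>\<^bsub>A\<^esub> b)) =
      sgnmul A (p * r) (sgnmul A (q * r) (a \<otimes>\<^bsub>A\<^esub> Y (X b)) \<oplus>\<^bsub>A\<^esub> Y a \<otimes>\<^bsub>A\<^esub> X b) \<oplus>\<^bsub>A\<^esub>
      (sgnmul A (q * (p + r)) (X a \<otimes>\<^bsub>A\<^esub> Y b) \<oplus>\<^bsub>A\<^esub> Y (X a) \<otimes>\<^bsub>A\<^esub> b)"
    by (simp add: X(3)[OF a b] linear_map_add[OF Y(1)] linear_map_sgn[OF Y(1) module module]
        Y(3)[OF a] Y(3)[OF X(2)[OF a]])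
  show ?thesis
    unfolding C_def 1 2
    by (cases p; cases q; cases r; simp add: sgnmul_def l_distr r_distr l_minus r_minus M.cancel)
qed

locale symplectic = tensor K L + cocycle K L \<sigma>
  for K :: "('k, 'm) ring_scheme" and L :: "('k, 'v, 'n) bsuper_scheme" and \<sigma> :: "'v \<Rightarrow> 'v \<Rightarrow> 'k"
begin

sublocale S: supercommutative_superalgebra K S by (rule S_supercommutative)

lemma Lbr: "bilinear2 K L L L (bracket L)"
  using bracket_bilinear by (simp add: bilinear_map_iff)

lemma \<sigma>b: "bilinear2 K L L (self_module K) \<sigma>"
  using cocycle_bilinear by (simp add: bilinear_map_iff)

lemma self_module_simps:
  "carrier (self_module K) = carrier K" "zero (self_module K) = zero K" "add (self_module K) = add K"
  "smult (self_module K) = mult K"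
  by (simp_all add: self_module_def)

lemma K_group: "abelian_group K"
  using field_axioms by (simp add: field_def domain_def cring_def ring_def)

lemma self_module: "module K (self_module K)"
  by (rule moduleI)
    (auto simp: self_module_simps is_cring l_distr r_distr m_assoc
      intro!: abelian_group_transfer[OF K_group])

text \<open>The prescribed Poisson bracket of two generators.\<close>

definition "gen_bracket x y = s \<lbrace>x, y\<rbrace>\<^bsub>L\<^esub> \<oplus>\<^bsub>S\<^esub> \<sigma> x y \<odot>\<^bsub>S\<^esub> \<one>\<^bsub>S\<^esub>"

lemmas s_linear = even_linear_linear[OF s_even]
lemmas s_part = even_linear_part[OF s_even]

lemma scalar_linear: "linear_map K (self_module K) S (\<lambda>c. c \<odot>\<^bsub>S\<^esub> \<one>\<^bsub>S\<^esub>)"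
  by (rule linear_mapI) (auto simp: self_module_simps S.smult_l_distr S.smult_assoc1)

lemma gen_bracket_bilinear: "bilinear2 K L L S gen_bracket"
  unfolding gen_bracket_def[abs_def]
proof (intro bilinear2_plus module S.module)
  have i: "linear_map K L L (\<lambda>x. x)" by (simp add: linear_map_def)
  show "bilinear2 K L L S (\<lambda>x y. s \<lbrace>x, y\<rbrace>\<^bsub>L\<^esub>)"
    by (rule bilinear2_comp[OF Lbr i i s_linear])
  show "bilinear2 K L L S (\<lambda>x y. \<sigma> x y \<odot>\<^bsub>S\<^esub> \<one>\<^bsub>S\<^esub>)"
    by (rule bilinear2_comp[OF \<sigma>b i i scalar_linear])
qed

lemma \<sigma>_K: "x \<in> carrier L \<Longrightarrow> y \<in> carrier L \<Longrightarrow> \<sigma> x y \<in> carrier K"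
  using bilinear2_closed[OF \<sigma>b] by (simp add: self_module_simps)

lemma gen_bracket_part: "x \<in> part L p \<Longrightarrow> y \<in> part L q \<Longrightarrow> gen_bracket x y \<in> part S (p + q)"
  unfolding gen_bracket_def using bit_exhaust[of "p + q"] cocycle_even[of x p y q] \<sigma>_K[of x y] S.one_even
  by (intro S.part_add s_part bracket_even) (auto simp: part_closed S.part_smult)

lemma sgn_neg_self: "sgnmul (self_module K) = sgnmul K" "a_inv (self_module K) = a_inv K"
  by (rule a_inv_transfer; simp add: self_module_simps)+

lemma gen_bracket_skew: "x \<in> part L p \<Longrightarrow> y \<in> part L q \<Longrightarrow> gen_bracket x y = \<ominus>\<^bsub>S\<^esub> sgnmul S (p * q) (gen_bracket y x)"
proof -
  assume x: "x \<in> part L p" and y: "y \<in> part L q"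
  note c [simp] = part_closed[OF x] part_closed[OF y]
  note [simp] = bilinear2_closed[OF Lbr] \<sigma>_K linear_map_closed[OF s_linear]
  have 1: "s \<lbrace>x, y\<rbrace>\<^bsub>L\<^esub> = \<ominus>\<^bsub>S\<^esub> sgnmul S (p * q) (s \<lbrace>y, x\<rbrace>\<^bsub>L\<^esub>)"
    unfolding bracket_skew[OF x y]
    by (simp add: linear_map_neg[OF s_linear module S.module] linear_map_sgn[OF s_linear module S.module])
  have 2: "\<sigma> x y \<odot>\<^bsub>S\<^esub> \<one>\<^bsub>S\<^esub> = \<ominus>\<^bsub>S\<^esub> sgnmul S (p * q) (\<sigma> y x \<odot>\<^bsub>S\<^esub> \<one>\<^bsub>S\<^esub>)"
    unfolding cocycle_skew[OF x y] by (simp add: sgnmul_def S.smult_l_minus)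
  show ?thesis
    unfolding gen_bracket_def 1 2 by (simp add: S.sgnmul_add S.M.minus_add S.M.a_comm)
qed

text \<open>
  The Jacobi identity of \<open>L\<close> and the cocycle identity of \<open>\<sigma>\<close>, rearranged by skew-symmetry into
  \<open>[x, [y, z]] - (-1)\<^bsup>|x||y|\<^esup> [y, [x, z]] = [[x, y], z]\<close> and its analogue for \<open>\<sigma>\<close>, are the two components of this identity.
\<close>

lemma gen_bracket_jacobi:
  assumes x: "x \<in> part L p" and y: "y \<in> part L q" and z: "z \<in> part L r"
  shows "gen_bracket x \<lbrace>y, z\<rbrace>\<^bsub>L\<^esub> \<ominus>\<^bsub>S\<^esub> sgnmul S (p * q) (gen_bracket y \<lbrace>x, z\<rbrace>\<^bsub>L\<^esub>) = gen_bracket \<lbrace>x, y\<rbrace>\<^bsub>L\<^esub> z"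
proof -
  note c [simp] = part_closed[OF x] part_closed[OF y] part_closed[OF z]
  note [simp] = bilinear2_closed[OF Lbr] \<sigma>_K linear_map_closed[OF s_linear]
  note Lsimps = bilinear2_sgn_left[OF Lbr module module module] bilinear2_sgn_right[OF Lbr module module module]
    bilinear2_neg_left[OF Lbr module module module] bilinear2_neg_right[OF Lbr module module module]
  note \<sigma>simps = bilinear2_sgn_left[OF \<sigma>b module module self_module, unfolded sgn_neg_self]
    bilinear2_neg_left[OF \<sigma>b module module self_module, unfolded sgn_neg_self]
  let ?xyz = "\<lbrace>x, \<lbrace>y, z\<rbrace>\<^bsub>L\<^esub>\<rbrace>\<^bsub>L\<^esub>" and ?yxz = "\<lbrace>y, \<lbrace>x, z\<rbrace>\<^bsub>L\<^esub>\<rbrace>\<^bsub>L\<^esub>" and ?xy_z = "\<lbrace>\<lbrace>x, y\<rbrace>\<^bsub>L\<^esub>, z\<rbrace>\<^bsub>L\<^esub>"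
  have "?xyz \<oplus>\<^bsub>L\<^esub> sgnmul L (p * (q + r)) (\<ominus>\<^bsub>L\<^esub> sgnmul L (r * p) ?yxz) \<oplus>\<^bsub>L\<^esub>
      sgnmul L (r * (p + q)) (\<ominus>\<^bsub>L\<^esub> sgnmul L (r * (p + q)) ?xy_z) = \<zero>\<^bsub>L\<^esub>"
    using bracket_jacobi[OF x y z] bracket_skew[OF z x] bracket_skew[OF z bracket_even[OF x y]]
    by (simp add: Lsimps)
  then have "(?xyz \<ominus>\<^bsub>L\<^esub> sgnmul L (p * q) ?yxz) \<ominus>\<^bsub>L\<^esub> ?xy_z = \<zero>\<^bsub>L\<^esub>"
    by (cases p; cases q; cases r; simp add: sgnmul_def M.minus_eq)
  then have 1: "?xyz \<ominus>\<^bsub>L\<^esub> sgnmul L (p * q) ?yxz = ?xy_z"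
    by (simp add: M.minus_zero_iff)
  have "\<sigma> \<lbrace>x, y\<rbrace>\<^bsub>L\<^esub> z \<oplus>\<^bsub>K\<^esub>
      sgnmul K (r * (p + q)) (\<ominus>\<^bsub>K\<^esub> sgnmul K (r * p) (\<ominus>\<^bsub>K\<^esub> sgnmul K ((p + r) * q) (\<sigma> y \<lbrace>x, z\<rbrace>\<^bsub>L\<^esub>))) \<oplus>\<^bsub>K\<^esub>
      sgnmul K (p * (q + r)) (\<ominus>\<^bsub>K\<^esub> sgnmul K ((q + r) * p) (\<sigma> x \<lbrace>y, z\<rbrace>\<^bsub>L\<^esub>)) = \<zero>\<^bsub>K\<^esub>"
    using cocycle_jacobi[OF x y z] bracket_skew[OF z x]
      cocycle_skew[OF bracket_even[OF x z] y] cocycle_skew[OF bracket_even[OF y z] x]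
    by (simp add: \<sigma>simps)
  then have "\<sigma> \<lbrace>x, y\<rbrace>\<^bsub>L\<^esub> z \<ominus>\<^bsub>K\<^esub> (\<sigma> x \<lbrace>y, z\<rbrace>\<^bsub>L\<^esub> \<ominus>\<^bsub>K\<^esub> sgnmul K (p * q) (\<sigma> y \<lbrace>x, z\<rbrace>\<^bsub>L\<^esub>)) = \<zero>\<^bsub>K\<^esub>"
    by (cases p; cases q; cases r; simp add: sgnmul_def abelian_group.cancel[OF K_group])
  then have 2: "\<sigma> x \<lbrace>y, z\<rbrace>\<^bsub>L\<^esub> \<ominus>\<^bsub>K\<^esub> sgnmul K (p * q) (\<sigma> y \<lbrace>x, z\<rbrace>\<^bsub>L\<^esub>) = \<sigma> \<lbrace>x, y\<rbrace>\<^bsub>L\<^esub> z"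
    by (subst (asm) abelian_group.minus_zero_iff[OF K_group]) (auto simp: sgnmul_def)
  have 3: "\<sigma> \<lbrace>x, y\<rbrace>\<^bsub>L\<^esub> z \<odot>\<^bsub>S\<^esub> \<one>\<^bsub>S\<^esub> = \<sigma> x \<lbrace>y, z\<rbrace>\<^bsub>L\<^esub> \<odot>\<^bsub>S\<^esub> \<one>\<^bsub>S\<^esub> \<ominus>\<^bsub>S\<^esub> sgnmul S (p * q) (\<sigma> y \<lbrace>x, z\<rbrace>\<^bsub>L\<^esub> \<odot>\<^bsub>S\<^esub> \<one>\<^bsub>S\<^esub>)"
    unfolding 2[symmetric] by (simp add: sgnmul_def a_minus_def S.smult_l_distr S.smult_l_minus)
  have 4: "s ?xy_z = s ?xyz \<ominus>\<^bsub>S\<^esub> sgnmul S (p * q) (s ?yxz)"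
    unfolding 1[symmetric]
    by (simp add: linear_map_minus[OF s_linear module S.module] linear_map_sgn[OF s_linear module S.module])
  show ?thesis
    unfolding gen_bracket_def 3 4 by (simp add: S.sgnmul_add S.M.minus_eq S.M.minus_add S.M.a_ac)
qed

end

context symplectic
begin

abbreviation "HL \<equiv> hom_space K L S"
abbreviation "ES \<equiv> end_algebra K S"

text \<open>
  The derivations \<open>{x, \<cdot>}\<close> of \<open>S\<close> for \<open>x \<in> L\<close>, of the parity of \<open>x\<close>. To obtain them for all \<open>x\<close> at once, linearly in
  \<open>x\<close>, and from an even derivation, one extends \<open>y \<mapsto> {y, \<cdot>}\<close> to an even derivation \<open>D\<close> from \<open>S\<close> to \<open>Hom(L, S)\<close>, which
  gives \<open>D(a)(x) = {a, x}\<close>, and exchanges the arguments by skew-symmetry.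
\<close>

lemma generator_derivations:
  obtains E where "bilinear2 K L S S E"
    "\<And>x p a q. x \<in> part L p \<Longrightarrow> a \<in> part S q \<Longrightarrow> E x a \<in> part S (p + q)"
    "\<And>x p y q. x \<in> part L p \<Longrightarrow> y \<in> part L q \<Longrightarrow> E x (s y) = gen_bracket x y"
    "\<And>x p a q b r. x \<in> part L p \<Longrightarrow> a \<in> part S q \<Longrightarrow> b \<in> part S r \<Longrightarrow>
      E x (a \<otimes>\<^bsub>S\<^esub> b) = sgnmul S (p * q) (a \<otimes>\<^bsub>S\<^esub> E x b) \<oplus>\<^bsub>S\<^esub> E x a \<otimes>\<^bsub>S\<^esub> b"
proof -
  interpret H: super_space K HL by (rule hom_super_space[OF super_space_axioms S.super_space_axioms])
  define f where "f y = (\<lambda>x. if x \<in> carrier L then gen_bracket y x else \<zero>\<^bsub>S\<^esub>)" for y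
  have f: "even_linear K L HL f"
  proof (intro even_linearI linear_mapI)
    fix y assume y: "y \<in> carrier L"
    have "linear_map K L S (f y)"
      using bilinear2_right[OF gen_bracket_bilinear y] by (auto simp: f_def linear_map_def)
    then show "f y \<in> carrier HL" by (simp add: hom_space_simps f_def)
  next
    fix x y assume "x \<in> carrier L" "y \<in> carrier L"
    then show "f (x \<oplus>\<^bsub>L\<^esub> y) = f x \<oplus>\<^bsub>HL\<^esub> f y"
      by (auto simp: fun_eq_iff f_def hom_space_simps(4) bilinear2_add_left[OF gen_bracket_bilinear])
  next
    fix c x assume "c \<in> carrier K" "x \<in> carrier L"
    then show "f (c \<odot>\<^bsub>L\<^esub> x) = c \<odot>\<^bsub>HL\<^esub> f x"
      by (auto simp: fun_eq_iff f_def hom_space_simps(5) bilinear2_smult_left[OF gen_bracket_bilinear])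
  next
    fix p y assume y: "y \<in> part L p"
    have "linear_map K L S (f y)"
      using bilinear2_right[OF gen_bracket_bilinear part_closed[OF y]] by (auto simp: f_def linear_map_def)
    then show "f y \<in> part HL p"
      using gen_bracket_part[OF y] by (simp add: hom_space_simps f_def part_closed)
  qed
  obtain D where D: "even_linear K S HL D" "\<And>x. x \<in> carrier L \<Longrightarrow> D (s x) = f x"
    "\<And>p q a b. a \<in> part S p \<Longrightarrow> b \<in> part S q \<Longrightarrow>
      D (a \<otimes>\<^bsub>S\<^esub> b) = (\<lambda>x. a \<otimes>\<^bsub>S\<^esub> D b x) \<oplus>\<^bsub>HL\<^esub> sgnmul HL (p * q) (\<lambda>x. b \<otimes>\<^bsub>S\<^esub> D a x)"
    using derivation_exists[OF S.hom_supermodule[OF super_space_axioms] f] by blast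
  note Dl = even_linear_linear[OF D(1)]
  have DS: "linear_map K L S (D a)" if "a \<in> carrier S" for a
    using linear_map_closed[OF Dl that] by (simp add: hom_space_simps)
  have Db: "bilinear2 K L S S (\<lambda>x a. D a x)"
    using linear_map_add[OF Dl] linear_map_smult[OF Dl] linear_map_closed[OF DS]
    by (intro bilinear2I DS linear_mapI) (auto simp: hom_space_simps(4,5))
  have Dp: "D a x \<in> part S (q + p)" if "a \<in> part S q" "x \<in> part L p" for a x p q
    using even_linear_part[OF D(1) that(1)] that(2) by (simp add: hom_space_simps)
  have Dm: "D (a \<otimes>\<^bsub>S\<^esub> b) x = a \<otimes>\<^bsub>S\<^esub> D b x \<oplus>\<^bsub>S\<^esub> sgnmul S (q * r) (b \<otimes>\<^bsub>S\<^esub> D a x)"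
    if a: "a \<in> part S q" and b: "b \<in> part S r" and x: "x \<in> carrier L" for a b q r x
  proof -
    interpret HM: supermodule K S HL "\<lambda>a f x. a \<otimes>\<^bsub>S\<^esub> f x"
      by (rule S.hom_supermodule[OF super_space_axioms])
    have "(\<lambda>x. b \<otimes>\<^bsub>S\<^esub> D a x) \<in> carrier HL"
      using HM.act_closed[OF S.part_closed[OF b] linear_map_closed[OF Dl S.part_closed[OF a]]] .
    then have "sgnmul HL (q * r) (\<lambda>x. b \<otimes>\<^bsub>S\<^esub> D a x) x = sgnmul S (q * r) (b \<otimes>\<^bsub>S\<^esub> D a x)"
      by (simp add: sgnmul_def hom_space_neg[OF super_space_axioms S.super_space_axioms])
    then show ?thesis by (simp add: D(3)[OF a b] hom_space_simps(4))
  qed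
  have sb: "bilinear2 K L S S (\<lambda>x a. \<ominus>\<^bsub>S\<^esub> sgnmul S (p * q) (D a x))" for p q
    by (intro bilinear2_uminus bilinear2_sgnmul module S.module Db)
  define E where "E = homog_ext L S S (\<lambda>p q x a. \<ominus>\<^bsub>S\<^esub> sgnmul S (p * q) (D a x))"
  have E: "bilinear2 K L S S E"
    unfolding E_def by (rule homog_ext_bilinear[OF super_space_axioms S.super_space_axioms S.module sb])
  have Ep: "E x a = \<ominus>\<^bsub>S\<^esub> sgnmul S (p * q) (D a x)" if "x \<in> part L p" "a \<in> part S q" for x a p q
    unfolding E_def by (rule homog_ext_eq[OF super_space_axioms S.super_space_axioms S.module sb that])
  show thesis
  proof (rule that[OF E])
    fix x p a q assume x: "x \<in> part L p" and a: "a \<in> part S q"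
    show "E x a \<in> part S (p + q)"
      using Dp[OF a x] unfolding Ep[OF x a] by (intro S.part_neg S.part_sgnmul) (simp add: add.commute)
    fix b r assume b: "b \<in> part S r"
    note c [simp] = S.part_closed[OF a] S.part_closed[OF b]
    note [simp] = linear_map_closed[OF DS[OF c(1)] part_closed[OF x]] linear_map_closed[OF DS[OF c(2)] part_closed[OF x]]
    have "E x (a \<otimes>\<^bsub>S\<^esub> b) = \<ominus>\<^bsub>S\<^esub> sgnmul S (p * (q + r)) (a \<otimes>\<^bsub>S\<^esub> D b x \<oplus>\<^bsub>S\<^esub> sgnmul S (q * r) (b \<otimes>\<^bsub>S\<^esub> D a x))"
      by (simp add: Ep[OF x S.part_mult[OF a b]] Dm[OF a b part_closed[OF x]])
    also have "\<dots> = sgnmul S (p * q) (a \<otimes>\<^bsub>S\<^esub> (\<ominus>\<^bsub>S\<^esub> sgnmul S (p * r) (D b x))) \<oplus>\<^bsub>S\<^esub>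
        \<ominus>\<^bsub>S\<^esub> sgnmul S (p * q) (sgnmul S ((q + p) * r) (b \<otimes>\<^bsub>S\<^esub> D a x))"
      by (cases p; cases q; cases r; simp add: sgnmul_def S.r_minus S.M.cancel)
    also have "\<dots> = sgnmul S (p * q) (a \<otimes>\<^bsub>S\<^esub> E x b) \<oplus>\<^bsub>S\<^esub> E x a \<otimes>\<^bsub>S\<^esub> b"
      unfolding S.super_comm[OF Dp[OF a x] b, symmetric] Ep[OF x a] Ep[OF x b]
      by (simp add: S.l_minus S.sgn_left)
    finally show "E x (a \<otimes>\<^bsub>S\<^esub> b) = sgnmul S (p * q) (a \<otimes>\<^bsub>S\<^esub> E x b) \<oplus>\<^bsub>S\<^esub> E x a \<otimes>\<^bsub>S\<^esub> b" .
  next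
    fix x p y q assume x: "x \<in> part L p" and y: "y \<in> part L q"
    show "E x (s y) = gen_bracket x y"
      using part_closed[OF x] part_closed[OF y]
      by (simp add: Ep[OF x s_part[OF y]] D(2) f_def gen_bracket_skew[OF x y])
  qed
qed

text \<open>
  The map \<open>h : S \<rightarrow> End(S)\<close> below is the derivation with \<open>h(x) = {x, \<cdot>}\<close> on generators, and \<open>{a, b} = h(a)(b)\<close>. It is a derivation in
  \<open>a\<close> by construction. It is one in \<open>b\<close>, because this holds for generators \<open>a\<close> and is inherited by products.
  Skew-symmetry holds on generators and extends in each argument by the two Leibniz rules. The Jacobi identity
  is the relation \<open>h{a, b} = [h(a), h(b)]\<close>, to which \<open>\<beta>_br\<close> applies for the algebra \<open>End(S)\<close>: on generators, both
  sides are derivations of \<open>S\<close>, and they agree on \<open>L\<close> by the Jacobi and cocycle identities.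
\<close>

lemma bracket_exists:
  "\<exists>b. poisson_superalgebra K (with_bracket S b) \<and> (\<forall>x\<in>carrier L. \<forall>y\<in>carrier L. b (s x) (s y) = gen_bracket x y)"
proof -
  obtain E where E: "bilinear2 K L S S E"
    and E_part: "\<And>x p a q. x \<in> part L p \<Longrightarrow> a \<in> part S q \<Longrightarrow> E x a \<in> part S (p + q)"
    and E_gen: "\<And>x p y q. x \<in> part L p \<Longrightarrow> y \<in> part L q \<Longrightarrow> E x (s y) = gen_bracket x y"
    and E_mult: "\<And>x p a q b r. x \<in> part L p \<Longrightarrow> a \<in> part S q \<Longrightarrow> b \<in> part S r \<Longrightarrow>
      E x (a \<otimes>\<^bsub>S\<^esub> b) = sgnmul S (p * q) (a \<otimes>\<^bsub>S\<^esub> E x b) \<oplus>\<^bsub>S\<^esub> E x a \<otimes>\<^bsub>S\<^esub> b"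
    using generator_derivations by blast
  interpret A: superalgebra K ES by (rule end_superalgebra[OF S.super_space_axioms])
  note e = end_algebra_simps hom_space_simps
  define E1 where "E1 x = (\<lambda>a. if a \<in> carrier S then E x a else \<zero>\<^bsub>S\<^esub>)" for x
  have E1l: "linear_map K S S (E1 x)" if "x \<in> carrier L" for x
    using bilinear2_right[OF E that] by (auto simp: E1_def linear_map_def)
  have E1: "even_linear K L ES E1"
  proof (intro even_linearI linear_mapI)
    show "E1 x \<in> carrier ES" if "x \<in> carrier L" for x using E1l[OF that] by (simp add: e E1_def)
    show "E1 (x \<oplus>\<^bsub>L\<^esub> y) = E1 x \<oplus>\<^bsub>ES\<^esub> E1 y" if "x \<in> carrier L" "y \<in> carrier L" for x y
      using that by (auto simp: fun_eq_iff E1_def e(4) hom_space_simps(4) bilinear2_add_left[OF E])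
    show "E1 (c \<odot>\<^bsub>L\<^esub> x) = c \<odot>\<^bsub>ES\<^esub> E1 x" if "c \<in> carrier K" "x \<in> carrier L" for c x
      using that by (auto simp: fun_eq_iff E1_def e(5) hom_space_simps(5) bilinear2_smult_left[OF E])
    show "E1 x \<in> part ES p" if x: "x \<in> part L p" for p x
      using E1l[OF part_closed[OF x]] E_part[OF x] by (simp add: e E1_def S.part_closed)
  qed
  obtain h where h: "even_linear K S ES h" "\<And>x. x \<in> carrier L \<Longrightarrow> h (s x) = E1 x"
    and h_mult: "\<And>p q a b. a \<in> part S p \<Longrightarrow> b \<in> part S q \<Longrightarrow>
      h (a \<otimes>\<^bsub>S\<^esub> b) = (\<lambda>x. a \<otimes>\<^bsub>S\<^esub> h b x) \<oplus>\<^bsub>ES\<^esub> sgnmul ES (p * q) (\<lambda>x. b \<otimes>\<^bsub>S\<^esub> h a x)"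
    using derivation_exists[OF S.end_supermodule E1] by blast
  note hl = even_linear_linear[OF h(1)]
  have hS: "linear_map K S S (h a)" if "a \<in> carrier S" for a
    using linear_map_closed[OF hl that] by (simp add: e)
  have h0: "h a x = \<zero>\<^bsub>S\<^esub>" if "a \<in> carrier S" "x \<notin> carrier S" for a x
    using linear_map_closed[OF hl that(1)] that(2) by (simp add: e)
  have neg: "\<ominus>\<^bsub>ES\<^esub> f = (\<lambda>x. \<ominus>\<^bsub>S\<^esub> f x)" if "f \<in> carrier ES" for f
    using hom_space_neg[OF S.super_space_axioms S.super_space_axioms, of f] that
      a_inv_transfer[of ES "hom_space K S S"]
    by (simp add: end_algebra_simps)
  have sgn: "sgnmul ES p f x = sgnmul S p (f x)" if "f \<in> carrier ES" for p f x
    using that by (simp add: sgnmul_def neg)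
  interpret EM: supermodule K S ES "\<lambda>a f x. a \<otimes>\<^bsub>S\<^esub> f x" by (rule S.end_supermodule)
  have hb: "bilinear2 K S S S h"
    using linear_map_add[OF hl] linear_map_smult[OF hl] linear_map_closed[OF hS]
    by (intro bilinear2I hS linear_mapI) (auto simp: end_algebra_simps hom_space_simps(4,5))
  note hc = bilinear2_closed[OF hb]
  have hp: "h a x \<in> part S (p + q)" if "a \<in> part S p" "x \<in> part S q" for a x p q
    using even_linear_part[OF h(1) that(1)] that(2) by (simp add: e)
  have hm: "h (a \<otimes>\<^bsub>S\<^esub> b) x = a \<otimes>\<^bsub>S\<^esub> h b x \<oplus>\<^bsub>S\<^esub> sgnmul S (p * q) (b \<otimes>\<^bsub>S\<^esub> h a x)"
    if a: "a \<in> part S p" and b: "b \<in> part S q" for a b p q x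
    using EM.act_closed[OF S.part_closed[OF b] linear_map_closed[OF hl S.part_closed[OF a]]]
    by (simp add: h_mult[OF a b] end_algebra_simps hom_space_simps(4) sgn)
  have h1: "h \<one>\<^bsub>S\<^esub> x = \<zero>\<^bsub>S\<^esub>" for x
  proof (cases "x \<in> carrier S")
    case True
    then have "h \<one>\<^bsub>S\<^esub> x = h \<one>\<^bsub>S\<^esub> x \<oplus>\<^bsub>S\<^esub> h \<one>\<^bsub>S\<^esub> x" using hm[OF S.one_even S.one_even, of x] hc by simp
    then show ?thesis using hc True by (metis S.M.add.l_cancel_one' S.one_closed)
  qed (simp add: h0)
  note hsimps = bilinear2_add_left[OF hb] bilinear2_add_right[OF hb]
    bilinear2_smult_left[OF hb] bilinear2_smult_right[OF hb]
    bilinear2_zero_left[OF hb S.module S.module S.module] bilinear2_zero_right[OF hb S.module S.module S.module]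
  have hgen: "h (s x) (s y) = gen_bracket x y" if "x \<in> part L p" "y \<in> part L q" for x y p q
    using that E_gen linear_map_closed[OF s_linear] by (simp add: h(2) E1_def part_closed)
  have leib: "h a (b \<otimes>\<^bsub>S\<^esub> c) = sgnmul S (p * q) (b \<otimes>\<^bsub>S\<^esub> h a c) \<oplus>\<^bsub>S\<^esub> h a b \<otimes>\<^bsub>S\<^esub> c"
    if a: "a \<in> part S p" and b: "b \<in> part S q" and c: "c \<in> part S r" for a b c p q r
    using S_generated a
  proof (induction rule: graded_generatedD)
    note cl [simp] = S.part_closed[OF b] S.part_closed[OF c]
    { case zero then show ?case by (simp add: hsimps) }
    { case one then show ?case by (simp add: h1) }
    { case (gen p x)
      then show ?case using E_mult[OF gen b c] by (simp add: h(2) E1_def part_closed) }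
    { case add then show ?case
        by (simp add: hsimps S.part_closed hc S.l_distr S.r_distr S.sgnmul_add S.M.a_ac) }
    { case smult then show ?case
        by (simp add: hsimps S.part_closed hc S.smult_mult_left S.smult_mult_right S.sgnmul_smult S.smult_r_distr) }
    case (mult p p' a a')
    note cl' [simp] = mult(1,2)[THEN S.part_closed]
    note [simp] = hc[OF cl'(1) cl(1)] hc[OF cl'(1) cl(2)] hc[OF cl'(2) cl(1)] hc[OF cl'(2) cl(2)]
    have 1: "a \<otimes>\<^bsub>S\<^esub> (b \<otimes>\<^bsub>S\<^esub> h a' c) = sgnmul S (p * q) (b \<otimes>\<^bsub>S\<^esub> (a \<otimes>\<^bsub>S\<^esub> h a' c))"
      using S.super_comm[OF mult(1) b] by (simp add: S.sgn_left flip: S.m_assoc)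
    have 2: "a' \<otimes>\<^bsub>S\<^esub> (b \<otimes>\<^bsub>S\<^esub> h a c) = sgnmul S (p' * q) (b \<otimes>\<^bsub>S\<^esub> (a' \<otimes>\<^bsub>S\<^esub> h a c))"
      using S.super_comm[OF mult(2) b] by (simp add: S.sgn_left flip: S.m_assoc)
    show ?case
      unfolding hm[OF mult(1,2)] mult(3,4)
      by (simp add: S.r_distr S.l_distr S.sgn_right S.sgn_left S.sgnmul_add 1 2 S.m_assoc S.M.a_ac algebra_simps)
  qed
  have hone: "h a \<one>\<^bsub>S\<^esub> = \<zero>\<^bsub>S\<^esub>" if a: "a \<in> part S p" for a p
  proof -
    have "h a \<one>\<^bsub>S\<^esub> = h a \<one>\<^bsub>S\<^esub> \<oplus>\<^bsub>S\<^esub> h a \<one>\<^bsub>S\<^esub>"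
      using leib[OF a S.one_even S.one_even] hc[of a "\<one>\<^bsub>S\<^esub>"] a by (simp add: S.part_closed)
    then show ?thesis using hc[of a "\<one>\<^bsub>S\<^esub>"] S.part_closed[OF a] by (metis S.M.add.l_cancel_one' S.one_closed)
  qed
  let ?sk = "\<lambda>p q a b. h a b = \<ominus>\<^bsub>S\<^esub> sgnmul S (p * q) (h b a)"
  have skew_mult: "?sk p (q + r) a (b \<otimes>\<^bsub>S\<^esub> c)"
    if a: "a \<in> part S p" and b: "b \<in> part S q" and c: "c \<in> part S r"
      and ab: "?sk p q a b" and ac: "?sk p r a c" for a b c p q r
  proof -
    note cl [simp] = S.part_closed[OF a] S.part_closed[OF b] S.part_closed[OF c]
    note [simp] = hc[OF cl(2,1)] hc[OF cl(3,1)]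
    have 1: "h b a \<otimes>\<^bsub>S\<^esub> c = sgnmul S ((q + p) * r) (c \<otimes>\<^bsub>S\<^esub> h b a)"
      by (rule S.super_comm[OF hp[OF b a] c])
    have "h a (b \<otimes>\<^bsub>S\<^esub> c) = sgnmul S (p * q) (b \<otimes>\<^bsub>S\<^esub> (\<ominus>\<^bsub>S\<^esub> sgnmul S (p * r) (h c a))) \<oplus>\<^bsub>S\<^esub>
        \<ominus>\<^bsub>S\<^esub> sgnmul S (p * q) (sgnmul S ((q + p) * r) (c \<otimes>\<^bsub>S\<^esub> h b a))"
      unfolding leib[OF a b c] ab ac by (simp add: S.l_minus S.sgn_left 1)
    also have "\<dots> = \<ominus>\<^bsub>S\<^esub> sgnmul S (p * (q + r)) (h (b \<otimes>\<^bsub>S\<^esub> c) a)"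
      unfolding hm[OF b c] by (cases p; cases q; cases r; simp add: sgnmul_def S.r_minus S.M.cancel)
    finally show ?thesis .
  qed
  have skew_flip: "?sk q p b a" if "?sk p q a b" "a \<in> part S p" "b \<in> part S q" for a b p q
    using that hc[of b a] by (simp add: S.part_closed S.sgnmul_neg mult.commute[of q p])
  have skew_gen: "?sk p q (s x) b" if x: "x \<in> part L p" and b: "b \<in> part S q" for x b p q
    using S_generated b
  proof (induction rule: graded_generatedD)
    note sx = s_part[OF x]
    note [simp] = S.part_closed[OF sx]
    { case zero then show ?case by (simp add: hsimps) }
    { case one then show ?case by (simp add: h1 hone[OF sx]) }
    { case gen then show ?case using hgen[OF x gen] hgen[OF gen x] gen_bracket_skew[OF x gen] by simp }
    { case add then show ?case by (simp add: hsimps S.part_closed hc S.sgnmul_add S.M.minus_add S.M.a_comm) }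
    { case smult then show ?case by (simp add: hsimps S.part_closed hc S.sgnmul_smult S.smult_r_minus) }
    { case mult then show ?case by (intro skew_mult sx) }
  qed
  have skew: "?sk p q a b" if a: "a \<in> part S p" and b: "b \<in> part S q" for a b p q
    using S_generated a
  proof (induction rule: graded_generatedD)
    note [simp] = S.part_closed[OF b]
    { case zero then show ?case by (simp add: hsimps) }
    { case one then show ?case by (simp add: h1 hone[OF b]) }
    { case gen then show ?case by (rule skew_gen[OF _ b]) }
    { case add then show ?case by (simp add: hsimps S.part_closed hc S.sgnmul_add S.M.minus_add S.M.a_comm) }
    { case smult then show ?case by (simp add: hsimps S.part_closed hc S.sgnmul_smult S.smult_r_minus) }
    case (mult p r a c)
    show ?case
      by (rule skew_flip[OF skew_mult[OF b mult(1,2) skew_flip[OF mult(3,1) b] skew_flip[OF mult(4,2) b]]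
            b S.part_mult[OF mult(1,2)]])
  qed
  interpret BD: biderivation K S h
    by unfold_locales (fact hb hp skew leib)+
  \<comment> \<open>property P is now extended from generators for \<open>m : S \<rightarrow> End(S)\<close>, the multiplication operators, and \<open>h\<close>\<close>
  define m where "m a = (\<lambda>b. if b \<in> carrier S then a \<otimes>\<^bsub>S\<^esub> b else \<zero>\<^bsub>S\<^esub>)" for a
  have ml: "linear_map K S S (m a)" if "a \<in> carrier S" for a
    using bilinear2_right[OF S.mult_bilinear that] by (auto simp: m_def linear_map_def)
  have mc: "m a \<in> carrier ES" if "a \<in> carrier S" for a using ml[OF that] by (simp add: e m_def)
  have m: "super_hom K S ES m"
  proof (rule super_homI)
    show "alg_hom K S ES m"
      unfolding alg_hom_def
    proof (intro conjI linear_mapI ballI mc)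
      show "m (a \<oplus>\<^bsub>S\<^esub> b) = m a \<oplus>\<^bsub>ES\<^esub> m b" if "a \<in> carrier S" "b \<in> carrier S" for a b
        using that by (auto simp: fun_eq_iff m_def end_algebra_simps hom_space_simps(4) S.l_distr)
      show "m (c \<odot>\<^bsub>S\<^esub> a) = c \<odot>\<^bsub>ES\<^esub> m a" if "c \<in> carrier K" "a \<in> carrier S" for c a
        using that by (auto simp: fun_eq_iff m_def end_algebra_simps hom_space_simps(5) S.smult_mult_left)
      show "m (a \<otimes>\<^bsub>S\<^esub> b) = m a \<otimes>\<^bsub>ES\<^esub> m b" if "a \<in> carrier S" "b \<in> carrier S" for a b
        using that by (auto simp: fun_eq_iff m_def end_algebra_simps S.m_assoc)
      show "m \<one>\<^bsub>S\<^esub> = \<one>\<^bsub>ES\<^esub>" by (auto simp: fun_eq_iff m_def end_algebra_simps)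
    qed
    show "m a \<in> part ES p" if a: "a \<in> part S p" for a p
      using ml[OF S.part_closed[OF a]] S.part_mult[OF a] by (simp add: e m_def S.part_closed)
  qed
  have act_m: "(\<lambda>x. a \<otimes>\<^bsub>S\<^esub> f x) = m a \<otimes>\<^bsub>ES\<^esub> f" if "f \<in> carrier ES" "a \<in> carrier S" for a f
  proof -
    have "f x \<in> carrier S" for x
      using that linear_map_closed[of K S S f] by (cases "x \<in> carrier S") (auto simp: e)
    then show ?thesis by (auto simp: fun_eq_iff m_def end_algebra_simps(6))
  qed
  have hd: "even_superderivation K S ES m h"
    unfolding even_superderivation_def
  proof (intro conjI allI ballI h(1))
    fix p q a b assume a: "a \<in> part S p" and b: "b \<in> part S q"
    show "h (a \<otimes>\<^bsub>S\<^esub> b) = m a \<otimes>\<^bsub>ES\<^esub> h b \<oplus>\<^bsub>ES\<^esub> sgnmul ES (p * q) (m b \<otimes>\<^bsub>ES\<^esub> h a)"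
      using S.part_closed[OF a] S.part_closed[OF b]
      by (simp add: h_mult[OF a b] act_m linear_map_closed[OF hl])
  qed
  have scomm_val: "A.scomm p q f g x = f (g x) \<ominus>\<^bsub>S\<^esub> sgnmul S (p * q) (g (f x))"
    if "f \<in> carrier ES" "g \<in> carrier ES" for p q f g x
    using that A.m_closed[of f g] A.m_closed[of g f]
    by (simp add: A.scomm_def a_minus_def neg sgn end_algebra_simps(4) hom_space_simps(4)) (simp add: end_algebra_simps(6))
  have m_gen: "m (h (s x) (s y)) = A.scomm p q (h (s x)) (m (s y))"
    if x: "x \<in> part L p" and y: "y \<in> part L q" for x y p q
  proof
    note sx = s_part[OF x] and sy = s_part[OF y]
    note [simp] = S.part_closed[OF sx] S.part_closed[OF sy] hc
    have hx: "h (s x) \<in> carrier ES" "m (s y) \<in> carrier ES"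
      by (simp_all add: mc linear_map_closed[OF hl])
    fix c
    show "m (h (s x) (s y)) c = A.scomm p q (h (s x)) (m (s y)) c"
    proof (cases "c \<in> carrier S")
      case True
      have "linear_map K S S (\<lambda>c. h (s x) (s y \<otimes>\<^bsub>S\<^esub> c))"
        by (rule linear_map_comp[OF bilinear2_right[OF S.mult_bilinear] hS]) simp_all
      moreover have "linear_map K S S (\<lambda>c. sgnmul S (p * q) (s y \<otimes>\<^bsub>S\<^esub> h (s x) c) \<oplus>\<^bsub>S\<^esub> h (s x) (s y) \<otimes>\<^bsub>S\<^esub> c)"
        by (intro linear_map_plus linear_map_sgnmul S.module linear_map_comp[OF hS bilinear2_right[OF S.mult_bilinear]]
            bilinear2_right[OF S.mult_bilinear]) simp_all
      ultimately have "h (s x) (s y \<otimes>\<^bsub>S\<^esub> c) = sgnmul S (p * q) (s y \<otimes>\<^bsub>S\<^esub> h (s x) c) \<oplus>\<^bsub>S\<^esub> h (s x) (s y) \<otimes>\<^bsub>S\<^esub> c"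
        using leib[OF sx sy] True by (rule S.linear_map_ext)
      then show ?thesis using True hx by (simp add: scomm_val m_def S.M.cancel)
    next
      case False
      then show ?thesis using hx by (simp add: scomm_val m_def h0 hsimps S.M.cancel)
    qed
  qed
  \<comment> \<open>on generators both sides are derivations of \<open>S\<close>; \<open>?C\<close> is the commutator of the operators of \<open>x\<close> and \<open>y\<close>\<close>
  have h_gen: "h (h (s x) (s y)) = A.scomm p q (h (s x)) (h (s y))"
    if x: "x \<in> part L p" and y: "y \<in> part L q" for x y p q
  proof
    note sx = s_part[OF x] and sy = s_part[OF y]
    note c [simp] = part_closed[OF x] part_closed[OF y] bilinear2_closed[OF Lbr part_closed[OF x] part_closed[OF y]]
      \<sigma>_K[OF part_closed[OF x] part_closed[OF y]]
    note [simp] = S.part_closed[OF sx] S.part_closed[OF sy] hc linear_map_closed[OF s_linear]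
    note xy = bracket_even[OF x y]
    have hx: "h (s x) \<in> carrier ES" "h (s y) \<in> carrier ES"
      by (simp_all add: linear_map_closed[OF hl])
    have l: "h (gen_bracket x y) c = h (s \<lbrace>x, y\<rbrace>\<^bsub>L\<^esub>) c" if "c \<in> carrier S" for c
      using that by (simp add: gen_bracket_def hsimps h1)
    let ?C = "\<lambda>c. h (s x) (h (s y) c) \<ominus>\<^bsub>S\<^esub> sgnmul S (p * q) (h (s y) (h (s x) c))"
    have Cl: "linear_map K S S ?C"
      unfolding a_minus_def
      by (intro linear_map_plus linear_map_uminus linear_map_sgnmul S.module linear_map_comp[OF hS hS]) simp_all
    have val: "h (s \<lbrace>x, y\<rbrace>\<^bsub>L\<^esub>) c = ?C c" if "c \<in> part S r" for c r
      using S_generated that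
    proof (induction rule: graded_generatedD)
      note [simp] = S.part_closed
      { case zero then show ?case by (simp add: hsimps S.M.cancel) }
      { case one then show ?case
          by (simp add: hone[OF sx] hone[OF sy] hone[OF s_part[OF xy]] hsimps S.M.cancel) }
      { case (gen r z)
        have 1: "h (s u) (gen_bracket v w) = gen_bracket u \<lbrace>v, w\<rbrace>\<^bsub>L\<^esub>"
          if u: "u \<in> part L pu" and v: "v \<in> part L pv" and w: "w \<in> part L pw" for u v w pu pv pw
          using hgen[OF u bracket_even[OF v w]] hone[OF s_part[OF u]] S.part_closed[OF s_part[OF u]]
            \<sigma>_K[OF part_closed[OF v] part_closed[OF w]] S.part_closed[OF s_part[OF bracket_even[OF v w]]]
            S.part_closed[OF gen_bracket_part[OF u bracket_even[OF v w]]]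
          by (simp add: gen_bracket_def[of v w] hsimps)
        show ?case
          by (simp add: hgen[OF x gen] hgen[OF y gen] hgen[OF xy gen] 1[OF x y gen] 1[OF y x gen] gen_bracket_jacobi[OF x y gen]) }
      { case (add r a b)
        then show ?case using linear_map_add[OF Cl, of a b] by (simp add: hsimps) }
      { case (smult r k a)
        then show ?case using linear_map_smult[OF Cl, of k a] by (simp add: hsimps) }
      case (mult r r' a b)
      have d: "h (s u) (a \<otimes>\<^bsub>S\<^esub> b) = sgnmul S (pu * ra) (a \<otimes>\<^bsub>S\<^esub> h (s u) b) \<oplus>\<^bsub>S\<^esub> h (s u) a \<otimes>\<^bsub>S\<^esub> b"
        if u: "u \<in> part L pu" and a: "a \<in> part S ra" and b: "b \<in> carrier S" for u a b pu ra
      proof (rule S.linear_map_ext[OF _ _ _ b])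
        note [simp] = S.part_closed[OF s_part[OF u]] S.part_closed[OF a]
        show "linear_map K S S (\<lambda>b. h (s u) (a \<otimes>\<^bsub>S\<^esub> b))"
          by (rule linear_map_comp[OF bilinear2_right[OF S.mult_bilinear] hS]) simp_all
        show "linear_map K S S (\<lambda>b. sgnmul S (pu * ra) (a \<otimes>\<^bsub>S\<^esub> h (s u) b) \<oplus>\<^bsub>S\<^esub> h (s u) a \<otimes>\<^bsub>S\<^esub> b)"
          by (intro linear_map_plus linear_map_sgnmul S.module linear_map_comp[OF hS bilinear2_right[OF S.mult_bilinear]]
              bilinear2_right[OF S.mult_bilinear]) simp_all
      qed (rule leib[OF s_part[OF u] a])
      have "?C (a \<otimes>\<^bsub>S\<^esub> b) = sgnmul S ((p + q) * r) (a \<otimes>\<^bsub>S\<^esub> ?C b) \<oplus>\<^bsub>S\<^esub> ?C a \<otimes>\<^bsub>S\<^esub> b"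
        using hS[OF S.part_closed[OF sx]] hp[OF sx] d[OF x] hS[OF S.part_closed[OF sy]] hp[OF sy] d[OF y]
          mult(1) S.part_closed[OF mult(2)]
        by (rule S.derivation_commutator)
      then show ?case
        using mult(3,4) d[OF xy mult(1) S.part_closed[OF mult(2)]] by simp
    qed
    fix c
    show "h (h (s x) (s y)) c = A.scomm p q (h (s x)) (h (s y)) c"
    proof (cases "c \<in> carrier S")
      case True
      have "h (s \<lbrace>x, y\<rbrace>\<^bsub>L\<^esub>) c = ?C c"
        by (rule S.linear_map_ext[OF hS Cl val True]) simp_all
      then show ?thesis using hx True by (simp add: scomm_val hgen[OF x y] l)
    next
      case False
      then show ?thesis using hx by (simp add: scomm_val h0 hsimps S.M.cancel)
    qed
  qed
  have jac: "h (h a b) c = h a (h b c) \<ominus>\<^bsub>S\<^esub> sgnmul S (p * q) (h b (h a c))"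
    if a: "a \<in> part S p" and b: "b \<in> part S q" for a b c p q
    using BD.\<beta>_br[OF S_generated s_part A.superalgebra_axioms m hd m_gen h_gen a b]
      scomm_val[of "h a" "h b"] linear_map_closed[OF hl] a b
    by (simp add: S.part_closed)
  let ?P = "with_bracket S h"
  have P: "carrier ?P = carrier S" "zero ?P = zero S" "add ?P = add S" "smult ?P = smult S"
    "part ?P = part S" "mult ?P = mult S" "one ?P = one S" "bracket ?P = h"
    by (simp_all add: with_bracket_def)
  note Ps = a_inv_transfer[OF P(1-3)]
  interpret PA: superalgebra K ?P by (rule superalgebra_transfer[OF S.superalgebra_axioms P(1-7)])
  have "poisson_superalgebra K ?P"
  proof (unfold_locales, unfold P Ps)
    show "bilinear_map K ?P ?P h"
      using hb by (simp add: bilinear_map_iff bilinear2_def linear_map_def P)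
  next
    fix x y z p q r assume x: "x \<in> part S p" and y: "y \<in> part S q" and z: "z \<in> part S r"
    note c [simp] = S.part_closed[OF x] S.part_closed[OF y] S.part_closed[OF z]
    note [simp] = hc
    note hs = BD.br_simps
    have 1: "h y (h z x) = \<ominus>\<^bsub>S\<^esub> sgnmul S (r * p) (h y (h x z))"
      unfolding skew[OF z x] by (simp add: hs)
    have 2: "h z (h x y) = \<ominus>\<^bsub>S\<^esub> sgnmul S (r * (p + q)) (h x (h y z) \<ominus>\<^bsub>S\<^esub> sgnmul S (p * q) (h y (h x z)))"
      unfolding skew[OF z hp[OF x y]] jac[OF x y] ..
    show "h x (h y z) \<oplus>\<^bsub>S\<^esub> sgnmul S (p * (q + r)) (h y (h z x)) \<oplus>\<^bsub>S\<^esub> sgnmul S (r * (p + q)) (h z (h x y)) = \<zero>\<^bsub>S\<^esub>"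
      unfolding 1 2 by (cases p; cases q; cases r; simp add: sgnmul_def S.M.cancel)
  qed (fact S.super_comm hp skew leib)+
  moreover have "h (s x) (s y) = gen_bracket x y" if "x \<in> carrier L" "y \<in> carrier L" for x y
    by (rule bilinear2_ext[OF super_space_axioms super_space_axioms _ gen_bracket_bilinear hgen that])
      (use hb s_linear in \<open>auto simp: bilinear2_def linear_map_def Pi_iff\<close>)
  ultimately show ?thesis by blast
qed

end

section \<open>The universal enveloping algebra of the Poisson symplectic superalgebra\<close>

lemma alg_hom_unique:
  assumes A: "superalgebra K A" and B: "superalgebra K B" and g: "graded_generated K V A j"
    and f: "alg_hom K A B f" and f': "alg_hom K A B f'"
    and eq: "\<And>p x. x \<in> part V p \<Longrightarrow> f (j x) = f' (j x)" and a: "a \<in> carrier A"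
  shows "f a = f' a"
proof -
  interpret A: superalgebra K A by fact
  interpret B: superalgebra K B by fact
  note l = alg_hom_linear[OF f] and l' = alg_hom_linear[OF f']
  show ?thesis
  proof (rule A.linear_map_ext[OF l l' _ a])
    fix p a assume "a \<in> part A p"
    with g show "f a = f' a"
    proof (induction rule: graded_generatedD)
      case (add p a b)
      then show ?case by (simp add: linear_map_add[OF l] linear_map_add[OF l'] A.part_closed)
    next
      case (smult p c a)
      then show ?case by (simp add: linear_map_smult[OF l] linear_map_smult[OF l'] A.part_closed)
    next
      case (mult p q a b)
      then show ?case by (simp add: alg_hom_mult[OF f] alg_hom_mult[OF f'] A.part_closed)
    qed (simp_all add: eq linear_map_zero[OF l A.module B.module] linear_map_zero[OF l' A.module B.module]
        alg_hom_one[OF f] alg_hom_one[OF f'])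
  qed
qed

text \<open>An \<open>\<alpha>\<close>-superderivation into \<open>B\<close> is a derivation into \<open>B\<close> as a module over \<open>S\<close> through \<open>\<alpha>\<close>.\<close>

lemma algebra_supermodule:
  assumes "supercommutative_superalgebra K S" "superalgebra K B" "super_hom K S B \<alpha>"
  shows "supermodule K S B (\<lambda>a v. \<alpha> a \<otimes>\<^bsub>B\<^esub> v)"
proof -
  interpret S: supercommutative_superalgebra K S by fact
  interpret B: superalgebra K B by fact
  note h = super_hom_alg[OF assms(3)]
  show ?thesis
  proof unfold_locales
    show "bilinear2 K S B B (\<lambda>a v. \<alpha> a \<otimes>\<^bsub>B\<^esub> v)"
      by (intro bilinear2I linear_map_comp[OF alg_hom_linear[OF h] bilinear2_left[OF B.mult_bilinear]]
          bilinear2_right[OF B.mult_bilinear] alg_hom_closed[OF h])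
    show "\<alpha> a \<otimes>\<^bsub>B\<^esub> u \<in> part B (p + q)" if "a \<in> part S p" "u \<in> part B q" for a u p q
      by (rule B.part_mult[OF super_hom_part[OF assms(3) that(1)] that(2)])
  qed (simp_all add: alg_hom_mult[OF h] alg_hom_one[OF h] alg_hom_closed[OF h] B.m_assoc)
qed

context symplectic
begin

abbreviation "R \<equiv> PS K L \<sigma>"
abbreviation "pb \<equiv> PS_bracket K L \<sigma>"

lemma PS_spec: "poisson_superalgebra K R"
  and pb_gen: "x \<in> carrier L \<Longrightarrow> y \<in> carrier L \<Longrightarrow> pb (s x) (s y) = gen_bracket x y"
proof -
  have "\<exists>b. poisson_superalgebra K (with_bracket S b) \<and>
      (\<forall>x\<in>carrier L. \<forall>y\<in>carrier L. b (s x) (s y) = s \<lbrace>x, y\<rbrace>\<^bsub>L\<^esub> \<oplus>\<^bsub>S\<^esub> \<sigma> x y \<odot>\<^bsub>S\<^esub> \<one>\<^bsub>S\<^esub>)"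
    using bracket_exists by (simp add: gen_bracket_def)
  from someI_ex[OF this] have "poisson_superalgebra K (with_bracket S pb) \<and>
      (\<forall>x\<in>carrier L. \<forall>y\<in>carrier L. pb (s x) (s y) = s \<lbrace>x, y\<rbrace>\<^bsub>L\<^esub> \<oplus>\<^bsub>S\<^esub> \<sigma> x y \<odot>\<^bsub>S\<^esub> \<one>\<^bsub>S\<^esub>)"
    unfolding PS_bracket_def Let_def .
  then show "poisson_superalgebra K R" "x \<in> carrier L \<Longrightarrow> y \<in> carrier L \<Longrightarrow> pb (s x) (s y) = gen_bracket x y"
    by (auto simp: PS_def gen_bracket_def)
qed

lemma R_simps: "carrier R = carrier S" "zero R = zero S" "add R = add S" "smult R = smult S"
    "part R = part S" "mult R = mult S" "one R = one S" "bracket R = pb"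
  by (simp_all add: PS_def with_bracket_def)

lemma R_maps:
  "super_hom K R B f \<longleftrightarrow> super_hom K S B f"
  "even_superderivation K R B f g \<longleftrightarrow> even_superderivation K S B f g"
  "even_linear K R B g \<longleftrightarrow> even_linear K S B g"
  by (simp_all add: super_hom_def even_superderivation_def even_linear_def linear_map_def R_simps)

sublocale BD: biderivation K S pb
proof -
  interpret P: poisson_superalgebra K R by (rule PS_spec)
  note r = a_inv_transfer[OF R_simps(1-3)]
  show "biderivation K S pb"
  proof unfold_locales
    show "bilinear2 K S S S pb"
      using P.bracket_bilinear by (simp add: bilinear_map_iff bilinear2_def linear_map_def R_simps)
    show "pb x y \<in> part S (p + q)" if "x \<in> part S p" "y \<in> part S q" for x y p q
      using P.bracket_even[of x p y q] that by (simp add: R_simps)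
    show "pb x y = \<ominus>\<^bsub>S\<^esub> sgnmul S (p * q) (pb y x)" if "x \<in> part S p" "y \<in> part S q" for x y p q
      using P.bracket_skew[of x p y q] that by (simp add: R_simps r)
    show "pb x (y \<otimes>\<^bsub>S\<^esub> z) = sgnmul S (p * q) (y \<otimes>\<^bsub>S\<^esub> pb x z) \<oplus>\<^bsub>S\<^esub> pb x y \<otimes>\<^bsub>S\<^esub> z"
      if "x \<in> part S p" "y \<in> part S q" "z \<in> part S r" for x y z p q r
      using P.leibniz[of x p y q z r] that by (simp add: R_simps r)
  qed
qed

abbreviation "g \<equiv> semidirect_ad L"
abbreviation "\<sigma>g \<equiv> semidirect_cocycle K \<sigma>"

lemma g_simps:
  "carrier g = carrier L \<times> carrier L" "zero g = (\<zero>\<^bsub>L\<^esub>, \<zero>\<^bsub>L\<^esub>)"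
  "(a, b) \<oplus>\<^bsub>g\<^esub> (c, d) = (a \<oplus>\<^bsub>L\<^esub> c, b \<oplus>\<^bsub>L\<^esub> d)" "k \<odot>\<^bsub>g\<^esub> (a, b) = (k \<odot>\<^bsub>L\<^esub> a, k \<odot>\<^bsub>L\<^esub> b)"
  "part g p = part L p \<times> part L p" "\<sigma>g (a, b) (c, d) = \<sigma> a d \<oplus>\<^bsub>K\<^esub> \<sigma> b c"
  by (auto simp: semidirect_ad_def semidirect_cocycle_def)

text \<open>Skew-symmetry of \<open>L\<close> absorbs the sign in the definition of the bracket of \<open>L\<^sup>0 \<oplus> L\<close>.\<close>

lemma g_bracket:
  assumes u: "u \<in> part L p" and x: "x \<in> part L p" and v: "v \<in> part L q" and y: "y \<in> part L q"
  shows "\<lbrace>(u, x), (v, y)\<rbrace>\<^bsub>g\<^esub> = (\<lbrace>x, v\<rbrace>\<^bsub>L\<^esub> \<oplus>\<^bsub>L\<^esub> \<lbrace>u, y\<rbrace>\<^bsub>L\<^esub>, \<lbrace>x, y\<rbrace>\<^bsub>L\<^esub>)"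
proof -
  have b: "bilinear2 K L L L (\<lambda>u y. sgnmul L (p * q) (ad L y u))" for p q
    unfolding ad_def by (rule bilinear2_sgnmul[OF module module module bilinear2_flip[OF Lbr]])
  have "homog_ext L L L (\<lambda>p q u y. sgnmul L (p * q) (ad L y u)) u y = sgnmul L (p * q) \<lbrace>y, u\<rbrace>\<^bsub>L\<^esub>"
    using homog_ext_eq[OF super_space_axioms super_space_axioms module b u y] by (simp add: ad_def)
  then show ?thesis
    by (simp add: semidirect_ad_def ad_def a_minus_def bracket_skew[OF u y])
qed

lemma g_super_space: "super_space K g"
  by (rule super_space_prod[OF super_space_axioms super_space_axioms]) (simp_all add: g_simps)

sublocale G: sridharan_setting K g \<sigma>g
proof -
  interpret g: super_space K g by (rule g_super_space)
  show "sridharan_setting K g \<sigma>g"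
  proof unfold_locales
    show "\<one>\<^bsub>K\<^esub> \<oplus>\<^bsub>K\<^esub> \<one>\<^bsub>K\<^esub> \<noteq> \<zero>\<^bsub>K\<^esub>" by (rule two)
    fix a p b q assume a: "a \<in> part g p" and b: "b \<in> part g q"
    then obtain u x v y where ab: "a = (u, x)" "b = (v, y)"
      and m: "u \<in> part L p" "x \<in> part L p" "v \<in> part L q" "y \<in> part L q"
      by (auto simp: g_simps)
    show "\<lbrace>a, b\<rbrace>\<^bsub>g\<^esub> \<in> part g (p + q)"
      unfolding ab g_bracket[OF m]
      using bracket_even[OF m(2,3)] bracket_even[OF m(1,4)] bracket_even[OF m(2,4)]
      by (simp add: g_simps part_add)
    show "\<sigma>g a b \<in> carrier K"
      using m[THEN part_closed] by (simp add: ab g_simps \<sigma>_K)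
    show "\<sigma>g a b = \<zero>\<^bsub>K\<^esub>" if "p + q = 1"
      using cocycle_even[OF m(2,3) that] cocycle_even[OF m(1,4) that] by (simp add: ab g_simps)
  qed
qed

sublocale U: superalgebra K G.U by (rule G.U_superalgebra)

lemma incl_even: "even_linear K L g (incl0 L)" "even_linear K L g (incl1 L)"
  by (intro even_linearI linear_mapI; simp add: incl0_def incl1_def g_simps part_zero)+

abbreviation "i0 x \<equiv> G.u (incl0 L x)"
abbreviation "i1 x \<equiv> G.u (incl1 L x)"

lemma i0_even: "even_linear K L G.U i0" and i1_even: "even_linear K L G.U i1"
  by (rule even_linear_comp[OF incl_even(1) G.u_even] even_linear_comp[OF incl_even(2) G.u_even])+

lemmas i0_part = even_linear_part[OF i0_even]
lemmas i1_part = even_linear_part[OF i1_even]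

lemma u_split:
  assumes "u \<in> carrier L" "x \<in> carrier L" shows "G.u (u, x) = i0 u \<oplus>\<^bsub>G.U\<^esub> i1 x"
  using linear_map_add[OF even_linear_linear[OF G.u_even], of "incl0 L u" "incl1 L x"] assms
  by (simp add: incl0_def incl1_def g_simps)

lemma br_zero: "x \<in> carrier L \<Longrightarrow> \<lbrace>x, \<zero>\<^bsub>L\<^esub>\<rbrace>\<^bsub>L\<^esub> = \<zero>\<^bsub>L\<^esub>" "x \<in> carrier L \<Longrightarrow> \<lbrace>\<zero>\<^bsub>L\<^esub>, x\<rbrace>\<^bsub>L\<^esub> = \<zero>\<^bsub>L\<^esub>"
    "x \<in> carrier L \<Longrightarrow> \<sigma> x \<zero>\<^bsub>L\<^esub> = \<zero>\<^bsub>K\<^esub>" "x \<in> carrier L \<Longrightarrow> \<sigma> \<zero>\<^bsub>L\<^esub> x = \<zero>\<^bsub>K\<^esub>"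
  using bilinear2_zero_left[OF Lbr module module module] bilinear2_zero_right[OF Lbr module module module]
    bilinear2_zero_left[OF \<sigma>b module module self_module] bilinear2_zero_right[OF \<sigma>b module module self_module]
  by (simp_all add: self_module_simps)

lemma U_rel:
  assumes u: "u \<in> part L p" and x: "x \<in> part L p" and v: "v \<in> part L q" and y: "y \<in> part L q"
  shows "U.scomm p q (G.u (u, x)) (G.u (v, y)) =
    G.u (\<lbrace>x, v\<rbrace>\<^bsub>L\<^esub> \<oplus>\<^bsub>L\<^esub> \<lbrace>u, y\<rbrace>\<^bsub>L\<^esub>, \<lbrace>x, y\<rbrace>\<^bsub>L\<^esub>) \<oplus>\<^bsub>G.U\<^esub> (\<sigma> u y \<oplus>\<^bsub>K\<^esub> \<sigma> x v) \<odot>\<^bsub>G.U\<^esub> \<one>\<^bsub>G.U\<^esub>"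
  using G.u_rel[of "(u, x)" p "(v, y)" q] assms
  by (simp add: U.scomm_def g_simps(5,6) g_bracket[OF u x v y])

lemma u_zero: "G.u (\<zero>\<^bsub>L\<^esub>, \<zero>\<^bsub>L\<^esub>) = \<zero>\<^bsub>G.U\<^esub>"
  using linear_map_zero[OF even_linear_linear[OF G.u_even] G.module U.module] by (simp add: g_simps)

text \<open>The defining relations of \<open>U\<close>, separated according to the two summands.\<close>

lemma U_relations:
  assumes x: "x \<in> part L p" and y: "y \<in> part L q"
  shows "U.scomm p q (i0 x) (i0 y) = \<zero>\<^bsub>G.U\<^esub>"
    and "U.scomm p q (i1 x) (i0 y) = i0 \<lbrace>x, y\<rbrace>\<^bsub>L\<^esub> \<oplus>\<^bsub>G.U\<^esub> \<sigma> x y \<odot>\<^bsub>G.U\<^esub> \<one>\<^bsub>G.U\<^esub>"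
    and "U.scomm p q (i1 x) (i1 y) = i1 \<lbrace>x, y\<rbrace>\<^bsub>L\<^esub>"
proof -
  note c [simp] = part_closed[OF x] part_closed[OF y]
  note [simp] = \<sigma>_K br_zero bilinear2_closed[OF Lbr] u_zero
  have z: "i1 z \<in> carrier G.U" "i0 z \<in> carrier G.U" if "z \<in> carrier L" for z
    using linear_map_closed[OF even_linear_linear[OF i1_even] that]
      linear_map_closed[OF even_linear_linear[OF i0_even] that] .
  show "U.scomm p q (i0 x) (i0 y) = \<zero>\<^bsub>G.U\<^esub>"
    using U_rel[OF x part_zero y part_zero] by (simp add: incl0_def incl1_def)
  show "U.scomm p q (i1 x) (i0 y) = i0 \<lbrace>x, y\<rbrace>\<^bsub>L\<^esub> \<oplus>\<^bsub>G.U\<^esub> \<sigma> x y \<odot>\<^bsub>G.U\<^esub> \<one>\<^bsub>G.U\<^esub>"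
    using U_rel[OF part_zero x y part_zero] by (simp add: incl0_def incl1_def)
  show "U.scomm p q (i1 x) (i1 y) = i1 \<lbrace>x, y\<rbrace>\<^bsub>L\<^esub>"
    using U_rel[OF part_zero x part_zero y] z(1)[of "\<lbrace>x, y\<rbrace>\<^bsub>L\<^esub>"] by (simp add: incl0_def incl1_def)
qed

abbreviation "\<alpha> \<equiv> can_alpha K L \<sigma>"
abbreviation "\<beta> \<equiv> can_beta K L \<sigma>"

lemma \<alpha>_hom: "super_hom K S G.U \<alpha>" and \<alpha>_gen: "x \<in> carrier L \<Longrightarrow> \<alpha> (s x) = i0 x"
proof -
  have "i0 x \<otimes>\<^bsub>G.U\<^esub> i0 y = sgnmul G.U (p * q) (i0 y \<otimes>\<^bsub>G.U\<^esub> i0 x)"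
    if x: "x \<in> part L p" and y: "y \<in> part L q" for x y p q
    using U_relations(1)[OF x y] U.part_closed[OF i0_part[OF x]] U.part_closed[OF i0_part[OF y]]
    by (simp add: U.scomm_def U.M.minus_zero_iff)
  from S_universal[OF G.U_superalgebra i0_even this]
  have "\<exists>\<alpha>. super_hom K R G.U \<alpha> \<and> (\<forall>x\<in>carrier L. \<alpha> (s x) = i0 x)" by (simp add: R_maps)
  then have "super_hom K R G.U \<alpha> \<and> (\<forall>x\<in>carrier L. \<alpha> (s x) = i0 x)"
    unfolding can_alpha_def Let_def by (rule someI_ex)
  then show "super_hom K S G.U \<alpha>" "x \<in> carrier L \<Longrightarrow> \<alpha> (s x) = i0 x" by (simp_all add: R_maps)
qed

lemma \<beta>_der: "even_superderivation K S G.U \<alpha> \<beta>" and \<beta>_gen: "x \<in> carrier L \<Longrightarrow> \<beta> (s x) = i1 x"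
proof -
  obtain D where "even_linear K S G.U D" "\<And>x. x \<in> carrier L \<Longrightarrow> D (s x) = i1 x"
    "\<And>p q a b. a \<in> part S p \<Longrightarrow> b \<in> part S q \<Longrightarrow>
      D (a \<otimes>\<^bsub>S\<^esub> b) = \<alpha> a \<otimes>\<^bsub>G.U\<^esub> D b \<oplus>\<^bsub>G.U\<^esub> sgnmul G.U (p * q) (\<alpha> b \<otimes>\<^bsub>G.U\<^esub> D a)"
    using derivation_exists[OF algebra_supermodule[OF S_supercommutative G.U_superalgebra \<alpha>_hom] i1_even] by blast
  then have "\<exists>\<beta>. even_superderivation K R G.U \<alpha> \<beta> \<and> (\<forall>x\<in>carrier L. \<beta> (s x) = i1 x)"
    unfolding R_maps by (intro exI[of _ D]) (simp add: even_superderivation_def)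
  then have "even_superderivation K R G.U \<alpha> \<beta> \<and> (\<forall>x\<in>carrier L. \<beta> (s x) = i1 x)"
    unfolding can_beta_def Let_def by (rule someI_ex)
  then show "even_superderivation K S G.U \<alpha> \<beta>" "x \<in> carrier L \<Longrightarrow> \<beta> (s x) = i1 x" by (simp_all add: R_maps)
qed

text \<open>
  On generators the two bracket conditions are the relations of \<open>U\<close>; they extend to homogeneous elements by the lemmas on
  biderivations, and to all of \<open>S\<close> by bilinearity.
\<close>

lemma property_P_U: "property_P K R G.U \<alpha> \<beta>"
proof -
  have \<beta>e: "even_linear K S G.U \<beta>" using \<beta>_der by (simp add: even_superderivation_def)
  note al = alg_hom_linear[OF super_hom_alg[OF \<alpha>_hom]] and bl = even_linear_linear[OF \<beta>e]
  note ac = linear_map_closed[OF al] and bc = linear_map_closed[OF bl]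
  note Lc = bilinear2_closed[OF Lbr]
  have 1: "\<alpha> (pb (s x) (s y)) = U.scomm p q (\<beta> (s x)) (\<alpha> (s y))" if "x \<in> part L p" "y \<in> part L q" for x y p q
    using that[THEN part_closed] U_relations(2)[OF that] Lc \<sigma>_K linear_map_closed[OF s_linear]
    by (simp add: pb_gen gen_bracket_def linear_map_add[OF al] linear_map_smult[OF al] \<alpha>_gen \<beta>_gen
        alg_hom_one[OF super_hom_alg[OF \<alpha>_hom]])
  have 2: "\<beta> (pb (s x) (s y)) = U.scomm p q (\<beta> (s x)) (\<beta> (s y))" if "x \<in> part L p" "y \<in> part L q" for x y p q
    using that[THEN part_closed] U_relations(3)[OF that] Lc \<sigma>_K linear_map_closed[OF s_linear]
      U.part_closed[OF i1_part[OF bracket_even[OF that]]]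
    by (simp add: pb_gen gen_bracket_def linear_map_add[OF bl] linear_map_smult[OF bl] \<beta>_gen
        derivation_one[OF S_superalgebra G.U_superalgebra \<alpha>_hom \<beta>_der])
  have a: "\<alpha> (pb x y) = super_commutator G.U (\<beta> x) (\<alpha> y)" if "x \<in> carrier S" "y \<in> carrier S" for x y
  proof (rule bilinear2_ext[OF S.super_space_axioms S.super_space_axioms _ _ _ that])
    show "bilinear2 K S S G.U (\<lambda>x y. \<alpha> (pb x y))"
      by (intro bilinear2I linear_map_comp[OF bilinear2_left[OF BD.br] al] linear_map_comp[OF bilinear2_right[OF BD.br] al])
    show "bilinear2 K S S G.U (\<lambda>x y. super_commutator G.U (\<beta> x) (\<alpha> y))"
      by (intro bilinear2I linear_map_comp[OF bl bilinear2_left[OF U.super_commutator_bilinear]]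
          linear_map_comp[OF al bilinear2_right[OF U.super_commutator_bilinear]] ac bc)
    fix p q x y assume x: "x \<in> part S p" and y: "y \<in> part S q"
    show "\<alpha> (pb x y) = super_commutator G.U (\<beta> x) (\<alpha> y)"
      unfolding U.super_commutator_part[OF even_linear_part[OF \<beta>e x] super_hom_part[OF \<alpha>_hom y]]
      by (rule BD.\<alpha>_br[OF S_generated s_part G.U_superalgebra \<alpha>_hom \<beta>_der 1 x y])
  qed
  have b: "\<beta> (pb x y) = super_commutator G.U (\<beta> x) (\<beta> y)" if "x \<in> carrier S" "y \<in> carrier S" for x y
  proof (rule bilinear2_ext[OF S.super_space_axioms S.super_space_axioms _ _ _ that])
    show "bilinear2 K S S G.U (\<lambda>x y. \<beta> (pb x y))"
      by (intro bilinear2I linear_map_comp[OF bilinear2_left[OF BD.br] bl] linear_map_comp[OF bilinear2_right[OF BD.br] bl])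
    show "bilinear2 K S S G.U (\<lambda>x y. super_commutator G.U (\<beta> x) (\<beta> y))"
      by (intro bilinear2I linear_map_comp[OF bl bilinear2_left[OF U.super_commutator_bilinear]]
          linear_map_comp[OF bl bilinear2_right[OF U.super_commutator_bilinear]] bc)
    fix p q x y assume x: "x \<in> part S p" and y: "y \<in> part S q"
    show "\<beta> (pb x y) = super_commutator G.U (\<beta> x) (\<beta> y)"
      unfolding U.super_commutator_part[OF even_linear_part[OF \<beta>e x] even_linear_part[OF \<beta>e y]]
      by (rule BD.\<beta>_br[OF S_generated s_part G.U_superalgebra \<alpha>_hom \<beta>_der 1 2 x y])
  qed
  have "lie_super_hom K R (lie_of G.U) \<beta>"
    using \<beta>e b by (simp add: lie_super_hom_def lie_of_def with_bracket_def R_simps even_linear_def linear_map_def)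
  then show ?thesis
    unfolding property_P_def R_maps R_simps using G.U_superalgebra \<alpha>_hom \<beta>_der a by blast
qed

text \<open>
  The homomorphism \<open>U \<rightarrow> B\<close> extends \<open>(u, x) \<mapsto> \<gamma>(u) + \<delta>(x)\<close>; property P of \<open>(B, \<gamma>, \<delta>)\<close> provides the relations of \<open>U\<close>.
\<close>

lemma universal_U:
  fixes B :: "('k, 'b) super"
  assumes P: "property_P K R B \<gamma> \<delta>"
  shows "\<exists>!\<phi>. \<phi> \<in> carrier G.U \<rightarrow>\<^sub>E carrier B \<and> super_hom K G.U B \<phi> \<and>
          (\<forall>x\<in>carrier R. \<phi> (\<alpha> x) = \<gamma> x \<and> \<phi> (\<beta> x) = \<delta> x)"
proof -
  have B: "superalgebra K B" and \<gamma>: "super_hom K S B \<gamma>" and \<delta>: "even_superderivation K S B \<gamma> \<delta>"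
    using P by (auto simp: property_P_def R_maps)
  interpret B: superalgebra K B by (rule B)
  have \<delta>e: "even_linear K S B \<delta>" using \<delta> by (simp add: even_superderivation_def)
  have \<gamma>br: "\<gamma> (pb x y) = super_commutator B (\<delta> x) (\<gamma> y)" if "x \<in> carrier S" "y \<in> carrier S" for x y
    using P that by (simp add: property_P_def R_simps)
  have \<delta>br: "\<delta> (pb x y) = super_commutator B (\<delta> x) (\<delta> y)" if "x \<in> carrier S" "y \<in> carrier S" for x y
    using P that by (simp add: property_P_def R_simps lie_super_hom_def lie_of_def with_bracket_def)
  note \<gamma>l = alg_hom_linear[OF super_hom_alg[OF \<gamma>]] and \<delta>l = even_linear_linear[OF \<delta>e]
  note \<gamma>s = linear_map_comp[OF s_linear \<gamma>l] and \<delta>s = linear_map_comp[OF s_linear \<delta>l]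
  note \<gamma>p = super_hom_part[OF \<gamma> s_part] and \<delta>p = even_linear_part[OF \<delta>e s_part]
  define f where "f = (\<lambda>(u, x). \<gamma> (s u) \<oplus>\<^bsub>B\<^esub> \<delta> (s x))"
  have fl: "linear_map K g B f"
  proof (rule linear_mapI)
    note [simp] = linear_map_closed[OF \<gamma>s] linear_map_closed[OF \<delta>s]
    show "f a \<in> carrier B" if "a \<in> carrier g" for a using that by (auto simp: f_def g_simps)
    show "f (a \<oplus>\<^bsub>g\<^esub> b) = f a \<oplus>\<^bsub>B\<^esub> f b" if "a \<in> carrier g" "b \<in> carrier g" for a b
      using that by (auto simp: f_def g_simps linear_map_add[OF \<gamma>s] linear_map_add[OF \<delta>s] B.M.a_ac)
    show "f (c \<odot>\<^bsub>g\<^esub> a) = c \<odot>\<^bsub>B\<^esub> f a" if "c \<in> carrier K" "a \<in> carrier g" for c a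
      using that by (auto simp: f_def g_simps linear_map_smult[OF \<gamma>s] linear_map_smult[OF \<delta>s] B.smult_r_distr)
  qed
  have fe: "even_linear K g B f"
    by (rule even_linearI[OF fl]) (auto simp: f_def g_simps intro!: B.part_add \<gamma>p \<delta>p)
  have rel: "B.scomm p q (f a) (f b) = f \<lbrace>a, b\<rbrace>\<^bsub>g\<^esub> \<oplus>\<^bsub>B\<^esub> \<sigma>g a b \<odot>\<^bsub>B\<^esub> \<one>\<^bsub>B\<^esub>"
    if ab: "a \<in> part g p" "b \<in> part g q" for a b p q
  proof -
    obtain u x v y where e: "a = (u, x)" "b = (v, y)"
      and u: "u \<in> part L p" and x: "x \<in> part L p" and v: "v \<in> part L q" and y: "y \<in> part L q"
      using ab by (auto simp: g_simps)
    have \<gamma>gen_bracket: "\<gamma> (gen_bracket z w) = \<gamma> (s \<lbrace>z, w\<rbrace>\<^bsub>L\<^esub>) \<oplus>\<^bsub>B\<^esub> \<sigma> z w \<odot>\<^bsub>B\<^esub> \<one>\<^bsub>B\<^esub>" if "z \<in> carrier L" "w \<in> carrier L" for z w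
      using that bilinear2_closed[OF Lbr that] linear_map_closed[OF s_linear] \<sigma>_K
      by (simp add: gen_bracket_def linear_map_add[OF \<gamma>l] linear_map_smult[OF \<gamma>l] alg_hom_one[OF super_hom_alg[OF \<gamma>]])
    note c [simp] = part_closed[OF u] part_closed[OF x] part_closed[OF v] part_closed[OF y]
    note [simp] = linear_map_closed[OF s_linear] linear_map_closed[OF \<gamma>s] linear_map_closed[OF \<delta>s]
      bilinear2_closed[OF Lbr] \<sigma>_K B.scomm_closed bilinear2_closed[OF gen_bracket_bilinear] linear_map_closed[OF \<gamma>l] linear_map_closed[OF \<delta>l]
    have 1: "B.scomm p q (\<gamma> (s u)) (\<gamma> (s v)) = \<zero>\<^bsub>B\<^esub>"
    proof -
      have "\<gamma> (s u) \<otimes>\<^bsub>B\<^esub> \<gamma> (s v) = sgnmul B (p * q) (\<gamma> (s v) \<otimes>\<^bsub>B\<^esub> \<gamma> (s u))"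
        using s_comm[OF u v] by (simp add: linear_map_sgn[OF \<gamma>l S.module B.module]
            flip: alg_hom_mult[OF super_hom_alg[OF \<gamma>]])
      then show ?thesis by (simp add: B.scomm_def B.M.minus_zero_iff)
    qed
    have 2: "B.scomm p q (\<delta> (s x)) (\<gamma> (s v)) = \<gamma> (s \<lbrace>x, v\<rbrace>\<^bsub>L\<^esub>) \<oplus>\<^bsub>B\<^esub> \<sigma> x v \<odot>\<^bsub>B\<^esub> \<one>\<^bsub>B\<^esub>"
      using \<gamma>br[of "s x" "s v"] B.super_commutator_part[OF \<delta>p[OF x] \<gamma>p[OF v]] by (simp add: pb_gen \<gamma>gen_bracket)
    \<comment> \<open>property P gives the commutator in the other order; both it and the Poisson bracket are skew\<close>
    have "B.scomm p q (\<gamma> (s u)) (\<delta> (s y)) = \<ominus>\<^bsub>B\<^esub> sgnmul B (p * q) (\<gamma> (pb (s y) (s u)))"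
      using \<gamma>br[of "s y" "s u"] B.super_commutator_part[OF \<delta>p[OF y] \<gamma>p[OF u]]
        B.scomm_skew[of "\<gamma> (s u)" "\<delta> (s y)" p q] by simp
    also have "\<dots> = \<gamma> (pb (s u) (s y))"
      unfolding BD.br_skew[OF s_part[OF u] s_part[OF y]]
      by (simp add: linear_map_neg[OF \<gamma>l S.module B.module] linear_map_sgn[OF \<gamma>l S.module B.module] pb_gen)
    finally have 3: "B.scomm p q (\<gamma> (s u)) (\<delta> (s y)) = \<gamma> (s \<lbrace>u, y\<rbrace>\<^bsub>L\<^esub>) \<oplus>\<^bsub>B\<^esub> \<sigma> u y \<odot>\<^bsub>B\<^esub> \<one>\<^bsub>B\<^esub>"
      by (simp add: pb_gen \<gamma>gen_bracket)
    have 4: "B.scomm p q (\<delta> (s x)) (\<delta> (s y)) = \<delta> (s \<lbrace>x, y\<rbrace>\<^bsub>L\<^esub>)"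
      using \<delta>br[of "s x" "s y"] B.super_commutator_part[OF \<delta>p[OF x] \<delta>p[OF y]]
      by (simp add: pb_gen gen_bracket_def linear_map_add[OF \<delta>l] linear_map_smult[OF \<delta>l]
          derivation_one[OF S_superalgebra B \<gamma> \<delta>])
    show ?thesis
      by (simp add: e f_def g_bracket[OF u x v y] g_simps B.scomm_simps 1 2 3 4 linear_map_add[OF \<gamma>s]
          B.smult_l_distr B.M.a_ac)
  qed
  obtain \<psi> where \<psi>: "super_hom K G.U B \<psi>" "\<And>a. a \<in> carrier g \<Longrightarrow> \<psi> (G.u a) = f a"
    using G.U_universal[OF B fe rel[unfolded B.scomm_def]] by blast
  note zero_s = linear_map_zero[OF \<gamma>s module B.module] linear_map_zero[OF \<delta>s module B.module]
  have \<psi>0: "\<psi> (i0 x) = \<gamma> (s x)" and \<psi>1: "\<psi> (i1 x) = \<delta> (s x)" if "x \<in> carrier L" for x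
    using that \<psi>(2)[of "incl0 L x"] \<psi>(2)[of "incl1 L x"] linear_map_closed[OF \<gamma>s] linear_map_closed[OF \<delta>s]
    by (simp_all add: incl0_def incl1_def g_simps f_def zero_s)
  \<comment> \<open>uniqueness as a function requires a fixed value outside the carrier\<close>
  define \<phi> where "\<phi> = restrict \<psi> (carrier G.U)"
  have \<phi>: "super_hom K G.U B \<phi>"
    using \<psi>(1) by (auto simp: super_hom_def even_linear_def linear_map_def \<phi>_def U.part_closed Pi_iff image_subset_iff)
  have \<phi>E: "\<phi> \<in> carrier G.U \<rightarrow>\<^sub>E carrier B"
    using alg_hom_closed[OF super_hom_alg[OF \<psi>(1)]] by (auto simp: \<phi>_def)
  note \<phi>h = super_hom_alg[OF \<phi>]
  have i_closed: "i0 x \<in> carrier G.U" "i1 x \<in> carrier G.U" if "x \<in> carrier L" for x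
    using linear_map_closed[OF even_linear_linear[OF i1_even] that]
      linear_map_closed[OF even_linear_linear[OF i0_even] that] by simp_all
  have \<phi>0: "\<phi> (i0 x) = \<gamma> (s x)" and \<phi>1: "\<phi> (i1 x) = \<delta> (s x)" if "x \<in> carrier L" for x
    using that i_closed[OF that] \<psi>0[OF that] \<psi>1[OF that] by (simp_all add: \<phi>_def)
  note ah = super_hom_alg[OF \<alpha>_hom]
  have \<beta>e: "even_linear K S G.U \<beta>" using \<beta>_der by (simp add: even_superderivation_def)
  note \<beta>l = even_linear_linear[OF \<beta>e]
  have \<phi>\<alpha>: "\<phi> (\<alpha> a) = \<gamma> a" if "a \<in> carrier S" for a
  proof (rule alg_hom_unique[OF S_superalgebra B S_generated _ super_hom_alg[OF \<gamma>] _ that])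
    show "alg_hom K S B (\<lambda>a. \<phi> (\<alpha> a))"
      using linear_map_comp[OF alg_hom_linear[OF ah] alg_hom_linear[OF \<phi>h]]
      by (simp add: alg_hom_def[of K S B] alg_hom_mult[OF ah] alg_hom_mult[OF \<phi>h] alg_hom_one[OF ah]
          alg_hom_one[OF \<phi>h] alg_hom_closed[OF ah])
  qed (simp add: \<alpha>_gen \<phi>0 part_closed)
  have \<phi>\<beta>: "\<phi> (\<beta> a) = \<delta> a" if "a \<in> carrier S" for a
  proof (rule S.linear_map_ext[OF linear_map_comp[OF \<beta>l alg_hom_linear[OF \<phi>h]] \<delta>l _ that])
    fix p a assume "a \<in> part S p"
    with S_generated show "\<phi> (\<beta> a) = \<delta> a"
    proof (induction rule: graded_generatedD)
      case (zero p)
      show ?case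
        by (simp add: linear_map_zero[OF \<beta>l S.module U.module] linear_map_zero[OF \<delta>l S.module B.module]
            linear_map_zero[OF alg_hom_linear[OF \<phi>h] U.module B.module])
    next
      case one
      show ?case
        by (simp add: derivation_one[OF S_superalgebra B \<gamma> \<delta>]
            derivation_one[OF S_superalgebra G.U_superalgebra \<alpha>_hom \<beta>_der]
            linear_map_zero[OF alg_hom_linear[OF \<phi>h] U.module B.module])
    next
      case (gen p x)
      then show ?case by (simp add: \<beta>_gen \<phi>1 part_closed)
    next
      case (add p a b)
      then show ?case
        by (simp add: S.part_closed linear_map_add[OF \<beta>l] linear_map_add[OF \<delta>l]
            linear_map_add[OF alg_hom_linear[OF \<phi>h]] linear_map_closed[OF \<beta>l])
    next
      case (smult p c a)
      then show ?case
        by (simp add: S.part_closed linear_map_smult[OF \<beta>l] linear_map_smult[OF \<delta>l]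
            linear_map_smult[OF alg_hom_linear[OF \<phi>h]] linear_map_closed[OF \<beta>l])
    next
      case (mult p q a b)
      have 1: "\<beta> (a \<otimes>\<^bsub>S\<^esub> b) = \<alpha> a \<otimes>\<^bsub>G.U\<^esub> \<beta> b \<oplus>\<^bsub>G.U\<^esub> sgnmul G.U (p * q) (\<alpha> b \<otimes>\<^bsub>G.U\<^esub> \<beta> a)"
        using \<beta>_der mult(1,2) unfolding even_superderivation_def by blast
      have 2: "\<delta> (a \<otimes>\<^bsub>S\<^esub> b) = \<gamma> a \<otimes>\<^bsub>B\<^esub> \<delta> b \<oplus>\<^bsub>B\<^esub> sgnmul B (p * q) (\<gamma> b \<otimes>\<^bsub>B\<^esub> \<delta> a)"
        using \<delta> mult(1,2) unfolding even_superderivation_def by blast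
      show ?case
        unfolding 1 2 using mult(3,4) mult(1,2)[THEN S.part_closed]
        by (simp add: linear_map_add[OF alg_hom_linear[OF \<phi>h]] alg_hom_mult[OF \<phi>h] \<phi>\<alpha>
            linear_map_sgn[OF alg_hom_linear[OF \<phi>h] U.module B.module] linear_map_closed[OF \<beta>l] alg_hom_closed[OF ah])
    qed
  qed
  show ?thesis
  proof (rule ex1I[of _ \<phi>])
    show "\<phi> \<in> carrier G.U \<rightarrow>\<^sub>E carrier B \<and> super_hom K G.U B \<phi> \<and>
          (\<forall>x\<in>carrier R. \<phi> (\<alpha> x) = \<gamma> x \<and> \<phi> (\<beta> x) = \<delta> x)"
      using \<phi>E \<phi> \<phi>\<alpha> \<phi>\<beta> by (simp add: R_simps)
    fix \<chi> assume \<chi>: "\<chi> \<in> carrier G.U \<rightarrow>\<^sub>E carrier B \<and> super_hom K G.U B \<chi> \<and>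
          (\<forall>x\<in>carrier R. \<chi> (\<alpha> x) = \<gamma> x \<and> \<chi> (\<beta> x) = \<delta> x)"
    then have \<chi>h: "alg_hom K G.U B \<chi>" by (simp add: super_hom_alg)
    have eq: "\<chi> (G.u a) = \<phi> (G.u a)" if a: "a \<in> part g p" for a p
    proof -
      obtain u x where ux: "a = (u, x)" "u \<in> carrier L" "x \<in> carrier L"
        using a by (auto simp: g_simps part_closed)
      have "\<chi> (\<alpha> (s u)) = \<phi> (\<alpha> (s u))" "\<chi> (\<beta> (s x)) = \<phi> (\<beta> (s x))"
        using \<chi> ux linear_map_closed[OF s_linear] by (simp_all add: R_simps \<phi>\<alpha> \<phi>\<beta>)
      then show ?thesis
        using ux i_closed by (simp add: u_split \<alpha>_gen \<beta>_gen linear_map_add[OF alg_hom_linear[OF \<chi>h]]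
            linear_map_add[OF alg_hom_linear[OF \<phi>h]])
    qed
    have "\<chi> z = \<phi> z" if "z \<in> carrier G.U" for z
      by (rule alg_hom_unique[OF G.U_superalgebra B G.U_generated \<chi>h \<phi>h eq that])
    then show "\<chi> = \<phi>" using \<chi> \<phi>E by (meson PiE_ext)
  qed
qed

end

theorem proposition3p15:
  fixes K :: "('k, 'm) ring_scheme"
    and L :: "('k, 'v, 'n) bsuper_scheme"
    and \<sigma> :: "'v \<Rightarrow> 'v \<Rightarrow> 'k"
  assumes "field K" and "char_zero K"
    and "lie_superalgebra K L"
    and "cocycle K L \<sigma>"
  shows "universal_enveloping TYPE('b) K (PS K L \<sigma>)
           (sridharan K (semidirect_ad L) (semidirect_cocycle K \<sigma>))
           (can_alpha K L \<sigma>) (can_beta K L \<sigma>)"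
proof -
  interpret K: field K by fact
  interpret L: cocycle K L \<sigma> by fact
  have "[(2::nat)] \<cdot>\<^bsub>K\<^esub> \<one>\<^bsub>K\<^esub> \<noteq> \<zero>\<^bsub>K\<^esub>"
    using assms(2) by (auto simp: char_zero_def)
  then have two: "\<one>\<^bsub>K\<^esub> \<oplus>\<^bsub>K\<^esub> \<one>\<^bsub>K\<^esub> \<noteq> \<zero>\<^bsub>K\<^esub>"
    by (simp add: numeral_2_eq_2)
  interpret symplectic K L \<sigma> by unfold_locales (rule two)
  show ?thesis
    unfolding universal_enveloping_def
    using PS_spec property_P_U universal_U by blast
qed

end
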